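(* Let $n,\ell$ be positive integers and $\varepsilon>0$. There exists a family $\mathcal{F}$ of functions from $\{0,1\}^n$ to $\{0,1\}^\ell$ with seed length $$s := \log|\mathcal{F}| = 2\lfloor \ell + \log(n/\ell) + \log(1/\varepsilon^2) - 1\rfloor$$ such that for every classical-quantum state $\rho_{XE}=\sum_{x\in\{0,1\}^n}|x\rangle\langle x|_X\otimes\rho_E^{[x]}$ (with $\operatorname{tr}\rho_E^{[x]}$ the probability of $x$, $\mathcal{H}_E$ finite-dimensional), the state $\rho_{FZE}$ obtained by applying a uniformly random $f\in\mathcal{F}$ satisfies $$e := d_u(Z|FE)_\rho \le 3\varepsilon + \frac12\sqrt{2^{\ell - H^\varepsilon_{\min}(X|E)_\rho + \log(\frac{2}{\varepsilon^2}+1)}}.$$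
   Context: $\log$ is binary. For a family $\mathcal{F}$ of functions $\{0,1\}^n\to\{0,1\}^\ell$, $\rho_{FZE} = \sum_{f}\sum_{z} \frac{1}{|\mathcal{F}|}|f\rangle\langle f|_F\otimes|z\rangle\langle z|_Z\otimes\rho_E^{[f,z]}$ with $\rho_E^{[f,z]}=\sum_{x:f(x)=z}\rho_E^{[x]}$. $\mathcal{S}_\le(\mathcal{H})$: positive semidefinite $\rho$ with $0<\operatorname{tr}\rho\le1$. $\bar F(\rho,\tau)=\operatorname{tr}|\sqrt\rho\sqrt\tau|+\sqrt{(1-\operatorname{tr}\rho)(1-\operatorname{tr}\tau)}$; purified distance $P=\sqrt{1-\bar F^2}$; $\mathcal{B}^\varepsilon(\rho)=\{\tilde\rho\in\mathcal{S}_\le: P(\rho,\tilde\rho)\le\varepsilon\}$. $H_{\min}(A|B)_\rho=\max_{\sigma_B}\sup\{\lambda:\rho_{AB}\le2^{-\lambda}\mathbb{1}_A\otimes\sigma_B\}$ (max over normalized $\sigma_B$); $H^\varepsilon_{\min}(A|B)_\rho=\max_{\tilde\rho_{AB}\in\mathcal{B}^\varepsilon(\rho_{AB})}H_{\min}(A|B)_{\tilde\rho}$. $d_u(A|B)_\rho=\min_{\sigma_B}\frac12\|\rho_{AB}-\omega_A\otimes\sigma_B\|_1$, $\omega_A=\mathbb{1}_A/\dim\mathcal{H}_A$, minimum over positive semidefinite $\sigma_B$ with $\operatorname{tr}\sigma_B=\operatorname{tr}\rho_B$; in $d_u(Z|FE)$ the conditioning system is $F$ and $E$ jointly.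
   Formalization: Proved for s ≥ 0 (for s < 0, e.g. n=ℓ=1, ε=2, no family can have log|F| = s); F is a family indexed by 2^s seeds, repetitions allowed; for ε ≥ 1, where the smooth min-entropy is infinite, its value is left unspecified and the bound is trivial as d_u ≤ 1. *)

theory Defs
  imports Complex_Main "Jordan_Normal_Form.Matrix"
begin

(* Operators on C^d are d x d complex matrices (JNF 'complex mat').
   Classical registers {0,1}^k are encoded as {0..<2^k} (binary encoding).
   Tensor products use the Kronecker convention: index (i,k) of A (x) B is i*dim B + k. *)

definition adj :: "complex mat \<Rightarrow> complex mat" where
  "adj M = mat (dim_col M) (dim_row M) (\<lambda>(i,j). cnj (M $$ (j,i)))"

definition mtr :: "complex mat \<Rightarrow> complex" where
  "mtr M = (\<Sum>i<dim_row M. M $$ (i,i))"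

definition kron :: "complex mat \<Rightarrow> complex mat \<Rightarrow> complex mat" where
  "kron A B = mat (dim_row A * dim_row B) (dim_col A * dim_col B)
      (\<lambda>(i,j). A $$ (i div dim_row B, j div dim_col B) * B $$ (i mod dim_row B, j mod dim_col B))"

definition idm :: "nat \<Rightarrow> complex mat" where
  "idm d = mat d d (\<lambda>(i,j). if i = j then 1 else 0)"

definition ketbra :: "nat \<Rightarrow> nat \<Rightarrow> complex mat" where
  "ketbra d x = mat d d (\<lambda>(i,j). if i = x \<and> j = x then 1 else 0)"

definition msum :: "nat \<Rightarrow> ('i \<Rightarrow> complex mat) \<Rightarrow> 'i set \<Rightarrow> complex mat" where
  "msum d F I = mat d d (\<lambda>(i,j). \<Sum>x\<in>I. F x $$ (i,j))"

definition psd :: "nat \<Rightarrow> complex mat \<Rightarrow> bool" where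
  "psd d A \<longleftrightarrow> A \<in> carrier_mat d d \<and> adj A = A \<and>
     (\<forall>v :: nat \<Rightarrow> complex. 0 \<le> Re (\<Sum>i<d. \<Sum>j<d. cnj (v i) * A $$ (i,j) * v j))"

definition loewner_le :: "nat \<Rightarrow> complex mat \<Rightarrow> complex mat \<Rightarrow> bool" where
  "loewner_le d A B \<longleftrightarrow> A \<in> carrier_mat d d \<and> B \<in> carrier_mat d d \<and> psd d (B - A)"

definition msqrt :: "nat \<Rightarrow> complex mat \<Rightarrow> complex mat" where
  "msqrt d A = (THE B. psd d B \<and> B * B = A)"

definition mabs :: "nat \<Rightarrow> complex mat \<Rightarrow> complex mat" where
  "mabs d M = msqrt d (adj M * M)"

definition tnorm :: "nat \<Rightarrow> complex mat \<Rightarrow> real" where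
  "tnorm d M = Re (mtr (mabs d M))"

definition substate :: "nat \<Rightarrow> complex mat \<Rightarrow> bool" where
  "substate d \<rho> \<longleftrightarrow> psd d \<rho> \<and> 0 < Re (mtr \<rho>) \<and> Re (mtr \<rho>) \<le> 1"

definition gen_fid :: "nat \<Rightarrow> complex mat \<Rightarrow> complex mat \<Rightarrow> real" where
  "gen_fid d \<rho> \<tau> = tnorm d (msqrt d \<rho> * msqrt d \<tau>)
      + sqrt ((1 - Re (mtr \<rho>)) * (1 - Re (mtr \<tau>)))"

definition pdist :: "nat \<Rightarrow> complex mat \<Rightarrow> complex mat \<Rightarrow> real" where
  "pdist d \<rho> \<tau> = sqrt (1 - (gen_fid d \<rho> \<tau>)\<^sup>2)"

definition Hmin :: "nat \<Rightarrow> nat \<Rightarrow> complex mat \<Rightarrow> real" where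
  "Hmin dA dB \<rho> = Sup {lam. \<exists>\<sigma>. psd dB \<sigma> \<and> mtr \<sigma> = 1 \<and>
       loewner_le (dA * dB) \<rho> ((2 powr (- lam)) \<cdot>\<^sub>m kron (idm dA) \<sigma>)}"

definition Hmin_smooth :: "nat \<Rightarrow> nat \<Rightarrow> real \<Rightarrow> complex mat \<Rightarrow> real" where
  "Hmin_smooth dA dB eps \<rho> = Sup {Hmin dA dB \<rho>' | \<rho>'.
       substate (dA * dB) \<rho>' \<and> pdist (dA * dB) \<rho> \<rho>' \<le> eps}"

definition d_u :: "nat \<Rightarrow> nat \<Rightarrow> complex mat \<Rightarrow> real" where
  "d_u dA dB \<rho> = Inf {tnorm (dA * dB) (\<rho> - kron ((1 / of_nat dA) \<cdot>\<^sub>m idm dA) \<sigma>) / 2 | \<sigma>.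
       psd dB \<sigma> \<and> mtr \<sigma> = mtr \<rho>}"

definition cq_data :: "nat \<Rightarrow> nat \<Rightarrow> (nat \<Rightarrow> complex mat) \<Rightarrow> bool" where
  "cq_data n dE \<rho>E \<longleftrightarrow> (\<forall>x<2^n. psd dE (\<rho>E x)) \<and> (\<Sum>x<2^n. mtr (\<rho>E x)) = 1"

definition rho_XE :: "nat \<Rightarrow> nat \<Rightarrow> (nat \<Rightarrow> complex mat) \<Rightarrow> complex mat" where
  "rho_XE n dE \<rho>E = msum (2^n * dE) (\<lambda>x. kron (ketbra (2^n) x) (\<rho>E x)) {..<2^n}"

definition rho_E_fz :: "nat \<Rightarrow> nat \<Rightarrow> (nat \<Rightarrow> complex mat) \<Rightarrow> (nat \<Rightarrow> nat) \<Rightarrow> nat \<Rightarrow> complex mat" where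
  "rho_E_fz n dE \<rho>E f z = msum dE \<rho>E {x. x < 2^n \<and> f x = z}"

(* the state \<rho>_FZE for the family Fam indexed by seeds k < 2^S, with the
   systems written in the order Z (x) F (x) E (so that Z is the first factor
   and FE the conditioning system in d_u) *)
definition rho_ZFE :: "nat \<Rightarrow> nat \<Rightarrow> nat \<Rightarrow> nat \<Rightarrow> (nat \<Rightarrow> nat \<Rightarrow> nat) \<Rightarrow> (nat \<Rightarrow> complex mat) \<Rightarrow> complex mat" where
  "rho_ZFE n l S dE Fam \<rho>E = msum (2^l * (2^S * dE))
      (\<lambda>(z,k). (1 / 2^S) \<cdot>\<^sub>m kron (ketbra (2^l) z) (kron (ketbra (2^S) k) (rho_E_fz n dE \<rho>E (Fam k) z)))
      ({..<2^l} \<times> {..<2^S})"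

end

theory Submission
  imports "HOL-Library.Z2" "HOL-Algebra.Algebraic_Closure_Type" "HOL-Analysis.Convex"
    "Jordan_Normal_Form.Schur_Decomposition" Defs
begin

no_notation var (\<open>X\<index>\<close>)
no_notation fps_nth (infixl \<open>$\<close> 75)

text \<open>
  All matrices are embedded into the algebra of finitely supported complex matrices over the
  naturals with the Hilbert--Schmidt inner product, where no dimensions have to be tracked. The trace
  norm of \<open>M\<close> is the real trace of \<open>C M\<close> for some contraction \<open>C\<close>, so \<open>d_u\<close> is bounded by
  traces against contractions \<open>U\<close>.

  Let \<open>\<rho>'\<close> be \<open>\<epsilon>\<close>-close to \<open>\<rho>\<close> in purified distance with \<open>\<rho>' \<le> 2 powr - lam \<cdot> 1 \<otimes> \<sigma>\<close>. The Fuchs--van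
  de Graaf argument, carried out against block diagonal contractions (so that \<open>\<rho>'\<close> need not be
  classical-quantum), replaces \<open>\<rho>\<close> by the diagonal blocks \<open>\<rho>'\<^sub>x\<close> of \<open>\<rho>'\<close> at cost about \<open>\<epsilon>\<close>. For the
  blocks, Cauchy--Schwarz with the weight \<open>\<tau> = \<rho>'\<^sub>E + \<epsilon>\<^sup>2 \<sigma>\<close> reduces the distance to the collision
  term of the matrices \<open>V \<rho>'\<^sub>x V\<close>, where \<open>V\<close> is the fourth root of the pseudo-inverse of \<open>\<tau>\<close>.
  The inequalities \<open>\<rho>'\<^sub>x \<le> 2 powr - lam / \<epsilon>\<^sup>2 \<cdot> \<tau>\<close> and \<open>\<rho>'\<^sub>E \<le> \<tau>\<close> bound the diagonal and the off-diagonal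
  collisions; since the trace of \<open>\<tau>\<close> is at most \<open>1 + \<epsilon>\<^sup>2\<close>, this gives the factor \<open>2 / \<epsilon>\<^sup>2 + 1\<close>.

  The hash family is polynomial evaluation over the field with \<open>2^m\<close> elements, followed by
  multiplication with a random field element and truncation to \<open>l\<close> bits. For \<open>\<epsilon> \<ge> 1/3\<close> or \<open>n < l\<close> the bound
  exceeds \<open>1\<close> and every family works.
\<close>

section \<open>Finitely supported complex matrices\<close>

definition fbounded :: "(nat \<Rightarrow> nat \<Rightarrow> complex) \<Rightarrow> nat \<Rightarrow> bool" where
  "fbounded f N \<longleftrightarrow> (\<forall>i j. N \<le> i \<or> N \<le> j \<longrightarrow> f i j = 0)"

lemma fbounded_mono: "fbounded f N \<Longrightarrow> N \<le> N' \<Longrightarrow> fbounded f N'"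
  by (auto simp: fbounded_def)

typedef fmat = "{f. \<exists>N. fbounded f N}"
  morphisms entry Abs_fmat
  by (rule exI[of _ "\<lambda>_ _. 0"]) (auto simp: fbounded_def)

setup_lifting type_definition_fmat

lemma fmat_eqI: "(\<And>i j. entry A i j = entry B i j) \<Longrightarrow> A = B"
  by (auto simp: entry_inject[symmetric])

text \<open>Three matrices cover the associative and distributive laws; where fewer are involved,
  one of them is repeated.\<close>

lemma ex_common_bound:
  "\<exists>N. fbounded (entry A) N \<and> fbounded (entry B) N \<and> fbounded (entry C) N"
proof -
  obtain a where "fbounded (entry A) a" using entry[of A] by auto
  moreover obtain b where "fbounded (entry B) b" using entry[of B] by auto
  moreover obtain c where "fbounded (entry C) c" using entry[of C] by auto
  ultimately show ?thesis
    by (intro exI[of _ "max a (max b c)"]) (auto intro: fbounded_mono)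
qed

lemma obtain_bound:
  obtains N where "fbounded (entry A) N" "fbounded (entry B) N" "fbounded (entry C) N"
  using ex_common_bound[of A B C] by blast

text \<open>The class has no unit because the infinite identity matrix has infinite support. The
  corner identities \<open>projf d\<close> act as local units instead.\<close>

instantiation fmat :: real_algebra
begin

lift_definition zero_fmat :: fmat is "\<lambda>_ _. 0" by (auto simp: fbounded_def)

lift_definition plus_fmat :: "fmat \<Rightarrow> fmat \<Rightarrow> fmat" is "\<lambda>f g i j. f i j + g i j"
proof -
  fix f g :: "nat \<Rightarrow> nat \<Rightarrow> complex"
  assume "\<exists>N. fbounded f N" "\<exists>N. fbounded g N"
  then obtain a b where "fbounded f a" "fbounded g b" by auto
  then show "\<exists>N. fbounded (\<lambda>i j. f i j + g i j) N"
    by (intro exI[of _ "max a b"]) (auto simp: fbounded_def)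
qed

lift_definition minus_fmat :: "fmat \<Rightarrow> fmat \<Rightarrow> fmat" is "\<lambda>f g i j. f i j - g i j"
proof -
  fix f g :: "nat \<Rightarrow> nat \<Rightarrow> complex"
  assume "\<exists>N. fbounded f N" "\<exists>N. fbounded g N"
  then obtain a b where "fbounded f a" "fbounded g b" by auto
  then show "\<exists>N. fbounded (\<lambda>i j. f i j - g i j) N"
    by (intro exI[of _ "max a b"]) (auto simp: fbounded_def)
qed

lift_definition uminus_fmat :: "fmat \<Rightarrow> fmat" is "\<lambda>f i j. - f i j"
  by (auto simp: fbounded_def)

lift_definition scaleR_fmat :: "real \<Rightarrow> fmat \<Rightarrow> fmat" is "\<lambda>c f i j. of_real c * f i j"
  by (metis (no_types, lifting) fbounded_def mult_zero_right)

text \<open>Summing over the support of row \<open>i\<close> avoids the choice of a bound;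
  \<open>entry_times\<close> replaces the index set by \<open>{..<N}\<close> for any bound
  \<open>N\<close> of the left factor.\<close>

lift_definition times_fmat :: "fmat \<Rightarrow> fmat \<Rightarrow> fmat" is
  "\<lambda>f g i j. \<Sum>k\<in>{k. f i k \<noteq> 0}. f i k * g k j"
proof -
  fix f g :: "nat \<Rightarrow> nat \<Rightarrow> complex"
  assume "\<exists>N. fbounded f N" "\<exists>N. fbounded g N"
  then obtain a b where "fbounded f a" "fbounded g b" by auto
  then show "\<exists>N. fbounded (\<lambda>i j. \<Sum>k\<in>{k. f i k \<noteq> 0}. f i k * g k j) N"
    by (intro exI[of _ "max a b"]) (auto simp: fbounded_def)
qed

lemma entry_times: "fbounded (entry A) N \<Longrightarrow> entry (A * B) i j = (\<Sum>k<N. entry A i k * entry B k j)"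
  unfolding times_fmat.rep_eq
  by (rule sum.mono_neutral_left) (auto simp: fbounded_def, meson not_le)

lemma fbounded_times: "fbounded (entry A) N \<Longrightarrow> fbounded (entry B) N \<Longrightarrow> fbounded (entry (A * B)) N"
  by (auto simp: fbounded_def entry_times intro!: sum.neutral)

lemma fbounded_plus: "fbounded (entry A) N \<Longrightarrow> fbounded (entry B) N \<Longrightarrow> fbounded (entry (A + B)) N"
  by (auto simp: fbounded_def plus_fmat.rep_eq)

lemma fbounded_scaleR: "fbounded (entry A) N \<Longrightarrow> fbounded (entry (c *\<^sub>R A)) N"
  by (auto simp: fbounded_def scaleR_fmat.rep_eq)

instance
proof
  fix A B C :: fmat and c c' :: real
  show "A + B + C = A + (B + C)" by transfer (auto simp: algebra_simps)
  show "A + B = B + A" by transfer (auto simp: algebra_simps)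
  show "0 + A = A" by transfer auto
  show "- A + A = 0" by transfer auto
  show "A - B = A + - B" by transfer auto
  show "c *\<^sub>R (A + B) = c *\<^sub>R A + c *\<^sub>R B" by transfer (auto simp: algebra_simps)
  show "(c + c') *\<^sub>R A = c *\<^sub>R A + c' *\<^sub>R A" by transfer (auto simp: algebra_simps)
  show "c *\<^sub>R c' *\<^sub>R A = (c * c') *\<^sub>R A" by transfer (auto simp: algebra_simps)
  show "1 *\<^sub>R A = A" by transfer auto
  obtain N where N: "fbounded (entry A) N" "fbounded (entry B) N" "fbounded (entry C) N"
    by (rule obtain_bound)
  show "A * B * C = A * (B * C)"
    by (rule fmat_eqI)
      (simp add: entry_times[OF fbounded_times[OF N(1,2)]] entry_times[OF N(1)] entry_times[OF N(2)]
        sum_distrib_left sum_distrib_right mult.assoc, subst sum.swap, rule refl)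
  show "(A + B) * C = A * C + B * C"
    by (rule fmat_eqI) (simp add: entry_times[OF fbounded_plus[OF N(1,2)]] entry_times[OF N(1)]
        entry_times[OF N(2)] plus_fmat.rep_eq algebra_simps sum.distrib)
  show "A * (B + C) = A * B + A * C"
    by (rule fmat_eqI) (simp add: entry_times[OF N(1)] plus_fmat.rep_eq algebra_simps sum.distrib)
  show "c *\<^sub>R A * B = c *\<^sub>R (A * B)"
    by (rule fmat_eqI) (simp add: entry_times[OF fbounded_scaleR[OF N(1)]] entry_times[OF N(1)]
        scaleR_fmat.rep_eq sum_distrib_left algebra_simps)
  show "A * c *\<^sub>R B = c *\<^sub>R (A * B)"
    by (rule fmat_eqI) (simp add: entry_times[OF N(1)] scaleR_fmat.rep_eq sum_distrib_left algebra_simps)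
qed

end

section \<open>Adjoint and trace\<close>

lift_definition adjf :: "fmat \<Rightarrow> fmat" ("_\<^sup>\<dagger>" [1000] 1000) is "\<lambda>f i j. cnj (f j i)"
  by (metis (no_types, lifting) fbounded_def complex_cnj_zero)

text \<open>Taking the real part makes \<open>rtr (A\<^sup>\<dagger> * B)\<close> a symmetric real
  inner product, so that the theory of \<open>real_inner\<close>, in particular Cauchy--Schwarz,
  applies.\<close>

lift_definition rtr :: "fmat \<Rightarrow> real" is "\<lambda>f. Re (\<Sum>i\<in>{i. f i i \<noteq> 0}. f i i)" .

lemma rtr_bounded: "fbounded (entry A) N \<Longrightarrow> rtr A = Re (\<Sum>i<N. entry A i i)"
  unfolding rtr.rep_eq
  by (rule arg_cong[of _ _ Re], rule sum.mono_neutral_left) (auto simp: fbounded_def, meson not_le)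

lemma fbounded_adjf: "fbounded (entry A) N \<Longrightarrow> fbounded (entry (A\<^sup>\<dagger>)) N"
  by (auto simp: fbounded_def adjf.rep_eq)

lemma adjf_adjf [simp]: "A\<^sup>\<dagger>\<^sup>\<dagger> = A" by transfer simp
lemma adjf_zero [simp]: "0\<^sup>\<dagger> = 0" by transfer simp
lemma adjf_add: "(A + B)\<^sup>\<dagger> = A\<^sup>\<dagger> + B\<^sup>\<dagger>" by transfer simp
lemma adjf_minus: "(A - B)\<^sup>\<dagger> = A\<^sup>\<dagger> - B\<^sup>\<dagger>" by transfer simp
lemma adjf_scaleR: "(c *\<^sub>R A)\<^sup>\<dagger> = c *\<^sub>R A\<^sup>\<dagger>" by transfer simp
lemma adjf_mult: "(A * B)\<^sup>\<dagger> = B\<^sup>\<dagger> * A\<^sup>\<dagger>"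
proof -
  obtain N where N: "fbounded (entry A) N" "fbounded (entry B) N" "fbounded (entry A) N"
    by (rule obtain_bound)
  show ?thesis
    by (rule fmat_eqI) (simp add: adjf.rep_eq entry_times[OF N(1)] entry_times[OF fbounded_adjf[OF N(2)]] mult.commute)
qed
lemma adjf_sum: "(\<Sum>x\<in>I. f x)\<^sup>\<dagger> = (\<Sum>x\<in>I. (f x)\<^sup>\<dagger>)"
  by (induction I rule: infinite_finite_induct) (auto simp: adjf_add)

lemmas adjf_simps = adjf_add adjf_minus adjf_scaleR adjf_mult adjf_sum

lemma rtr_add: "rtr (A + B) = rtr A + rtr B"
proof -
  obtain N where N: "fbounded (entry A) N" "fbounded (entry B) N" "fbounded (entry A) N"
    by (rule obtain_bound)
  show ?thesis
    by (simp add: rtr_bounded[OF fbounded_plus[OF N(1,2)]] rtr_bounded[OF N(1)] rtr_bounded[OF N(2)]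
        plus_fmat.rep_eq sum.distrib)
qed

lemma rtr_scaleR: "rtr (c *\<^sub>R A) = c * rtr A"
proof -
  obtain N where N: "fbounded (entry A) N" "fbounded (entry A) N" "fbounded (entry A) N"
    by (rule obtain_bound)
  show ?thesis
    by (simp add: rtr_bounded[OF fbounded_scaleR[OF N(1)]] rtr_bounded[OF N(1)] scaleR_fmat.rep_eq
        sum_distrib_left)
qed

lemma rtr_zero [simp]: "rtr 0 = 0" using rtr_scaleR[of 0 0] by simp
lemma rtr_minus: "rtr (A - B) = rtr A - rtr B"
  using rtr_add[of "A - B" B] by simp
lemma rtr_uminus: "rtr (- A) = - rtr A"
  using rtr_minus[of 0 A] by simp
lemma rtr_sum: "rtr (\<Sum>x\<in>I. f x) = (\<Sum>x\<in>I. rtr (f x))"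
  by (induction I rule: infinite_finite_induct) (auto simp: rtr_add)

lemma rtr_adjf [simp]: "rtr (A\<^sup>\<dagger>) = rtr A"
  by (transfer) simp

lemma rtr_mult_commute: "rtr (A * B) = rtr (B * A)"
proof -
  obtain N where N: "fbounded (entry A) N" "fbounded (entry B) N" "fbounded (entry A) N"
    by (rule obtain_bound)
  have "(\<Sum>i<N. \<Sum>k<N. entry A i k * entry B k i) = (\<Sum>i<N. \<Sum>k<N. entry B i k * entry A k i)"
    by (subst sum.swap) (simp add: mult.commute)
  then show ?thesis
    by (simp only: rtr_bounded[OF fbounded_times[OF N(1,2)]] rtr_bounded[OF fbounded_times[OF N(2,1)]]
        entry_times[OF N(1)] entry_times[OF N(2)])
qed

section \<open>The Hilbert--Schmidt inner product\<close>

instantiation fmat :: real_inner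
begin

definition inner_fmat :: "fmat \<Rightarrow> fmat \<Rightarrow> real" where "inner_fmat A B = rtr (A\<^sup>\<dagger> * B)"
definition norm_fmat :: "fmat \<Rightarrow> real" where "norm_fmat A = sqrt (inner A A)"
definition dist_fmat :: "fmat \<Rightarrow> fmat \<Rightarrow> real" where "dist_fmat A B = norm (A - B)"
definition sgn_fmat :: "fmat \<Rightarrow> fmat" where "sgn_fmat A = A /\<^sub>R norm A"
definition uniformity_fmat :: "(fmat \<times> fmat) filter" where
  "uniformity_fmat = (INF e\<in>{0 <..}. principal {(x, y). dist x y < e})"
definition open_fmat :: "fmat set \<Rightarrow> bool" where
  "open_fmat U = (\<forall>x\<in>U. eventually (\<lambda>(x', y). x' = x \<longrightarrow> y \<in> U) uniformity)"

lemma inner_fmat_self: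
  assumes "fbounded (entry A) N"
  shows "inner A A = (\<Sum>i<N. \<Sum>j<N. (cmod (entry A j i))\<^sup>2)"
proof -
  have "Re (cnj z * z) = (cmod z)\<^sup>2" for z
    by (metis complex_norm_square mult.commute Re_complex_of_real)
  then show ?thesis
    unfolding inner_fmat_def
    by (simp only: rtr_bounded[OF fbounded_times[OF fbounded_adjf[OF assms] assms]] Re_sum
        entry_times[OF fbounded_adjf[OF assms]] adjf.rep_eq)
qed

instance
proof
  fix A B C :: fmat and r :: real
  show "inner A B = inner B A"
    unfolding inner_fmat_def by (subst rtr_adjf[symmetric]) (simp add: adjf_mult)
  show "inner (A + B) C = inner A C + inner B C"
    by (simp add: inner_fmat_def adjf_add rtr_add distrib_right)
  show "inner (r *\<^sub>R A) B = r * inner A B"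
    by (simp add: inner_fmat_def adjf_scaleR rtr_scaleR)
  obtain N where N: "fbounded (entry A) N" "fbounded (entry A) N" "fbounded (entry A) N"
    by (rule obtain_bound)
  show "0 \<le> inner A A" by (simp add: inner_fmat_self[OF N(1)] sum_nonneg)
  show "inner A A = 0 \<longleftrightarrow> A = 0"
  proof
    assume "inner A A = 0"
    then have "\<forall>i<N. \<forall>j<N. entry A j i = 0"
      by (auto simp: inner_fmat_self[OF N(1)] sum_nonneg_eq_0_iff sum_nonneg)
    with N(1) show "A = 0" by (intro fmat_eqI) (auto simp: zero_fmat.rep_eq fbounded_def, meson not_le)
  qed (simp add: inner_fmat_def)
qed (simp_all add: norm_fmat_def dist_fmat_def sgn_fmat_def uniformity_fmat_def open_fmat_def)

end

section \<open>The spectral theorem\<close>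

lemma inner_mult_left: "inner (A * B) C = inner B (A\<^sup>\<dagger> * (C :: fmat))"
  by (simp add: inner_fmat_def adjf_mult mult.assoc)

lemma inner_mult_right: "inner (A * B) C = inner A (C * (B :: fmat)\<^sup>\<dagger>)"
  by (simp add: inner_fmat_def adjf_mult mult.assoc) (metis rtr_mult_commute mult.assoc)

lemma inner_adjf: "inner (A\<^sup>\<dagger>) (B\<^sup>\<dagger>) = inner A (B :: fmat)"
  by (simp add: inner_fmat_def) (metis adjf_adjf adjf_mult rtr_adjf rtr_mult_commute)

lemma norm_adjf [simp]: "norm (A\<^sup>\<dagger>) = norm (A :: fmat)"
  by (simp add: norm_eq_sqrt_inner inner_adjf)

lemma norm_sq_rtr: "(norm (A :: fmat))\<^sup>2 = rtr (A\<^sup>\<dagger> * A)"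
  by (simp add: power2_norm_eq_inner inner_fmat_def)

definition mat_of_fmat :: "nat \<Rightarrow> fmat \<Rightarrow> complex mat" where
  "mat_of_fmat N A = mat N N (\<lambda>(i,j). entry A i j)"

lemma mat_of_fmat_carrier [simp]: "mat_of_fmat N A \<in> carrier_mat N N"
  by (simp add: mat_of_fmat_def)

lemma trace_mult_commute:
  fixes X Y :: "complex mat"
  assumes "X \<in> carrier_mat N N" "Y \<in> carrier_mat N N"
  shows "(\<Sum>i<N. (X * Y) $$ (i,i)) = (\<Sum>i<N. (Y * X) $$ (i,i))"
proof -
  have "(\<Sum>i<N. (X * Y) $$ (i,i)) = (\<Sum>i<N. \<Sum>k<N. X $$ (i,k) * Y $$ (k,i))"
    using assms by (intro sum.cong) (auto simp: scalar_prod_def atLeast0LessThan)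
  also have "\<dots> = (\<Sum>k<N. \<Sum>i<N. Y $$ (k,i) * X $$ (i,k))"
    by (subst sum.swap) (simp add: mult.commute)
  also have "\<dots> = (\<Sum>i<N. (Y * X) $$ (i,i))"
    using assms by (intro sum.cong) (auto simp: scalar_prod_def atLeast0LessThan)
  finally show ?thesis .
qed

text \<open>If all eigenvalues vanish, a Schur triangulation has zero diagonal, so the trace of the
  square, which is the squared norm of a self-adjoint matrix, vanishes.\<close>

lemma ex_nonzero_eigenvalue:
  fixes M :: "complex mat"
  assumes M: "M \<in> carrier_mat N N" and tr: "(\<Sum>i<N. (M * M) $$ (i,i)) \<noteq> 0"
  shows "\<exists>c. c \<noteq> 0 \<and> eigenvalue M c"
proof (rule ccontr)
  assume no: "\<not> ?thesis"
  obtain as where as: "char_poly M = (\<Prod>a\<leftarrow>as. [:- a, 1:])"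
    using char_poly_factorized[OF M] by blast
  obtain B where B: "B \<in> carrier_mat N N" "upper_triangular B" "similar_mat M B"
    using schur_decomposition_exists[OF M as] by blast
  obtain P Q where PQ: "similar_mat_wit M B P Q"
    using B(3) unfolding similar_mat_def by blast
  have car: "P \<in> carrier_mat N N" "Q \<in> carrier_mat N N" and QP: "Q * P = 1\<^sub>m N"
    and MB: "M = P * B * Q"
    using similar_mat_witD2[OF M PQ] by auto
  have diag0: "B $$ (i,i) = 0" if "i < N" for i
  proof -
    have "poly (char_poly M) (B $$ (i,i)) = 0"
      using that B(1) unfolding char_poly_similar[OF B(3)] char_poly_upper_triangular[OF B(1,2)]
      by (auto simp: poly_prod_list prod_list_zero_iff diag_mat_def image_iff)
    then show ?thesis using no eigenvalue_root_char_poly[OF M] by blast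
  qed
  have BB: "(B * B) $$ (i,i) = 0" if "i < N" for i
  proof -
    have "B $$ (i,k) * B $$ (k,i) = 0" if "k < N" for k
      using upper_triangularD[OF B(2), of k i] upper_triangularD[OF B(2), of i k] diag0[of i] that \<open>i < N\<close> B(1)
      by (cases k i rule: linorder_cases) auto
    then have "(\<Sum>k<N. B $$ (i,k) * B $$ (k,i)) = 0" by (intro sum.neutral) blast
    then show ?thesis using \<open>i < N\<close> B(1) by (simp add: scalar_prod_def atLeast0LessThan)
  qed
  have "M * M = P * ((B * B) * Q)"
  proof -
    have "M * M = P * (B * (Q * P * (B * Q)))"
      unfolding MB using car B(1) by (simp add: assoc_mult_mat[of _ N N _ N _ N])
    also have "\<dots> = P * ((B * B) * Q)"
      unfolding QP using car B(1) by (simp add: assoc_mult_mat[of _ N N _ N _ N])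
    finally show ?thesis .
  qed
  then have "(\<Sum>i<N. (M * M) $$ (i,i)) = (\<Sum>i<N. ((B * B) * Q * P) $$ (i,i))"
    using trace_mult_commute[of P N "(B * B) * Q"] car B(1) by simp
  also have "(B * B) * Q * P = B * B"
    using car B(1) by (simp add: assoc_mult_mat[of _ N N _ N _ N] QP)
  finally show False using tr BB by simp
qed

text \<open>The trace of \<open>A * A\<close> is the squared norm of \<open>A\<close>, hence
  nonzero, which yields an eigenvector \<open>v\<close> with nonzero eigenvalue. \<open>E\<close> is
  the rank-one projection onto the line of \<open>v\<close>.\<close>

lemma ex_eigenprojection:
  assumes herm: "A\<^sup>\<dagger> = A" and "A \<noteq> 0"
  shows "\<exists>E c. c \<noteq> 0 \<and> E\<^sup>\<dagger> = E \<and> E * E = E \<and> rtr E = 1 \<and> A * E = c *\<^sub>R E"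
proof -
  obtain N where N: "fbounded (entry A) N" "fbounded (entry A) N" "fbounded (entry A) N"
    by (rule obtain_bound)
  let ?M = "mat_of_fmat N A"
  have he: "cnj (entry A j i) = entry A i j" for i j
    using herm by (metis adjf.rep_eq)
  have "(\<Sum>i<N. (?M * ?M) $$ (i,i)) = (\<Sum>i<N. \<Sum>k<N. entry A i k * entry A k i)"
    by (intro sum.cong) (auto simp: scalar_prod_def atLeast0LessThan mat_of_fmat_def)
  also have "Re \<dots> = inner A A"
    by (simp add: inner_fmat_def herm rtr_bounded[OF fbounded_times[OF N(1,2)]] entry_times[OF N(1)])
  finally have "Re (\<Sum>i<N. (?M * ?M) $$ (i,i)) = inner A A" .
  then have "(\<Sum>i<N. (?M * ?M) $$ (i,i)) \<noteq> 0"
    using \<open>A \<noteq> 0\<close> by (metis inner_eq_zero_iff zero_complex.sel(1))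
  then obtain c v where c: "c \<noteq> 0" and v: "eigenvector ?M v c"
    using ex_nonzero_eigenvalue[of ?M N] unfolding eigenvalue_def by auto
  have vc: "v \<in> carrier_vec N" "v \<noteq> 0\<^sub>v N" and ev: "?M *\<^sub>v v = c \<cdot>\<^sub>v v"
    using v mat_of_fmat_carrier[of N A] by (auto simp: eigenvector_def)
  have ev': "(\<Sum>k<N. entry A i k * v $ k) = c * v $ i" if "i < N" for i
    using arg_cong[OF ev, of "\<lambda>u. u $ i"] that vc
    by (auto simp: mat_of_fmat_def scalar_prod_def atLeast0LessThan)
  define s where "s = (\<Sum>i<N. (cmod (v $ i))\<^sup>2)"
  obtain i0 where "i0 < N" "v $ i0 \<noteq> 0" using vc by (auto simp: vec_eq_iff)
  then have s: "0 < s" unfolding s_def by (intro sum_pos2[of _ i0]) auto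
  have sc: "complex_of_real s = (\<Sum>i<N. v $ i * cnj (v $ i))"
    unfolding s_def of_real_sum by (simp only: complex_norm_square)
  \<comment> \<open>The quadratic form of \<open>A\<close> at \<open>v\<close>: it equals
    \<open>c * s\<close> and, \<open>A\<close> being self-adjoint, its own conjugate. Hence
    \<open>c\<close> is real.\<close>
  define q where "q = (\<Sum>i<N. \<Sum>k<N. cnj (v $ i) * (entry A i k * v $ k))"
  have "q = (\<Sum>i<N. cnj (v $ i) * (c * v $ i))"
    unfolding q_def by (intro sum.cong refl) (simp add: sum_distrib_left[symmetric] ev')
  then have qc: "q = c * of_real s" unfolding sc by (simp add: sum_distrib_left algebra_simps)
  have "cnj q = (\<Sum>i<N. \<Sum>k<N. cnj (v $ k) * (entry A k i * v $ i))"
    unfolding q_def by (simp add: he algebra_simps)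
  also have "\<dots> = q" unfolding q_def by (rule sum.swap)
  finally have "cnj c = c" using qc s by simp
  then obtain r where r: "c = of_real r" by (metis Reals_cnj_iff Reals_cases)
  define f where "f = (\<lambda>i j. if i < N \<and> j < N then v $ i * cnj (v $ j) / of_real s else 0)"
  have fb: "fbounded f N" by (auto simp: fbounded_def f_def)
  define E where "E = Abs_fmat f"
  have entE: "entry E = f" unfolding E_def using fb by (intro Abs_fmat_inverse) auto
  have EE: "E * E = E"
  proof (rule fmat_eqI)
    fix i j
    have "(\<Sum>k<N. f i k * f k j) = (if i < N \<and> j < N then v $ i * cnj (v $ j) / of_real s else 0)"
    proof (cases "i < N \<and> j < N")
      case True
      then have "(\<Sum>k<N. f i k * f k j) = (\<Sum>k<N. v $ i * cnj (v $ j) / of_real s / of_real s * (v $ k * cnj (v $ k)))"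
        by (intro sum.cong) (auto simp: f_def)
      also have "\<dots> = v $ i * cnj (v $ j) / of_real s"
        unfolding sum_distrib_left[symmetric] sc[symmetric] using s by simp
      finally show ?thesis using True by simp
    qed (auto simp: f_def)
    then show "entry (E * E) i j = entry E i j"
      using entry_times[of E N E i j] fb by (simp add: entE f_def)
  qed
  have Eh: "E\<^sup>\<dagger> = E" by (rule fmat_eqI) (auto simp: adjf.rep_eq entE f_def)
  have Et: "rtr E = 1"
  proof -
    have "(\<Sum>i<N. f i i) = (\<Sum>i<N. v $ i * cnj (v $ i)) / of_real s"
      unfolding sum_divide_distrib by (intro sum.cong) (auto simp: f_def)
    also have "\<dots> = 1" unfolding sc[symmetric] using s by simp
    finally show ?thesis using rtr_bounded[of E N] fb by (simp add: entE)
  qed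
  have "A * E = r *\<^sub>R E"
  proof (rule fmat_eqI)
    fix i j
    have "(\<Sum>k<N. entry A i k * f k j) = c * f i j"
    proof (cases "j < N")
      case True
      then have "(\<Sum>k<N. entry A i k * f k j) = (\<Sum>k<N. entry A i k * v $ k) * (cnj (v $ j) / of_real s)"
        unfolding sum_distrib_right by (intro sum.cong) (auto simp: f_def)
      also have "\<dots> = c * f i j"
        using ev'[of i] N(1) True by (cases "i < N") (auto simp: f_def fbounded_def)
      finally show ?thesis .
    qed (auto simp: f_def)
    then show "entry (A * E) i j = entry (r *\<^sub>R E) i j"
      by (simp add: entry_times[OF N(1)] entE scaleR_fmat.rep_eq r)
  qed
  moreover have "r \<noteq> 0" using c r by auto
  ultimately show ?thesis using EE Eh Et by blast
qed

text \<open>The identity of the top left \<open>d\<close> by \<open>d\<close> corner, a two-sided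
  unit for every matrix bounded by \<open>d\<close>.\<close>

lift_definition projf :: "nat \<Rightarrow> fmat" is "\<lambda>d i j. if i = j \<and> i < d then 1 else 0"
proof -
  fix d :: nat
  show "\<exists>N. fbounded (\<lambda>i j. if i = j \<and> i < d then 1 else 0) N"
    by (rule exI[of _ d]) (auto simp: fbounded_def)
qed

lemma fbounded_projf: "fbounded (entry (projf d)) d"
  by (auto simp: fbounded_def projf.rep_eq)

lemma projf_adjf [simp]: "(projf d)\<^sup>\<dagger> = projf d"
  by (rule fmat_eqI) (auto simp: adjf.rep_eq projf.rep_eq)

lemma projf_mult: "fbounded (entry A) d \<Longrightarrow> projf d * A = A"
proof (rule fmat_eqI)
  fix i j assume A: "fbounded (entry A) d"
  have "(\<Sum>k<d. entry (projf d) i k * entry A k j) = (\<Sum>k<d. if k = i then entry A k j else 0)"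
    by (intro sum.cong) (auto simp: projf.rep_eq)
  also have "\<dots> = entry A i j" using A by (auto simp: fbounded_def)
  finally show "entry (projf d * A) i j = entry A i j" by (simp add: entry_times[OF fbounded_projf])
qed

lemma mult_projf: "fbounded (entry A) d \<Longrightarrow> A * projf d = A"
  using projf_mult[of "A\<^sup>\<dagger>" d] fbounded_adjf[of A d] by (metis adjf_adjf adjf_mult projf_adjf)

lemma rtr_projf: "rtr (projf d) = real d"
  by (simp add: rtr_bounded[OF fbounded_projf] projf.rep_eq)

lemma projf_idem: "projf d * projf d = projf d"
  by (rule projf_mult[OF fbounded_projf])

text \<open>Mutually orthogonal rank-one projections. Trace 1 keeps them nonzero, which is what
  bounds the length of a family by the dimension.\<close>

definition spectral_family :: "nat \<Rightarrow> (nat \<Rightarrow> fmat) \<Rightarrow> bool" where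
  "spectral_family k E \<longleftrightarrow> (\<forall>i<k. (E i)\<^sup>\<dagger> = E i \<and> rtr (E i) = 1) \<and>
     (\<forall>i<k. \<forall>j<k. E i * E j = (if i = j then E i else 0))"

lemma spectral_family_mult:
  assumes "spectral_family k E"
  shows "(\<Sum>i<k. a i *\<^sub>R E i) * (\<Sum>i<k. b i *\<^sub>R E i) = (\<Sum>i<k. (a i * b i) *\<^sub>R E i)"
proof -
  have "(\<Sum>i<k. a i *\<^sub>R E i) * (\<Sum>i<k. b i *\<^sub>R E i) = (\<Sum>i<k. \<Sum>j<k. (a i * b j) *\<^sub>R (E i * E j))"
    by (simp add: sum_product mult.commute)
  also have "\<dots> = (\<Sum>i<k. \<Sum>j<k. if i = j then (a i * b j) *\<^sub>R E i else 0)"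
    using assms by (intro sum.cong) (auto simp: spectral_family_def)
  finally show ?thesis by simp
qed

lemma spectral_family_adjf:
  assumes "spectral_family k E"
  shows "(\<Sum>i<k. a i *\<^sub>R E i)\<^sup>\<dagger> = (\<Sum>i<k. a i *\<^sub>R E i)"
  unfolding adjf_simps using assms by (intro sum.cong) (auto simp: spectral_family_def)

text \<open>For the sum \<open>Q\<close> of the projections, Cauchy--Schwarz against the corner
  identity gives \<open>k = inner (projf d) Q \<le> sqrt d * sqrt k\<close>.\<close>

lemma spectral_family_card_le:
  assumes sf: "spectral_family k E" and b: "\<And>i. i < k \<Longrightarrow> fbounded (entry (E i)) d"
  shows "k \<le> d"
proof -
  define Q where "Q = (\<Sum>i<k. 1 *\<^sub>R E i)"
  have Q: "Q\<^sup>\<dagger> = Q" "Q * Q = Q"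
    unfolding Q_def by (rule spectral_family_adjf[OF sf]) (simp only: spectral_family_mult[OF sf] mult_1)
  have trQ: "rtr Q = real k"
    unfolding Q_def rtr_sum rtr_scaleR using sf by (simp add: spectral_family_def)
  have "projf d * Q = Q" unfolding Q_def sum_distrib_left
    using b by (intro sum.cong) (auto simp: projf_mult)
  then have "real k = inner (projf d) Q" by (simp add: inner_fmat_def trQ)
  also have "\<dots> \<le> norm (projf d) * norm Q" by (rule norm_cauchy_schwarz)
  also have "\<dots> = sqrt (real d) * sqrt (real k)"
    by (simp add: norm_eq_sqrt_inner inner_fmat_def Q trQ projf_idem rtr_projf)
  finally have "real k * real k \<le> (sqrt (real d) * sqrt (real k)) * (sqrt (real d) * sqrt (real k))"
    by (intro mult_mono) auto
  then show ?thesis by (cases "k = 0") (auto simp: real_sqrt_mult[symmetric])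
qed

lemma fbounded_of_mult_projf:
  assumes B: "B\<^sup>\<dagger> = B" "B * projf d = B"
  shows "fbounded (entry B) d"
proof -
  have 1: "projf d * B = B" using arg_cong[OF B(2), of adjf] B(1) by (simp add: adjf_mult)
  have row: "entry B i j = 0" if "d \<le> i" for i j
    using that by (subst 1[symmetric]) (simp add: entry_times[OF fbounded_projf] projf.rep_eq)
  moreover have "entry B i j = 0" if "d \<le> j" for i j
  proof -
    have "entry B i j = cnj (entry B j i)" using B(1) by (metis adjf.rep_eq)
    then show ?thesis using row that by simp
  qed
  ultimately show ?thesis by (auto simp: fbounded_def)
qed

text \<open>\<open>E\<close> is a multiple of \<open>A * E\<close>, so its rows vanish where those
  of \<open>A\<close> do; self-adjointness settles the columns.\<close>

lemma fbounded_eigenprojection: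
  assumes "c \<noteq> 0" "A * E = c *\<^sub>R E" "E\<^sup>\<dagger> = E" "fbounded (entry A) d"
  shows "fbounded (entry E) d"
proof -
  have "projf d * E = inverse c *\<^sub>R (projf d * A * E)" using assms by (simp add: mult.assoc)
  also have "\<dots> = E" using assms by (simp add: projf_mult)
  finally have 1: "projf d * E = E" .
  have "E * projf d = E" using arg_cong[OF 1, of adjf] assms by (simp add: adjf_mult)
  then show ?thesis by (rule fbounded_of_mult_projf[OF assms(3)])
qed

text \<open>Take a family of eigenprojections of maximal length. The remainder \<open>B\<close>
  annihilates all of them, so an eigenprojection of a nonzero \<open>B\<close> would be orthogonal
  to the family and extend it. Only nonzero eigenvalues are listed, since the kernel of a finitely
  supported matrix has infinite dimension.\<close>

theorem spectral_theorem_fmat: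
  assumes herm: "A\<^sup>\<dagger> = A"
  shows "\<exists>k E c. spectral_family k E \<and> (\<forall>i<k. c i \<noteq> 0) \<and> A = (\<Sum>i<k. c i *\<^sub>R E i)"
proof -
  obtain d where d: "fbounded (entry A) d" "fbounded (entry A) d" "fbounded (entry A) d"
    by (rule obtain_bound)
  define P where "P = (\<lambda>k. \<exists>E c. spectral_family k E \<and> (\<forall>i<k. c i \<noteq> 0 \<and> A * E i = c i *\<^sub>R E i))"
  have bnd: "\<And>k. P k \<Longrightarrow> k \<le> d"
    unfolding P_def using spectral_family_card_le fbounded_eigenprojection d(1)
    by (metis spectral_family_def)
  have "P 0" by (auto simp: P_def spectral_family_def)
  define k where "k = (GREATEST k. P k)"
  have "P k" unfolding k_def using GreatestI_nat[of P 0 d] \<open>P 0\<close> bnd by blast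
  have nP: "\<not> P (Suc k)"
    using Greatest_le_nat[of P "Suc k" d] bnd unfolding k_def[symmetric] by (meson Suc_n_not_le_n)
  obtain E c where sf: "spectral_family k E" and c: "\<And>i. i < k \<Longrightarrow> c i \<noteq> 0"
    and AE: "\<And>i. i < k \<Longrightarrow> A * E i = c i *\<^sub>R E i"
    using \<open>P k\<close> unfolding P_def by blast
  define B where "B = A - (\<Sum>i<k. c i *\<^sub>R E i)"
  have Bh: "B\<^sup>\<dagger> = B" unfolding B_def adjf_minus herm spectral_family_adjf[OF sf] ..
  have BE: "B * E i = 0" if "i < k" for i
  proof -
    have "(\<Sum>j<k. c j *\<^sub>R E j) * E i = (\<Sum>j<k. c j *\<^sub>R (E j * E i))"
      by (simp add: sum_distrib_right)
    also have "\<dots> = (\<Sum>j<k. if j = i then c j *\<^sub>R E j else 0)"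
      using sf that by (intro sum.cong) (auto simp: spectral_family_def)
    also have "\<dots> = c i *\<^sub>R E i" using that by simp
    finally show ?thesis using AE[OF that] by (simp add: B_def left_diff_distrib)
  qed
  have "B = 0"
  proof (rule ccontr)
    assume "B \<noteq> 0"
    then obtain F r where F: "r \<noteq> 0" "F\<^sup>\<dagger> = F" "F * F = F" "rtr F = 1" "B * F = r *\<^sub>R F"
      using ex_eigenprojection[OF Bh] by blast
    have EF: "E i * F = 0" if "i < k" for i
    proof -
      have Eh: "(E i)\<^sup>\<dagger> = E i" using sf that by (auto simp: spectral_family_def)
      have "E i * B = 0" using arg_cong[OF BE[OF that], of adjf] by (simp add: adjf_mult Bh Eh)
      then have "r *\<^sub>R (E i * F) = 0" using F(5) by (metis mult.assoc mult_scaleR_right mult_zero_left)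
      then show ?thesis using F by simp
    qed
    have FE: "F * E i = 0" if "i < k" for i
      using arg_cong[OF EF[OF that], of adjf] sf that by (auto simp: adjf_mult F spectral_family_def)
    have "A * F = r *\<^sub>R F"
    proof -
      have "(\<Sum>i<k. c i *\<^sub>R E i) * F = 0"
        unfolding sum_distrib_right using EF by (intro sum.neutral) auto
      then show ?thesis using F(5) by (simp add: B_def left_diff_distrib)
    qed
    then have "P (Suc k)"
      unfolding P_def using sf c AE EF FE F
      by (intro exI[of _ "E(k := F)"] exI[of _ "c(k := r)"]) (auto simp: spectral_family_def less_Suc_eq)
    then show False using nP by simp
  qed
  then show ?thesis using sf c by (intro exI[of _ k] exI[of _ E] exI[of _ c]) (auto simp: B_def)
qed

section \<open>Positive matrices and contractions\<close>

text \<open>Matrices take the place of vectors: \<open>inner B (A * B)\<close> is the sum of the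
  quadratic form of \<open>A\<close> over the columns of \<open>B\<close>. The agreement with
  \<open>psd\<close> is \<open>psd_iff_pos\<close>.\<close>

definition pos :: "fmat \<Rightarrow> bool" where
  "pos A \<longleftrightarrow> A\<^sup>\<dagger> = A \<and> (\<forall>B. 0 \<le> inner B (A * B))"

lemma pos_adjf: "pos A \<Longrightarrow> A\<^sup>\<dagger> = A"
  by (simp add: pos_def)

lemma pos_zero: "pos 0"
  by (simp add: pos_def)

lemma pos_add: "pos A \<Longrightarrow> pos B \<Longrightarrow> pos (A + B)"
  by (simp add: pos_def adjf_add distrib_right inner_add_right)

lemma pos_scaleR: "0 \<le> c \<Longrightarrow> pos A \<Longrightarrow> pos (c *\<^sub>R A)"
  by (simp add: pos_def adjf_scaleR)

lemma pos_sum: "(\<And>x. x \<in> I \<Longrightarrow> pos (f x)) \<Longrightarrow> pos (\<Sum>x\<in>I. f x)"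
  by (induction I rule: infinite_finite_induct) (auto simp: pos_zero pos_add)

lemma pos_conj: "pos A \<Longrightarrow> pos (X\<^sup>\<dagger> * A * X)"
  unfolding pos_def
proof (intro conjI allI)
  fix B assume A: "A\<^sup>\<dagger> = A \<and> (\<forall>B. 0 \<le> inner B (A * B))"
  have "inner B (X\<^sup>\<dagger> * A * X * B) = inner (X * B) (A * (X * B))"
    by (simp add: inner_mult_left mult.assoc)
  then show "0 \<le> inner B (X\<^sup>\<dagger> * A * X * B)" using A by simp
qed (simp add: adjf_mult mult.assoc)

lemma pos_conj': "pos A \<Longrightarrow> pos (X * A * X\<^sup>\<dagger>)"
  using pos_conj[of A "X\<^sup>\<dagger>"] by simp

lemma pos_spectral_sum:
  assumes sf: "spectral_family k E" and c: "\<And>i. i < k \<Longrightarrow> 0 \<le> c i"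
  shows "pos (\<Sum>i<k. c i *\<^sub>R E i)"
proof (intro pos_sum pos_scaleR)
  fix i assume "i \<in> {..<k}"
  then have E: "(E i)\<^sup>\<dagger> = E i" "E i * E i = E i" using sf by (auto simp: spectral_family_def)
  have "inner B (E i * B) = inner (E i * B) (E i * B)" for B
    by (simp add: inner_mult_left E mult.assoc[symmetric])
  then show "pos (E i)" using E by (simp add: pos_def)
qed (use c in auto)

text \<open>Testing positivity on \<open>E i\<close> itself gives
  \<open>inner (E i) (A * E i) = c i\<close>.\<close>

lemma pos_spectral:
  assumes "pos A"
  shows "\<exists>k E c. spectral_family k E \<and> (\<forall>i<k. 0 < c i) \<and> A = (\<Sum>i<k. c i *\<^sub>R E i)"
proof -
  obtain k E c where sf: "spectral_family k E" and c: "\<And>i. i < k \<Longrightarrow> c i \<noteq> 0"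
    and A: "A = (\<Sum>i<k. c i *\<^sub>R E i)"
    using spectral_theorem_fmat[OF pos_adjf[OF assms]] by blast
  have "0 < c i" if "i < k" for i
  proof -
    have E: "(E i)\<^sup>\<dagger> = E i" "E i * E i = E i" "rtr (E i) = 1"
      using sf that by (auto simp: spectral_family_def)
    have "A * E i = (\<Sum>j<k. if j = i then c j *\<^sub>R E j else 0)"
      unfolding A sum_distrib_right using sf that
      by (intro sum.cong) (auto simp: spectral_family_def)
    also have "\<dots> = c i *\<^sub>R E i" using that by simp
    finally have "inner (E i) (A * E i) = c i" by (simp add: inner_fmat_def E rtr_scaleR)
    then show ?thesis using assms c[OF that] unfolding pos_def by (metis order_le_less)
  qed
  then show ?thesis using sf A by blast
qed

lemma pos_sqrt_ex:
  assumes "pos A"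
  shows "\<exists>B. pos B \<and> B * B = A"
proof -
  obtain k E c where sf: "spectral_family k E" and c: "\<And>i. i < k \<Longrightarrow> 0 < c i"
    and A: "A = (\<Sum>i<k. c i *\<^sub>R E i)"
    using pos_spectral[OF assms] by blast
  let ?B = "\<Sum>i<k. sqrt (c i) *\<^sub>R E i"
  have "?B * ?B = A"
    unfolding spectral_family_mult[OF sf] A using c by (intro sum.cong) (auto simp: less_imp_le)
  moreover have "pos ?B" using c by (intro pos_spectral_sum[OF sf]) (auto simp: less_imp_le)
  ultimately show ?thesis by blast
qed

lemma pos_square: "A\<^sup>\<dagger> = A \<Longrightarrow> pos (A * A)"
  by (simp add: pos_def adjf_mult) (metis inner_ge_zero inner_mult_left mult.assoc adjf_adjf)

text \<open>With a self-adjoint root \<open>C\<close> of \<open>B\<close>, the inner product becomes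
  \<open>inner C (A * C)\<close>.\<close>

lemma inner_pos_nonneg:
  assumes "pos A" "pos B"
  shows "0 \<le> inner A B"
proof -
  obtain C where C: "C\<^sup>\<dagger> = C" "C * C = B" using pos_sqrt_ex[OF assms(2)] pos_adjf by blast
  have "inner A B = inner (A * C) C" unfolding C(2)[symmetric] by (simp add: inner_mult_right C)
  also have "\<dots> = inner C (A * C)" by (rule inner_commute)
  finally show ?thesis using assms(1) by (simp add: pos_def)
qed

lemma rtr_square: "C\<^sup>\<dagger> = C \<Longrightarrow> rtr (C * C) = (norm C)\<^sup>2"
  by (simp add: norm_sq_rtr)

lemma pos_rtr_nonneg: "pos A \<Longrightarrow> 0 \<le> rtr A"
  using pos_sqrt_ex[of A] pos_adjf rtr_square by (metis zero_le_power2)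

lemma pos_rtr_eq_zero: "pos A \<Longrightarrow> rtr A = 0 \<Longrightarrow> A = 0"
  using pos_sqrt_ex[of A] pos_adjf rtr_square
  by (metis mult_zero_left norm_eq_zero zero_eq_power2)

text \<open>With \<open>D = B - C\<close>, \<open>D (B + C) + (B + C) D = 2 (B\<^sup>2 - C\<^sup>2) = 0\<close>, whence the traces of the
  positive matrices \<open>D B D\<close> and \<open>D C D\<close> vanish and \<open>D\<^sup>3 = 0\<close>.\<close>

lemma pos_sqrt_unique:
  assumes B: "pos B" and C: "pos C" and eq: "B * B = C * C"
  shows "B = C"
proof -
  define D where "D = B - C"
  have D: "D\<^sup>\<dagger> = D" using B C by (simp add: D_def adjf_minus pos_adjf)
  have posB: "pos (D * B * D)" and posC: "pos (D * C * D)"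
    using pos_conj[OF B, of D] pos_conj[OF C, of D] by (simp_all add: D)
  have "D * (B + C) + (B + C) * D = 0"
    using eq by (simp add: D_def algebra_simps)
  then have "rtr (D * (D * (B + C) + (B + C) * D)) = 0" by simp
  then have "rtr (D * (D * (B + C))) + rtr (D * ((B + C) * D)) = 0"
    by (simp add: distrib_left[of D] rtr_add)
  moreover have "rtr (D * (D * (B + C))) = rtr (D * ((B + C) * D))"
    by (metis rtr_mult_commute mult.assoc)
  ultimately have "rtr (D * B * D) + rtr (D * C * D) = 0"
    by (simp add: algebra_simps rtr_add)
  then have "D * B * D = 0" "D * C * D = 0"
    using pos_rtr_nonneg[OF posB] pos_rtr_nonneg[OF posC] posB posC pos_rtr_eq_zero
    by (auto simp: add_nonneg_eq_0_iff)
  then have "D * D * D = 0" by (metis D_def diff_zero left_diff_distrib right_diff_distrib)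
  then have "inner (D * D) (D * D) = 0"
    by (simp add: inner_fmat_def adjf_mult D mult.assoc[symmetric])
  then have "D * D = 0" by simp
  then have "inner D D = 0" by (simp add: inner_fmat_def D)
  then show ?thesis by (simp add: D_def)
qed

text \<open>Operator norm at most 1, expressed through the Hilbert--Schmidt norm: left
  multiplication acts on each column separately.\<close>

definition contr :: "fmat \<Rightarrow> bool" where
  "contr U \<longleftrightarrow> (\<forall>A. norm (U * A) \<le> norm A)"

lemma contr_norm_left: "contr U \<Longrightarrow> norm (U * A) \<le> norm A"
  by (simp add: contr_def)

lemma contr_adjf: "contr U \<Longrightarrow> contr (U\<^sup>\<dagger>)"
  unfolding contr_def
proof
  fix A assume U: "\<forall>A. norm (U * A) \<le> norm A"
  have "norm (U\<^sup>\<dagger> * A) * norm (U\<^sup>\<dagger> * A) = inner A (U * (U\<^sup>\<dagger> * A))"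
    unfolding power2_eq_square[symmetric] power2_norm_eq_inner by (simp add: inner_mult_left)
  also have "\<dots> \<le> norm A * norm (U * (U\<^sup>\<dagger> * A))" by (rule norm_cauchy_schwarz)
  also have "\<dots> \<le> norm A * norm (U\<^sup>\<dagger> * A)" using U by (intro mult_left_mono) auto
  finally show "norm (U\<^sup>\<dagger> * A) \<le> norm A"
    by (metis mult_right_le_imp_le norm_ge_zero order_le_less)
qed

lemma contr_norm_right: "contr U \<Longrightarrow> norm (A * U) \<le> norm A"
  by (metis adjf_mult contr_adjf contr_norm_left norm_adjf)

lemma rtr_mult_le_norm: "rtr (A * B) \<le> norm A * norm B"
  using norm_cauchy_schwarz[of "A\<^sup>\<dagger>" B] by (simp add: inner_fmat_def)

lemma contr_uminus: "contr U \<Longrightarrow> contr (- U)"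
  by (simp add: contr_def)

text \<open>Split \<open>A = C * C\<close> and use Cauchy--Schwarz: both factors have norm at most
  \<open>norm C\<close>, whose square is the trace of \<open>A\<close>.\<close>

lemma rtr_contr_pos_le:
  assumes U: "contr U" and A: "pos A"
  shows "rtr (U * A) \<le> rtr A"
proof -
  obtain C where C: "C\<^sup>\<dagger> = C" "C * C = A" using pos_sqrt_ex[OF A] pos_adjf by blast
  have "rtr (U * A) = rtr ((U * C) * C)" by (simp add: C mult.assoc)
  also have "\<dots> \<le> norm (U * C) * norm C" by (rule rtr_mult_le_norm)
  also have "\<dots> \<le> norm C * norm C" using contr_norm_left[OF U] by (intro mult_right_mono) auto
  also have "\<dots> = rtr A" using rtr_square[OF C(1)] by (simp add: C power2_eq_square)
  finally show ?thesis .
qed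

lemma contr_compress:
  assumes U: "contr U" and V: "contr J"
  shows "contr (J\<^sup>\<dagger> * U * J)"
  unfolding contr_def
  by (metis mult.assoc order_trans contr_norm_left contr_adjf U V)

lemma herm_proj_contr:
  assumes "Q\<^sup>\<dagger> = Q" "Q * Q = Q"
  shows "contr Q"
  unfolding contr_def
proof
  fix A
  have "norm (Q * A) * norm (Q * A) = inner A (Q * A)"
    unfolding power2_eq_square[symmetric] power2_norm_eq_inner
    by (simp add: inner_mult_left assms mult.assoc[symmetric])
  also have "\<dots> \<le> norm A * norm (Q * A)" by (rule norm_cauchy_schwarz)
  finally show "norm (Q * A) \<le> norm A"
    by (metis mult_right_le_imp_le norm_ge_zero order_le_less)
qed

text \<open>\<open>C\<close> is a partial isometry: \<open>C\<^sup>\<dagger> * A\<close> has the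
  same norm as \<open>Q * A\<close>, and \<open>Q\<close> is a projection.\<close>

lemma contr_of_mult_adjf:
  assumes "Q\<^sup>\<dagger> = Q" "Q * Q = Q" "C * C\<^sup>\<dagger> = Q"
  shows "contr C"
proof -
  have "norm (C\<^sup>\<dagger> * A) \<le> norm A" for A
  proof -
    have "norm (C\<^sup>\<dagger> * A) = norm (Q * A)"
      by (simp add: norm_eq_sqrt_inner inner_mult_left assms mult.assoc[symmetric])
    then show ?thesis using contr_norm_left[OF herm_proj_contr[OF assms(1,2)]] by simp
  qed
  then show ?thesis using contr_adjf[of "C\<^sup>\<dagger>"] by (simp add: contr_def)
qed

text \<open>The witness is \<open>K\<^sup>+ N\<^sup>\<dagger>\<close> with the pseudo-inverse \<open>K\<^sup>+\<close> of \<open>K = |N|\<close>.\<close>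

lemma polar_contr:
  assumes "pos K" "K * K = N\<^sup>\<dagger> * N"
  shows "\<exists>C. contr C \<and> C * N = K"
proof -
  obtain k E c where sf: "spectral_family k E" and c: "\<And>i. i < k \<Longrightarrow> 0 < c i"
    and K: "K = (\<Sum>i<k. c i *\<^sub>R E i)"
    using pos_spectral[OF assms(1)] by blast
  define L where "L = (\<Sum>i<k. inverse (c i) *\<^sub>R E i)"
  define Q where "Q = (\<Sum>i<k. 1 *\<^sub>R E i)"
  have L: "L\<^sup>\<dagger> = L" and Q: "Q\<^sup>\<dagger> = Q" unfolding L_def Q_def by (rule spectral_family_adjf[OF sf])+
  have QQ: "Q * Q = Q" and QK: "Q * K = K" and LK: "L * K = Q" and KL: "K * L = Q"
    unfolding L_def Q_def K spectral_family_mult[OF sf] using c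
    by (auto intro!: sum.cong simp: less_imp_neq[THEN not_sym])
  have "(L * N\<^sup>\<dagger>) * (L * N\<^sup>\<dagger>)\<^sup>\<dagger> = L * (K * K) * L"
    by (simp add: adjf_mult L assms(2) mult.assoc)
  also have "\<dots> = (L * K) * (K * L)" by (simp add: mult.assoc)
  also have "\<dots> = Q" by (simp add: LK KL QQ)
  finally have "contr (L * N\<^sup>\<dagger>)" by (rule contr_of_mult_adjf[OF Q QQ])
  moreover have "L * N\<^sup>\<dagger> * N = L * K * K" by (simp add: mult.assoc assms(2))
  ultimately show ?thesis using LK QK by (intro exI[of _ "L * N\<^sup>\<dagger>"]) simp
qed

text \<open>\<open>W\<close> is the fourth root of \<tau>, \<open>V\<close> its pseudo-inverse and
  \<open>Q\<close> the support projection. With fourth roots, \<open>V * M * V\<close> divides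
  \<open>M\<close> symmetrically by the square root of \<tau>.\<close>

lemma pos_fourth_root:
  assumes "pos \<tau>"
  shows "\<exists>W V Q. W\<^sup>\<dagger> = W \<and> V\<^sup>\<dagger> = V \<and> Q\<^sup>\<dagger> = Q \<and> Q * Q = Q \<and> V * W = Q \<and> W * V = Q \<and>
    W * W * (W * W) = \<tau> \<and> \<tau> * Q = \<tau> \<and> V * V * \<tau> * (V * V) = Q"
proof -
  obtain k E c where sf: "spectral_family k E" and c: "\<And>i. i < k \<Longrightarrow> 0 < c i"
    and T: "\<tau> = (\<Sum>i<k. c i *\<^sub>R E i)"
    using pos_spectral[OF assms] by blast
  define r where "r = (\<lambda>i. sqrt (sqrt (c i)))"
  have r: "r i \<noteq> 0" "r i * r i * (r i * r i) = c i" if "i < k" for i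
    using c[OF that] by (auto simp: r_def)
  define V where "V = (\<Sum>i<k. inverse (r i) *\<^sub>R E i)"
  define W where "W = (\<Sum>i<k. r i *\<^sub>R E i)"
  define Q where "Q = (\<Sum>i<k. 1 *\<^sub>R E i)"
  have "V\<^sup>\<dagger> = V" "W\<^sup>\<dagger> = W" "Q\<^sup>\<dagger> = Q"
    unfolding V_def W_def Q_def by (rule spectral_family_adjf[OF sf])+
  moreover have "Q * Q = Q" "V * W = Q" "W * V = Q" "W * W * (W * W) = \<tau>" "\<tau> * Q = \<tau>"
    unfolding V_def Q_def W_def T spectral_family_mult[OF sf] using r
    by (auto intro!: sum.cong)
  moreover have "V * V * \<tau> * (V * V) = Q"
    unfolding V_def Q_def T spectral_family_mult[OF sf]
    by (intro sum.cong refl) (use r in \<open>simp add: r(2)[symmetric] field_simps\<close>)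
  ultimately show ?thesis by blast
qed

text \<open>\<open>Z\<close> is the complement of \<open>Q\<close> inside a common corner. There
  \<tau> vanishes, so domination leaves \<open>inner Z (\<rho> * Z) \<le> 0\<close>; hence the root
  of \<rho>, and then \<rho> itself, kills \<open>Z\<close>.\<close>

lemma dominated_absorbs_support:
  assumes \<rho>: "pos \<rho>" and le: "pos (c *\<^sub>R \<tau> - \<rho>)" and Q: "Q\<^sup>\<dagger> = Q" "\<tau> * Q = \<tau>"
  shows "\<rho> * Q = \<rho>" "Q * \<rho> = \<rho>"
proof -
  obtain d where d: "fbounded (entry \<rho>) d" "fbounded (entry \<tau>) d" "fbounded (entry Q) d"
    by (rule obtain_bound)
  define Z where "Z = projf d - Q"
  have "\<tau> * Z = 0" using d Q by (simp add: Z_def right_diff_distrib mult_projf)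
  moreover have "0 \<le> inner Z ((c *\<^sub>R \<tau> - \<rho>) * Z)" using le by (simp add: pos_def)
  ultimately have le0: "inner Z (\<rho> * Z) \<le> 0" by (simp add: left_diff_distrib inner_diff_right)
  obtain K where K: "K\<^sup>\<dagger> = K" "K * K = \<rho>" using pos_sqrt_ex[OF \<rho>] pos_adjf by blast
  have "inner (K * Z) (K * Z) = inner Z (\<rho> * Z)"
    by (simp add: inner_mult_left K mult.assoc[symmetric])
  then have "K * Z = 0" using le0 inner_ge_zero[of "K * Z"] inner_eq_zero_iff[of "K * Z"] by linarith
  then have "\<rho> * Z = 0" by (metis K(2) mult.assoc mult_zero_right)
  then show 1: "\<rho> * Q = \<rho>" using d by (simp add: Z_def right_diff_distrib mult_projf)
  show "Q * \<rho> = \<rho>" using arg_cong[OF 1, of adjf] by (simp add: adjf_mult Q pos_adjf[OF \<rho>])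
qed

section \<open>Fidelity and the weighted second moment\<close>

text \<open>With \<open>G = B C\<close>, the difference \<open>A A\<^sup>\<dagger> - G G\<^sup>\<dagger>\<close> is the symmetrised product of \<open>A - G\<close> and \<open>A + G\<close>,
  which yields the Fuchs--van de Graaf bound; passing from \<open>G G\<^sup>\<dagger>\<close> to \<open>B B\<close> costs at most the
  trace of the difference.\<close>

lemma fidelity_trace_bound:
  assumes A: "A\<^sup>\<dagger> = A" and B: "B\<^sup>\<dagger> = B" and C: "contr C" and U: "contr U"
    and nA: "norm A \<le> 1" and nB: "norm B \<le> 1" and e: "0 \<le> e"
    and F: "1 - e\<^sup>2 \<le> (rtr (C * (A * B)))\<^sup>2"
  shows "rtr (U * (A * A - B * B)) \<le> 2 * e + e\<^sup>2"
proof -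
  define G where "G = B * C"
  define D where "D = A - G"
  define S where "S = A + G"
  have nG: "norm G \<le> norm B" unfolding G_def by (rule contr_norm_right[OF C])
  have nG1: "norm G \<le> 1" using nG nB by simp
  define f where "f = inner A G"
  have f: "rtr (C * (A * B)) = f"
    unfolding f_def G_def inner_fmat_def A using rtr_mult_commute[of C "A * B"] by (simp add: mult.assoc)
  have fG: "f\<^sup>2 \<le> (norm G)\<^sup>2"
  proof -
    have "\<bar>f\<bar> \<le> norm A * norm G" unfolding f_def by (rule Cauchy_Schwarz_ineq2)
    also have "\<dots> \<le> norm G" using nA by (simp add: mult_left_le_one_le)
    finally show ?thesis by (metis abs_le_square_iff abs_norm_cancel)
  qed
  have UD: "rtr (U * (D * S\<^sup>\<dagger>)) \<le> norm D * norm S"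
  proof -
    have "rtr (U * (D * S\<^sup>\<dagger>)) \<le> norm (U * D) * norm (S\<^sup>\<dagger>)"
      unfolding mult.assoc[symmetric] by (rule rtr_mult_le_norm)
    also have "\<dots> \<le> norm D * norm S"
      using contr_norm_left[OF U, of D] by (simp add: mult_right_mono)
    finally show ?thesis .
  qed
  have US: "rtr (U * (S * D\<^sup>\<dagger>)) \<le> norm D * norm S"
  proof -
    have "rtr (U * (S * D\<^sup>\<dagger>)) \<le> norm (U * S) * norm (D\<^sup>\<dagger>)"
      unfolding mult.assoc[symmetric] by (rule rtr_mult_le_norm)
    also have "\<dots> \<le> norm S * norm D"
      using contr_norm_left[OF U, of S] by (simp add: mult_right_mono)
    finally show ?thesis by (simp add: mult.commute)
  qed
  have "2 *\<^sub>R (A * A - G * G\<^sup>\<dagger>) = D * S\<^sup>\<dagger> + S * D\<^sup>\<dagger>"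
    unfolding D_def S_def by (simp add: adjf_simps A algebra_simps scaleR_2)
  then have "2 * rtr (U * (A * A - G * G\<^sup>\<dagger>)) = rtr (U * (D * S\<^sup>\<dagger>)) + rtr (U * (S * D\<^sup>\<dagger>))"
    unfolding rtr_add[symmetric] rtr_scaleR[symmetric] distrib_left[symmetric] mult_scaleR_right[symmetric]
    by simp
  then have 1: "rtr (U * (A * A - G * G\<^sup>\<dagger>)) \<le> norm D * norm S" using UD US by linarith
  have 2: "norm D * norm S \<le> 2 * e"
  proof -
    define g where "g = (norm A)\<^sup>2 + (norm G)\<^sup>2"
    have "(norm A)\<^sup>2 \<le> 1" "(norm G)\<^sup>2 \<le> 1" using nA nG1 by (simp_all add: power_le_one)
    then have g: "0 \<le> g" "g \<le> 2" by (simp_all add: g_def)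
    have D2: "(norm D)\<^sup>2 = g - 2 * f" and S2: "(norm S)\<^sup>2 = g + 2 * f"
      unfolding D_def S_def g_def f_def power2_norm_eq_inner
      by (simp_all add: inner_diff inner_add inner_commute)
    have "(norm D * norm S)\<^sup>2 = g\<^sup>2 - 4 * f\<^sup>2"
      unfolding power_mult_distrib D2 S2 by (simp add: algebra_simps power2_eq_square)
    also have "\<dots> \<le> 2\<^sup>2 - 4 * f\<^sup>2" using g by (intro diff_right_mono power_mono) auto
    also have "\<dots> \<le> (2 * e)\<^sup>2" using F unfolding f by (simp add: power_mult_distrib)
    finally show ?thesis by (rule power2_le_imp_le) (use e in auto)
  qed
  \<comment> \<open>\<open>P\<close> is \<open>B\<close> conjugating the defect of
    \<open>C * C\<^sup>\<dagger>\<close> from the identity, positive because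
    \<open>C\<^sup>\<dagger>\<close> is a contraction. Its trace is at most
    \<open>1 - f\<^sup>2\<close>, which is the source of the summand
    \<open>e\<^sup>2\<close>.\<close>
  define P where "P = B * B - G * G\<^sup>\<dagger>"
  have posP: "pos P"
    unfolding pos_def
  proof (intro conjI allI)
    show "P\<^sup>\<dagger> = P" by (simp add: P_def adjf_simps B)
    fix X
    have "inner X (P * X) = (norm (B * X))\<^sup>2 - (norm (C\<^sup>\<dagger> * (B * X)))\<^sup>2"
      unfolding P_def G_def power2_norm_eq_inner
      by (simp add: inner_mult_left adjf_simps B left_diff_distrib inner_diff_right mult.assoc)
    moreover have "(norm (C\<^sup>\<dagger> * (B * X)))\<^sup>2 \<le> (norm (B * X))\<^sup>2"
      using contr_norm_left[OF contr_adjf[OF C]] by (intro power_mono) auto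
    ultimately show "0 \<le> inner X (P * X)" by simp
  qed
  have "rtr (- U * P) \<le> rtr P" by (rule rtr_contr_pos_le[OF contr_uminus[OF U] posP])
  also have "rtr P = (norm B)\<^sup>2 - (norm G)\<^sup>2"
    unfolding P_def rtr_minus norm_sq_rtr B by (simp add: rtr_mult_commute)
  also have "\<dots> \<le> 1 - f\<^sup>2" using nB fG by (intro diff_mono) (auto simp: power_le_one)
  also have "\<dots> \<le> e\<^sup>2" using F f by simp
  finally have 3: "rtr (- U * P) \<le> e\<^sup>2" .
  have "U * (A * A - B * B) = U * (A * A - G * G\<^sup>\<dagger>) + (- U * P)"
    unfolding P_def by (simp add: algebra_simps)
  then show ?thesis using 1 2 3 by (simp only: rtr_add)
qed

text \<open>A variance computation: subtracting the mean costs \<open>(norm T)\<^sup>2 / L\<close>,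
  and the squared norms of the fibre sums expand into inner products over colliding pairs.
  Nonnegative inner products let the collision counts be replaced by their bounds.\<close>

lemma collision_second_moment:
  fixes Y :: "'x \<Rightarrow> fmat" and f :: "'k \<Rightarrow> 'x \<Rightarrow> 'z"
  assumes fin: "finite X" "finite K" "finite Z" and Z: "Z \<noteq> {}"
    and range: "\<And>k x. k \<in> K \<Longrightarrow> x \<in> X \<Longrightarrow> f k x \<in> Z"
    and coll: "\<And>x x'. x \<in> X \<Longrightarrow> x' \<in> X \<Longrightarrow> x \<noteq> x' \<Longrightarrow>
      real (card {k \<in> K. f k x = f k x'}) \<le> \<delta> * real (card K)"
    and nonneg: "\<And>x x'. x \<in> X \<Longrightarrow> x' \<in> X \<Longrightarrow> 0 \<le> inner (Y x) (Y x')" and \<delta>: "0 \<le> \<delta>"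
  shows "(\<Sum>k\<in>K. \<Sum>z\<in>Z. (norm ((\<Sum>x\<in>{x\<in>X. f k x = z}. Y x) - (1 / real (card Z)) *\<^sub>R (\<Sum>x\<in>X. Y x)))\<^sup>2)
    \<le> real (card K) * ((\<Sum>x\<in>X. (norm (Y x))\<^sup>2) + (\<delta> - 1 / real (card Z)) * (norm (\<Sum>x\<in>X. Y x))\<^sup>2)"
proof -
  define T where "T = (\<Sum>x\<in>X. Y x)"
  define L where "L = real (card Z)"
  define S where "S = (\<lambda>k z. \<Sum>x\<in>{x\<in>X. f k x = z}. Y x)"
  have L: "0 < L" using fin Z by (auto simp: L_def card_gt_0_iff)
  have sumS: "(\<Sum>z\<in>Z. S k z) = T" if "k \<in> K" for k
    unfolding S_def T_def using sum.group[of X Z "f k" Y] fin range that by auto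
  \<comment> \<open>The cross term collapses because the fibre sums \<open>S k z\<close> add up to
    \<open>T\<close>.\<close>
  have inner_k: "(\<Sum>z\<in>Z. (norm (S k z - (1 / L) *\<^sub>R T))\<^sup>2) = (\<Sum>z\<in>Z. (norm (S k z))\<^sup>2) - (1 / L) * (norm T)\<^sup>2"
    if "k \<in> K" for k
  proof -
    have "(norm (S k z - (1 / L) *\<^sub>R T))\<^sup>2
      = (norm (S k z))\<^sup>2 - (2 / L) * inner (S k z) T + (1 / L)\<^sup>2 * (norm T)\<^sup>2" for z
      unfolding power2_norm_eq_inner
      by (simp add: inner_diff inner_commute power2_eq_square algebra_simps)
    then have "(\<Sum>z\<in>Z. (norm (S k z - (1 / L) *\<^sub>R T))\<^sup>2)
      = (\<Sum>z\<in>Z. (norm (S k z))\<^sup>2) - (2 / L) * inner (\<Sum>z\<in>Z. S k z) T + L * ((1 / L)\<^sup>2 * (norm T)\<^sup>2)"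
      by (simp add: sum.distrib sum_subtractf sum_distrib_left[symmetric] sum_divide_distrib[symmetric]
        inner_sum_left L_def)
    also have "(2 / L) * inner (\<Sum>z\<in>Z. S k z) T = 2 * ((1 / L) * (norm T)\<^sup>2)"
      by (simp add: sumS[OF that] power2_norm_eq_inner)
    also have "L * ((1 / L)\<^sup>2 * (norm T)\<^sup>2) = (1 / L) * (norm T)\<^sup>2"
      using L by (simp add: power2_eq_square)
    finally show ?thesis by linarith
  qed
  have sq: "(\<Sum>z\<in>Z. (norm (S k z))\<^sup>2) = (\<Sum>x\<in>X. \<Sum>x'\<in>X. (if f k x = f k x' then inner (Y x) (Y x') else 0))"
    if "k \<in> K" for k
  proof -
    have "(norm (S k z))\<^sup>2 = (\<Sum>x\<in>{x\<in>X. f k x = z}. \<Sum>x'\<in>X. (if f k x = f k x' then inner (Y x) (Y x') else 0))" for z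
    proof -
      have "(norm (S k z))\<^sup>2 = (\<Sum>x\<in>{x\<in>X. f k x = z}. \<Sum>x'\<in>{x'\<in>X. f k x' = z}. inner (Y x) (Y x'))"
        unfolding power2_norm_eq_inner S_def inner_sum_left inner_sum_right
        by (rule sum.swap)
      also have "\<dots> = (\<Sum>x\<in>{x\<in>X. f k x = z}. \<Sum>x'\<in>X. (if f k x = f k x' then inner (Y x) (Y x') else 0))"
        unfolding sum.inter_filter[OF fin(1)] by (intro sum.cong refl) (auto intro!: sum.cong)
      finally show ?thesis .
    qed
    moreover have "f k ` X \<subseteq> Z" using range that by auto
    ultimately show ?thesis by (simp only: sum.group[OF fin(1,3)])
  qed
  have TT: "(norm T)\<^sup>2 = (\<Sum>x\<in>X. \<Sum>x'\<in>X. inner (Y x) (Y x'))"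
    unfolding power2_norm_eq_inner T_def inner_sum_left inner_sum_right by (rule sum.swap)
  have "(\<Sum>k\<in>K. \<Sum>z\<in>Z. (norm (S k z))\<^sup>2)
    = (\<Sum>k\<in>K. \<Sum>x\<in>X. \<Sum>x'\<in>X. (if f k x = f k x' then inner (Y x) (Y x') else 0))"
    by (intro sum.cong refl sq)
  also have "\<dots> = (\<Sum>x\<in>X. \<Sum>x'\<in>X. \<Sum>k\<in>K. (if f k x = f k x' then inner (Y x) (Y x') else 0))"
    by (subst sum.swap, intro sum.cong refl, rule sum.swap)
  also have "\<dots> = (\<Sum>x\<in>X. \<Sum>x'\<in>X. real (card {k\<in>K. f k x = f k x'}) * inner (Y x) (Y x'))"
    using fin by (intro sum.cong refl) (simp add: sum.inter_filter[symmetric])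
  \<comment> \<open>A diagonal pair collides under every key. Giving it weight
    \<open>1 + \<delta>\<close> instead of 1 completes the \<delta>-part to the full double sum,
    which is \<open>(norm T)\<^sup>2\<close>.\<close>
  also have "\<dots> \<le> (\<Sum>x\<in>X. \<Sum>x'\<in>X. real (card K) * ((if x' = x then inner (Y x) (Y x') else 0) + \<delta> * inner (Y x) (Y x')))"
  proof (intro sum_mono)
    fix x x' assume x: "x \<in> X" "x' \<in> X"
    show "real (card {k\<in>K. f k x = f k x'}) * inner (Y x) (Y x')
      \<le> real (card K) * ((if x' = x then inner (Y x) (Y x') else 0) + \<delta> * inner (Y x) (Y x'))"
    proof (cases "x = x'")
      case True
      then show ?thesis using nonneg[OF x] \<delta> by (simp add: distrib_left)
    next
      case False
      then show ?thesis using mult_right_mono[OF coll[OF x False] nonneg[OF x]] by (simp add: mult_ac)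
    qed
  qed
  also have "\<dots> = real (card K) * ((\<Sum>x\<in>X. (norm (Y x))\<^sup>2) + \<delta> * (norm T)\<^sup>2)"
    unfolding TT using fin by (simp add: sum_distrib_left[symmetric] sum.distrib power2_norm_eq_inner)
  finally have main: "(\<Sum>k\<in>K. \<Sum>z\<in>Z. (norm (S k z))\<^sup>2)
    \<le> real (card K) * ((\<Sum>x\<in>X. (norm (Y x))\<^sup>2) + \<delta> * (norm T)\<^sup>2)" .
  have "(\<Sum>k\<in>K. \<Sum>z\<in>Z. (norm (S k z - (1 / L) *\<^sub>R T))\<^sup>2)
    = (\<Sum>k\<in>K. (\<Sum>z\<in>Z. (norm (S k z))\<^sup>2) - (1 / L) * (norm T)\<^sup>2)"
    by (intro sum.cong refl inner_k)
  also have "\<dots> = (\<Sum>k\<in>K. \<Sum>z\<in>Z. (norm (S k z))\<^sup>2) - real (card K) * ((1 / L) * (norm T)\<^sup>2)"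
    by (simp add: sum_subtractf)
  also have "\<dots> \<le> real (card K) * ((\<Sum>x\<in>X. (norm (Y x))\<^sup>2) + \<delta> * (norm T)\<^sup>2) - real (card K) * ((1 / L) * (norm T)\<^sup>2)"
    using main by simp
  finally show ?thesis unfolding S_def T_def L_def by (simp add: algebra_simps)
qed

text \<open>Since \<open>M = W * (V * M * V) * W\<close>, cyclicity of the trace moves the weights
  \<open>W\<close> onto \<open>U\<close>, and Cauchy--Schwarz separates the two factors.\<close>

lemma rtr_contr_weighted:
  assumes U: "contr U" and W: "W\<^sup>\<dagger> = W" and V: "V\<^sup>\<dagger> = V" and Q: "W * V = Q" "V * W = Q"
    and M: "Q * M = M" "M * Q = M"
  shows "rtr (U * M) \<le> norm (W * W) * norm (V * M * V)"
proof -
  have "W * (V * M * V) * W = (W * V) * M * (V * W)" by (simp add: mult.assoc)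
  then have "rtr (U * M) = rtr (U * (W * (V * M * V) * W))" by (simp add: Q M)
  also have "\<dots> = rtr ((W * U * W) * (V * M * V))"
    using rtr_mult_commute[of W "U * W * (V * M * V)"] by (simp add: mult.assoc)
  also have "\<dots> \<le> norm (W * U * W) * norm (V * M * V)" by (rule rtr_mult_le_norm)
  finally have 1: "rtr (U * M) \<le> norm (W * U * W) * norm (V * M * V)" .
  have "(norm (W * U * W))\<^sup>2 = inner (W * (U * W)) (W * (U * W))"
    by (simp add: power2_norm_eq_inner mult.assoc)
  also have "\<dots> = inner (U * W) (W * W * U * W)" by (simp add: inner_mult_left[of W] W mult.assoc)
  also have "\<dots> = inner (U * (W * W)) (W * W * U)"
    by (simp add: inner_mult_right[of U] W adjf_mult mult.assoc)
  also have "\<dots> \<le> norm (U * (W * W)) * norm (W * W * U)" by (rule norm_cauchy_schwarz)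
  also have "\<dots> \<le> norm (W * W) * norm (W * W)"
    by (intro mult_mono contr_norm_left contr_norm_right U) auto
  finally have "norm (W * U * W) \<le> norm (W * W)"
    unfolding power2_eq_square[of "norm (W * W)", symmetric] by (rule power2_le_imp_le) simp
  then show ?thesis using 1 by (meson mult_right_mono norm_ge_zero order_trans)
qed

text \<open>Conjugate the domination by \<open>V\<close> and pair it with the positive
  \<open>Y\<close>. The right side is \<open>c\<close> times the trace of \<open>\<rho> * Q\<close>,
  and \<rho> absorbs \<open>Q\<close>.\<close>

lemma weighted_norm_le:
  assumes \<rho>: "pos \<rho>" and \<tau>: "pos (c *\<^sub>R \<tau> - \<rho>)" and V: "V\<^sup>\<dagger> = V"
    and Q: "V * V * \<tau> * (V * V) = Q" "\<rho> * Q = \<rho>"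
  shows "(norm (V * \<rho> * V))\<^sup>2 \<le> c * rtr \<rho>"
proof -
  define Y where "Y = V * \<rho> * V"
  have Y: "pos Y" using pos_conj[OF \<rho>, of V] by (simp add: Y_def V)
  have "pos (V * (c *\<^sub>R \<tau> - \<rho>) * V)" using pos_conj[OF \<tau>, of V] by (simp add: V)
  then have "0 \<le> inner Y (V * (c *\<^sub>R \<tau> - \<rho>) * V)" by (rule inner_pos_nonneg[OF Y])
  also have "V * (c *\<^sub>R \<tau> - \<rho>) * V = c *\<^sub>R (V * \<tau> * V) - Y"
    by (simp add: Y_def algebra_simps)
  finally have "(norm Y)\<^sup>2 \<le> c * inner Y (V * \<tau> * V)"
    by (simp add: inner_diff_right power2_norm_eq_inner)
  also have "inner Y (V * \<tau> * V) = rtr (\<rho> * (V * V * \<tau> * (V * V)))"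
    unfolding inner_fmat_def pos_adjf[OF Y] unfolding Y_def
    using rtr_mult_commute[of V "\<rho> * V * V * \<tau> * V"] by (simp add: mult.assoc)
  finally show ?thesis by (simp add: Q Y_def)
qed

text \<open>The contractions \<open>U k z\<close> are arbitrary, so this amounts to a bound on trace
  norms summed over \<open>k\<close> and \<open>z\<close>. Each trace is split by the weighted
  Cauchy--Schwarz inequality; the remaining norms are summed by a second Cauchy--Schwarz and the
  collision estimate.\<close>

lemma leftover_hash_core:
  fixes \<rho> :: "'x \<Rightarrow> fmat" and f :: "'k \<Rightarrow> 'x \<Rightarrow> 'z"
  defines "R \<equiv> \<lambda>X. \<Sum>x\<in>X. \<rho> x"
  assumes fin: "finite X" "finite K" "finite Z" and Z: "Z \<noteq> {}"
    and range: "\<And>k x. k \<in> K \<Longrightarrow> x \<in> X \<Longrightarrow> f k x \<in> Z"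
    and coll: "\<And>x x'. x \<in> X \<Longrightarrow> x' \<in> X \<Longrightarrow> x \<noteq> x' \<Longrightarrow>
      real (card {k \<in> K. f k x = f k x'}) \<le> \<delta> * real (card K)"
    and \<delta>: "1 \<le> \<delta> * real (card Z)"
    and \<rho>: "\<And>x. x \<in> X \<Longrightarrow> pos (\<rho> x)" and \<tau>: "pos \<tau>" and c: "0 \<le> c"
    and dom: "\<And>x. x \<in> X \<Longrightarrow> pos (c *\<^sub>R \<tau> - \<rho> x)" and domR: "pos (\<tau> - R X)" and tr: "rtr (R X) \<le> 1"
    and U: "\<And>k z. contr (U k z)"
  shows "(\<Sum>k\<in>K. \<Sum>z\<in>Z. rtr (U k z * (R {x\<in>X. f k x = z} - (1 / real (card Z)) *\<^sub>R R X)))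
    \<le> real (card K) * sqrt (rtr \<tau> * (real (card Z) * c + (\<delta> * real (card Z) - 1)))"
proof -
  define L where "L = real (card Z)"
  have L: "0 < L" using fin Z by (auto simp: L_def card_gt_0_iff)
  have "1 / L \<le> \<delta>" using \<delta> L unfolding L_def[symmetric] by (simp add: pos_divide_le_eq)
  moreover have "0 < 1 / L" using L by simp
  ultimately have \<delta>0: "0 \<le> \<delta>" "0 \<le> \<delta> - 1 / L" by linarith+
  obtain W V Q where W: "W\<^sup>\<dagger> = W" and V: "V\<^sup>\<dagger> = V" and Q: "Q\<^sup>\<dagger> = Q" "V * W = Q" "W * V = Q"
    and W4: "W * W * (W * W) = \<tau>" and TQ: "\<tau> * Q = \<tau>" and VTV: "V * V * \<tau> * (V * V) = Q"
    using pos_fourth_root[OF \<tau>] by blast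
  have \<rho>Q: "\<rho> x * Q = \<rho> x" "Q * \<rho> x = \<rho> x" if "x \<in> X" for x
    using dominated_absorbs_support[OF \<rho> dom Q(1) TQ] that by auto
  have RQ: "R A * Q = R A" "Q * R A = R A" if "A \<subseteq> X" for A
    unfolding R_def sum_distrib_left sum_distrib_right using that \<rho>Q by (auto intro!: sum.cong)
  have posR: "pos (R A)" if "A \<subseteq> X" for A unfolding R_def using that \<rho> by (intro pos_sum) auto
  define Y where "Y = (\<lambda>x. V * \<rho> x * V)"
  define N where "N = (\<lambda>k z. (\<Sum>x\<in>{x\<in>X. f k x = z}. Y x) - (1 / L) *\<^sub>R (\<Sum>x\<in>X. Y x))"
  have Ysum: "(\<Sum>x\<in>A. Y x) = V * R A * V" for A
    by (simp add: Y_def R_def sum_distrib_left sum_distrib_right)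
  have step: "rtr (U k z * (R {x\<in>X. f k x = z} - (1 / L) *\<^sub>R R X)) \<le> norm (W * W) * norm (N k z)" for k z
  proof -
    have "rtr (U k z * (R {x\<in>X. f k x = z} - (1 / L) *\<^sub>R R X))
      \<le> norm (W * W) * norm (V * (R {x\<in>X. f k x = z} - (1 / L) *\<^sub>R R X) * V)"
      by (rule rtr_contr_weighted[OF U W V Q(3,2)]) (simp_all add: RQ algebra_simps)
    then show ?thesis unfolding N_def Ysum by (simp add: algebra_simps)
  qed
  have W2: "(norm (W * W))\<^sup>2 = rtr \<tau>" by (simp add: norm_sq_rtr adjf_mult W W4)
  have YX: "(\<Sum>x\<in>X. (norm (Y x))\<^sup>2) \<le> c"
  proof -
    have "(\<Sum>x\<in>X. (norm (Y x))\<^sup>2) \<le> (\<Sum>x\<in>X. c * rtr (\<rho> x))"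
      unfolding Y_def using \<rho> dom \<rho>Q by (intro sum_mono weighted_norm_le[OF _ _ V VTV]) auto
    also have "\<dots> = c * rtr (R X)" by (simp add: R_def rtr_sum sum_distrib_left)
    also have "\<dots> \<le> c" using tr c by (simp add: mult_left_le)
    finally show ?thesis .
  qed
  have "(norm (V * R X * V))\<^sup>2 \<le> 1 * rtr (R X)"
    using domR by (intro weighted_norm_le[OF posR _ V VTV]) (auto simp: RQ)
  then have YT: "(norm (\<Sum>x\<in>X. Y x))\<^sup>2 \<le> 1" unfolding Ysum using tr by simp
  have "(\<Sum>k\<in>K. \<Sum>z\<in>Z. (norm (N k z))\<^sup>2)
    \<le> real (card K) * ((\<Sum>x\<in>X. (norm (Y x))\<^sup>2) + (\<delta> - 1 / L) * (norm (\<Sum>x\<in>X. Y x))\<^sup>2)"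
    unfolding N_def L_def
  proof (rule collision_second_moment[OF fin Z range coll _ \<delta>0(1)])
    fix x x' assume "x \<in> X" "x' \<in> X"
    then show "0 \<le> inner (Y x) (Y x')"
      using pos_conj[OF \<rho>, of _ V] by (intro inner_pos_nonneg) (auto simp: Y_def V)
  qed
  also have "\<dots> \<le> real (card K) * (c + (\<delta> - 1 / L) * 1)"
    by (intro mult_left_mono add_mono YX YT \<delta>0) auto
  finally have N2: "(\<Sum>k\<in>K. \<Sum>z\<in>Z. (norm (N k z))\<^sup>2) \<le> real (card K) * (c + (\<delta> - 1 / L))" by simp
  \<comment> \<open>Cauchy--Schwarz over all pairs \<open>(k, z)\<close>, of which there are
    \<open>card K * L\<close>; the factor \<open>L\<close> later turns
    \<open>\<delta> - 1 / L\<close> into \<open>\<delta> * L - 1\<close>.\<close>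
  have CS: "(\<Sum>k\<in>K. \<Sum>z\<in>Z. norm (N k z))\<^sup>2 \<le> (real (card K) * L) * (\<Sum>k\<in>K. \<Sum>z\<in>Z. (norm (N k z))\<^sup>2)"
    using sum_squared_le_sum_of_squares[of "\<lambda>(k,z). norm (N k z)" "K \<times> Z"]
    by (simp add: sum.cartesian_product case_prod_beta L_def mult.commute
        card_cartesian_product)
  have "((\<Sum>k\<in>K. \<Sum>z\<in>Z. norm (W * W) * norm (N k z)))\<^sup>2
    = rtr \<tau> * (\<Sum>k\<in>K. \<Sum>z\<in>Z. norm (N k z))\<^sup>2"
    by (simp add: sum_distrib_left[symmetric] power_mult_distrib W2)
  also have "\<dots> \<le> rtr \<tau> * ((real (card K) * L) * (real (card K) * (c + (\<delta> - 1 / L))))"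
    by (intro mult_left_mono pos_rtr_nonneg[OF \<tau>] order_trans[OF CS] N2) (use L in auto)
  also have "\<dots> = (real (card K))\<^sup>2 * (rtr \<tau> * (L * c + (\<delta> * L - 1)))"
    using L by (simp add: field_simps power2_eq_square)
  finally have "(\<Sum>k\<in>K. \<Sum>z\<in>Z. norm (W * W) * norm (N k z))
    \<le> sqrt ((real (card K))\<^sup>2 * (rtr \<tau> * (L * c + (\<delta> * L - 1))))"
    by (rule real_le_rsqrt)
  also have "\<dots> = real (card K) * sqrt (rtr \<tau> * (L * c + (\<delta> * L - 1)))"
    by (simp add: real_sqrt_mult)
  finally have "(\<Sum>k\<in>K. \<Sum>z\<in>Z. norm (W * W) * norm (N k z))
    \<le> real (card K) * sqrt (rtr \<tau> * (L * c + (\<delta> * L - 1)))" .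
  then show ?thesis
    unfolding L_def[symmetric] by (rule order_trans[rotated]) (intro sum_mono step)
qed

section \<open>Transfer to the matrices of dimension d\<close>

text \<open>Padding by zeros. It forgets the dimension, so it is injective only among matrices of
  one fixed size (\<open>conv_inj\<close>).\<close>

lift_definition conv :: "complex mat \<Rightarrow> fmat" is
  "\<lambda>M i j. if i < dim_row M \<and> j < dim_col M then M $$ (i,j) else 0"
proof -
  fix M :: "complex mat"
  show "\<exists>N. fbounded (\<lambda>i j. if i < dim_row M \<and> j < dim_col M then M $$ (i,j) else 0) N"
    by (rule exI[of _ "max (dim_row M) (dim_col M)"]) (auto simp: fbounded_def)
qed

lemma fbounded_conv: "M \<in> carrier_mat d d \<Longrightarrow> fbounded (entry (conv M)) d"
  by (auto simp: fbounded_def conv.rep_eq)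

lemma entry_sum: "entry (\<Sum>x\<in>I. f x) i j = (\<Sum>x\<in>I. entry (f x) i j)"
  by (induction I rule: infinite_finite_induct) (auto simp: zero_fmat.rep_eq plus_fmat.rep_eq)

lemma conv_mult:
  assumes "A \<in> carrier_mat d d" "B \<in> carrier_mat d d"
  shows "conv (A * B) = conv A * conv B"
  by (rule fmat_eqI, subst entry_times[OF fbounded_conv[OF assms(1)]])
    (use assms in \<open>auto simp: conv.rep_eq scalar_prod_def atLeast0LessThan intro!: sum.neutral sum.cong\<close>)

lemma conv_adj: "conv (adj M) = (conv M)\<^sup>\<dagger>"
  by (rule fmat_eqI) (auto simp: conv.rep_eq adjf.rep_eq adj_def)

lemma adj_carrier: "M \<in> carrier_mat d d \<Longrightarrow> adj M \<in> carrier_mat d d"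
  by (auto simp: adj_def)

lemma rtr_conv: "M \<in> carrier_mat d d \<Longrightarrow> rtr (conv M) = Re (mtr M)"
  by (auto simp: rtr_bounded[OF fbounded_conv] mtr_def conv.rep_eq)

lemma conv_minus: "A \<in> carrier_mat d d \<Longrightarrow> B \<in> carrier_mat d d \<Longrightarrow> conv (A - B) = conv A - conv B"
  by (rule fmat_eqI) (auto simp: conv.rep_eq minus_fmat.rep_eq)

lemma conv_smult: "conv (of_real c \<cdot>\<^sub>m M) = c *\<^sub>R conv M"
  by (rule fmat_eqI) (auto simp: conv.rep_eq scaleR_fmat.rep_eq)

lemma conv_msum:
  assumes "\<And>x. x \<in> I \<Longrightarrow> F x \<in> carrier_mat d d"
  shows "conv (msum d F I) = (\<Sum>x\<in>I. conv (F x))"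
proof (rule fmat_eqI)
  fix i j
  have "entry (\<Sum>x\<in>I. conv (F x)) i j = (\<Sum>x\<in>I. if i < d \<and> j < d then F x $$ (i,j) else 0)"
    unfolding entry_sum conv.rep_eq using assms by (intro sum.cong refl) auto
  then show "entry (conv (msum d F I)) i j = entry (\<Sum>x\<in>I. conv (F x)) i j"
    by (auto simp: conv.rep_eq msum_def)
qed

lemma msum_carrier: "msum d F I \<in> carrier_mat d d"
  by (simp add: msum_def)

lemma conv_inj:
  assumes "A \<in> carrier_mat d d" "B \<in> carrier_mat d d" "conv A = conv B"
  shows "A = B"
proof (rule eq_matI)
  fix i j assume "i < dim_row B" "j < dim_col B"
  moreover have "entry (conv A) i j = entry (conv B) i j" using assms(3) by simp
  ultimately show "A $$ (i,j) = B $$ (i,j)" using assms(1,2) by (simp add: conv.rep_eq)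
qed (use assms in auto)

lemma conv_mat_of_fmat: "fbounded (entry A) d \<Longrightarrow> conv (mat_of_fmat d A) = A"
  by (rule fmat_eqI) (auto simp: conv.rep_eq mat_of_fmat_def fbounded_def)

section \<open>Positivity, square roots and the trace norm under the embedding\<close>

lemma quadratic_form_bounded:
  assumes "fbounded (entry A) d" "d \<le> N"
  shows "(\<Sum>i<N. \<Sum>k<N. cnj (v i) * entry A i k * v k) = (\<Sum>i<d. \<Sum>k<d. cnj (v i) * entry A i k * v k)"
proof -
  have "(\<Sum>i<N. \<Sum>k<N. cnj (v i) * entry A i k * v k) = (\<Sum>i<d. \<Sum>k<N. cnj (v i) * entry A i k * v k)"
    using assms by (intro sum.mono_neutral_right) (auto simp: fbounded_def)
  also have "\<dots> = (\<Sum>i<d. \<Sum>k<d. cnj (v i) * entry A i k * v k)"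
    using assms by (intro sum.cong refl sum.mono_neutral_right) (auto simp: fbounded_def)
  finally show ?thesis .
qed

lemma inner_quadratic_form:
  assumes A: "fbounded (entry A) N" and B: "fbounded (entry B) N"
  shows "inner B (A * B) = Re (\<Sum>j<N. \<Sum>i<N. \<Sum>k<N. cnj (entry B i j) * entry A i k * entry B k j)"
  unfolding inner_fmat_def rtr_bounded[OF fbounded_times[OF fbounded_adjf[OF B] fbounded_times[OF A B]]]
    entry_times[OF fbounded_adjf[OF B]] entry_times[OF A] adjf.rep_eq
  by (simp add: sum_distrib_left mult.assoc)

lemma psd_carrier: "psd d M \<Longrightarrow> M \<in> carrier_mat d d"
  by (simp add: psd_def)

text \<open>The form on matrices is a sum of quadratic forms of columns; conversely, a vector is a
  matrix whose only nonzero column is column 0.\<close>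

lemma psd_iff_pos:
  assumes M: "M \<in> carrier_mat d d"
  shows "psd d M \<longleftrightarrow> pos (conv M)"
proof
  assume psd: "psd d M"
  show "pos (conv M)" unfolding pos_def
  proof (intro conjI allI)
    show "(conv M)\<^sup>\<dagger> = conv M" using psd by (simp add: conv_adj[symmetric] psd_def)
    fix B
    obtain b where b: "fbounded (entry B) b" "fbounded (entry B) b" "fbounded (entry B) b"
      by (rule obtain_bound)
    let ?N = "max b d"
    have bd: "fbounded (entry (conv M)) ?N" "fbounded (entry B) ?N"
      using fbounded_conv[OF M] b by (auto intro: fbounded_mono)
    have "0 \<le> Re (\<Sum>i<d. \<Sum>k<d. cnj (entry B i j) * M $$ (i,k) * entry B k j)" for j
      using psd unfolding psd_def by (elim conjE) (erule allE[of _ "\<lambda>i. entry B i j"])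
    also have "(\<Sum>i<d. \<Sum>k<d. cnj (entry B i j) * M $$ (i,k) * entry B k j)
      = (\<Sum>i<d. \<Sum>k<d. cnj (entry B i j) * entry (conv M) i k * entry B k j)" for j
      using M by (intro sum.cong refl) (auto simp: conv.rep_eq)
    also have "\<dots> j = (\<Sum>i<?N. \<Sum>k<?N. cnj (entry B i j) * entry (conv M) i k * entry B k j)" for j
      by (rule quadratic_form_bounded[OF fbounded_conv[OF M], symmetric]) simp
    finally have "0 \<le> (\<Sum>j<?N. Re (\<Sum>i<?N. \<Sum>k<?N. cnj (entry B i j) * entry (conv M) i k * entry B k j))"
      by (intro sum_nonneg)
    then show "0 \<le> inner B (conv M * B)" unfolding inner_quadratic_form[OF bd] by simp
  qed
next
  assume pos: "pos (conv M)"
  show "psd d M" unfolding psd_def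
  proof (intro conjI allI M)
    show "adj M = M"
      using pos conv_inj[OF adj_carrier[OF M] M] by (simp add: conv_adj pos_def)
    fix v :: "nat \<Rightarrow> complex"
    show "0 \<le> Re (\<Sum>i<d. \<Sum>j<d. cnj (v i) * M $$ (i, j) * v j)"
    proof (cases "d = 0")
      case False
      define f where "f = (\<lambda>i (j::nat). if i < d \<and> j = 0 then v i else 0)"
      define B where "B = Abs_fmat f"
      have fb: "fbounded f d" using False by (auto simp: fbounded_def f_def)
      then have B: "entry B = f" unfolding B_def by (intro Abs_fmat_inverse) auto
      have "0 \<le> inner B (conv M * B)" using pos by (simp add: pos_def)
      also have "\<dots> = Re (\<Sum>j<d. \<Sum>i<d. \<Sum>k<d. cnj (f i j) * entry (conv M) i k * f k j)"
        using inner_quadratic_form[OF fbounded_conv[OF M], of B] fb B by simp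
      also have "(\<Sum>j<d. \<Sum>i<d. \<Sum>k<d. cnj (f i j) * entry (conv M) i k * f k j)
        = (\<Sum>j<d. if j = 0 then (\<Sum>i<d. \<Sum>k<d. cnj (v i) * M $$ (i,k) * v k) else 0)"
        using M by (intro sum.cong refl) (auto simp: f_def conv.rep_eq intro!: sum.cong)
      finally show ?thesis using False by simp
    qed simp
  qed
qed

lemma psd_pos: "psd d M \<Longrightarrow> pos (conv M)"
  using psd_iff_pos psd_carrier by blast

lemma pos_psd: "pos A \<Longrightarrow> fbounded (entry A) d \<Longrightarrow> psd d (mat_of_fmat d A)"
  by (simp add: psd_iff_pos conv_mat_of_fmat)

text \<open>A root found in the big algebra stays in dimension \<open>d\<close>: on the part
  \<open>Z\<close> of a larger corner outside \<open>projf d\<close> the matrix \<open>A\<close>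
  vanishes, so \<open>inner (B * Z) (B * Z) = inner Z (A * Z) = 0\<close>.\<close>

lemma fbounded_sqrt:
  assumes B: "B\<^sup>\<dagger> = B" "B * B = A" and A: "fbounded (entry A) d"
  shows "fbounded (entry B) d"
proof -
  obtain b where b: "fbounded (entry B) b" "fbounded (entry A) b" "fbounded (entry B) b"
    by (rule obtain_bound)
  define Z where "Z = projf b - projf d"
  have "A * Z = 0" by (simp add: Z_def right_diff_distrib mult_projf A b)
  then have "inner (B * Z) (B * Z) = 0"
    by (simp add: inner_mult_left B mult.assoc[symmetric])
  then have "B * projf d = B" using b by (simp add: Z_def right_diff_distrib mult_projf)
  then show ?thesis by (rule fbounded_of_mult_projf[OF B(1)])
qed

text \<open>Justifies the definite description in \<open>msqrt\<close>: existence is transported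
  from \<open>pos_sqrt_ex\<close>, uniqueness from \<open>pos_sqrt_unique\<close>.\<close>

lemma msqrt_props:
  assumes A: "psd d A"
  shows "psd d (msqrt d A)" "msqrt d A * msqrt d A = A"
proof -
  note Ac = psd_carrier[OF A]
  obtain S where S: "pos S" "S * S = conv A" using pos_sqrt_ex[OF psd_pos[OF A]] by blast
  have Sb: "fbounded (entry S) d" by (rule fbounded_sqrt[OF pos_adjf[OF S(1)] S(2) fbounded_conv[OF Ac]])
  have "\<exists>!B. psd d B \<and> B * B = A"
  proof (rule ex1I[of _ "mat_of_fmat d S"])
    have "mat_of_fmat d S * mat_of_fmat d S = A"
      by (rule conv_inj[OF _ Ac]) (auto simp: conv_mult[of _ d] conv_mat_of_fmat[OF Sb] S mult_carrier_mat[of _ d d])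
    then show "psd d (mat_of_fmat d S) \<and> mat_of_fmat d S * mat_of_fmat d S = A"
      using pos_psd[OF S(1) Sb] by simp
  next
    fix B assume B: "psd d B \<and> B * B = A"
    note Bc = psd_carrier[of d B]
    have "conv B = S"
      by (rule pos_sqrt_unique) (use B S psd_pos Bc in \<open>auto simp: conv_mult[of _ d, symmetric]\<close>)
    then show "B = mat_of_fmat d S"
      using B Bc by (intro conv_inj[of B d]) (auto simp: conv_mat_of_fmat[OF Sb])
  qed
  then have "psd d (msqrt d A) \<and> msqrt d A * msqrt d A = A"
    unfolding msqrt_def by (rule theI')
  then show "psd d (msqrt d A)" "msqrt d A * msqrt d A = A" by auto
qed

lemma mabs_props:
  assumes M: "M \<in> carrier_mat d d"
  shows "psd d (mabs d M)" "conv (mabs d M) * conv (mabs d M) = (conv M)\<^sup>\<dagger> * conv M"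
proof -
  have MM: "adj M * M \<in> carrier_mat d d" using adj_carrier[OF M] M by simp
  have eq: "conv (adj M * M) = (conv M)\<^sup>\<dagger> * conv M"
    by (simp add: conv_mult[OF adj_carrier[OF M] M] conv_adj)
  have "pos ((conv M)\<^sup>\<dagger> * conv M)"
    unfolding pos_def
  proof (intro conjI allI)
    fix B
    have "inner B ((conv M)\<^sup>\<dagger> * conv M * B) = inner (conv M * B) (conv M * B)"
      by (simp add: inner_mult_left mult.assoc)
    then show "0 \<le> inner B ((conv M)\<^sup>\<dagger> * conv M * B)" by simp
  qed (simp add: adjf_mult)
  then have "psd d (adj M * M)" using psd_iff_pos[OF MM] eq by simp
  from msqrt_props[OF this] show "psd d (mabs d M)"
    "conv (mabs d M) * conv (mabs d M) = (conv M)\<^sup>\<dagger> * conv M"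
    unfolding mabs_def eq[symmetric] by (auto simp: conv_mult[of _ d, symmetric] psd_carrier)
qed

lemma tnorm_nonneg: "M \<in> carrier_mat d d \<Longrightarrow> 0 \<le> tnorm d M"
  unfolding tnorm_def using mabs_props(1)[of M d]
  by (metis psd_carrier psd_pos pos_rtr_nonneg rtr_conv)

text \<open>The polar contraction carries \<open>M\<close> to its absolute value, whose trace is the
  trace norm.\<close>

lemma tnorm_dual:
  assumes M: "M \<in> carrier_mat d d"
  shows "\<exists>C. contr C \<and> tnorm d M = rtr (C * conv M)"
proof -
  note K = mabs_props[OF M]
  obtain C where "contr C" "C * conv M = conv (mabs d M)"
    using polar_contr[OF psd_pos[OF K(1)] K(2)] by blast
  then show ?thesis
    unfolding tnorm_def using rtr_conv[OF psd_carrier[OF K(1)]] by (intro exI[of _ C]) simp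
qed

text \<open>\<open>Hmin\<close> and \<open>d_u\<close> compare complex traces; a self-adjoint matrix
  has a real diagonal, so the real traces decide.\<close>

lemma psd_mtr: "psd d A \<Longrightarrow> mtr A = of_real (rtr (conv A))"
proof -
  assume A: "psd d A"
  have c: "A \<in> carrier_mat d d" and h: "adj A = A" using A by (auto simp: psd_def)
  have "cnj (A $$ (i,i)) = A $$ (i,i)" if "i < d" for i
    using arg_cong[OF h, of "\<lambda>X. X $$ (i,i)"] that c by (auto simp: adj_def)
  then have "cnj (mtr A) = mtr A" using c by (auto simp: mtr_def cnj_sum intro!: sum.cong)
  then have "Im (mtr A) = 0" by (metis complex_In_mult_cnj_zero complex_is_Real_iff Reals_cnj_iff)
  then show ?thesis by (simp add: rtr_conv[OF c] complex_eq_iff)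
qed

text \<open>The isometry taking a vector \<open>v\<close> to \<open>|a>\<close> tensor
  \<open>v\<close>: \<open>blk e a * A * (blk e a)\<^sup>\<dagger>\<close> puts \<open>A\<close>
  into diagonal block \<open>a\<close>, and \<open>(blk e a)\<^sup>\<dagger> * X * blk e a\<close>
  reads that block off.\<close>

lift_definition blk :: "nat \<Rightarrow> nat \<Rightarrow> fmat" is "\<lambda>e a i j. if j < e \<and> i = a * e + j then 1 else 0"
proof -
  fix e a :: nat
  show "\<exists>N. fbounded (\<lambda>i j. if j < e \<and> i = a * e + j then 1 else 0) N"
    by (rule exI[of _ "a * e + e"]) (auto simp: fbounded_def)
qed

lemma fbounded_blk: "fbounded (entry (blk e a)) (a * e + e)"
  by (auto simp: fbounded_def blk.rep_eq)

lemma entry_blk_mult: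
  assumes e: "0 < e"
  shows "entry (blk e a * A) i j = (if i div e = a then entry A (i mod e) j else 0)"
proof -
  have iff: "(k < e \<and> i = a * e + k) \<longleftrightarrow> (i div e = a \<and> k = i mod e)" for k
    using e by auto
  have "entry (blk e a * A) i j = (\<Sum>k<a * e + e. (if k = i mod e then if i div e = a then entry A k j else 0 else 0))"
    unfolding entry_times[OF fbounded_blk] blk.rep_eq iff by (intro sum.cong) auto
  also have "\<dots> = (if i div e = a then entry A (i mod e) j else 0)"
    using e by (simp add: trans_less_add2)
  finally show ?thesis .
qed

lemma entry_blk_conj:
  assumes e: "0 < e"
  shows "entry (blk e a * A * (blk e a)\<^sup>\<dagger>) i j
    = (if i div e = a \<and> j div e = a then entry A (i mod e) (j mod e) else 0)"
proof -
  have "blk e a * A * (blk e a)\<^sup>\<dagger> = (blk e a * (blk e a * A)\<^sup>\<dagger>)\<^sup>\<dagger>"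
    by (simp add: adjf_mult mult.assoc)
  then show ?thesis by (simp add: adjf.rep_eq entry_blk_mult[OF e])
qed

lemma blk_orthonormal:
  assumes e: "0 < e"
  shows "(blk e a)\<^sup>\<dagger> * blk e b = (if a = b then projf e else 0)"
proof (rule fmat_eqI)
  fix i j
  let ?N = "max (a * e + e) (b * e + e)"
  have b: "fbounded (entry ((blk e a)\<^sup>\<dagger>)) ?N"
    by (rule fbounded_adjf[OF fbounded_mono[OF fbounded_blk]]) simp
  have "entry ((blk e a)\<^sup>\<dagger> * blk e b) i j
    = (\<Sum>k<?N. if k = a * e + i then (if i < e \<and> j < e \<and> a * e + i = b * e + j then 1 else 0) else 0)"
    unfolding entry_times[OF b] adjf.rep_eq blk.rep_eq by (intro sum.cong) auto
  also have "\<dots> = (if i < e \<and> j < e \<and> a * e + i = b * e + j then 1 else 0)"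
    by (auto simp: less_max_iff_disj)
  also have "(i < e \<and> j < e \<and> a * e + i = b * e + j) \<longleftrightarrow> a = b \<and> i = j \<and> i < e"
    by (metis add_left_cancel div_mult_self3 div_less add_0_right e less_numeral_extra(3))
  finally show "entry ((blk e a)\<^sup>\<dagger> * blk e b) i j = entry (if a = b then projf e else 0) i j"
    by (auto simp: projf.rep_eq zero_fmat.rep_eq)
qed

lemma contr_blk: "0 < e \<Longrightarrow> contr (blk e a)"
  using contr_of_mult_adjf[of "projf e" "(blk e a)\<^sup>\<dagger>"] contr_adjf[of "(blk e a)\<^sup>\<dagger>"]
  by (simp add: blk_orthonormal projf_idem)

lemma blk_complete:
  assumes e: "0 < e"
  shows "(\<Sum>a<D. blk e a * projf e * (blk e a)\<^sup>\<dagger>) = projf (D * e)"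
proof (rule fmat_eqI)
  fix i j
  have "entry (\<Sum>a<D. blk e a * projf e * (blk e a)\<^sup>\<dagger>) i j
    = (\<Sum>a<D. if a = i div e then (if j div e = i div e \<and> i mod e = j mod e then 1 else 0) else 0)"
    unfolding entry_sum entry_blk_conj[OF e] projf.rep_eq using e by (intro sum.cong) auto
  also have "(j div e = i div e \<and> i mod e = j mod e) = (i = j)" by (metis div_mult_mod_eq)
  also have "(\<Sum>a<D. if a = i div e then (if i = j then 1 else 0) else 0) = (if i div e < D \<and> i = j then 1 else 0)"
    by (cases "i = j") auto
  also have "(i div e < D) = (i < D * e)" using e by (simp add: less_mult_imp_div_less div_less_iff_less_mult)
  finally show "entry (\<Sum>a<D. blk e a * projf e * (blk e a)\<^sup>\<dagger>) i j = entry (projf (D * e)) i j"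
    by (auto simp: projf.rep_eq)
qed

section \<open>Kronecker products as sums of blocks\<close>

lemma kron_carrier: "A \<in> carrier_mat a a \<Longrightarrow> B \<in> carrier_mat b b \<Longrightarrow> kron A B \<in> carrier_mat (a * b) (a * b)"
  by (auto simp: kron_def)

lemma conv_kron_ketbra:
  assumes e: "0 < e" and A: "A \<in> carrier_mat e e" and a: "a < D"
  shows "conv (kron (ketbra D a) A) = blk e a * conv A * (blk e a)\<^sup>\<dagger>"
proof (rule fmat_eqI)
  fix i j
  have lt: "k div e = a \<Longrightarrow> k < D * e" for k using a e by (metis div_less_iff_less_mult)
  show "entry (conv (kron (ketbra D a) A)) i j = entry (blk e a * conv A * (blk e a)\<^sup>\<dagger>) i j"
    unfolding entry_blk_conj[OF e] using A e lt
    by (auto simp: conv.rep_eq kron_def ketbra_def div_less_iff_less_mult)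
qed

lemma conv_kron_idm:
  assumes e: "0 < e" and A: "A \<in> carrier_mat e e"
  shows "conv (kron (idm D) A) = (\<Sum>a<D. blk e a * conv A * (blk e a)\<^sup>\<dagger>)"
proof (rule fmat_eqI)
  fix i j
  have "entry (\<Sum>a<D. blk e a * conv A * (blk e a)\<^sup>\<dagger>) i j
    = (\<Sum>a<D. if a = i div e then (if j div e = i div e then entry (conv A) (i mod e) (j mod e) else 0) else 0)"
    unfolding entry_sum entry_blk_conj[OF e] by (intro sum.cong) auto
  also have "\<dots> = entry (conv (kron (idm D) A)) i j"
  proof (cases "j div e = i div e")
    case True
    then have "i < D * e \<longleftrightarrow> j < D * e" by (metis div_less_iff_less_mult[OF e])
    then show ?thesis using A e True by (auto simp: conv.rep_eq kron_def idm_def div_less_iff_less_mult)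
  next
    case False
    then show ?thesis using A e by (auto simp: conv.rep_eq kron_def idm_def div_less_iff_less_mult)
  qed
  finally show "entry (conv (kron (idm D) A)) i j = entry (\<Sum>a<D. blk e a * conv A * (blk e a)\<^sup>\<dagger>) i j" by simp
qed

lemma ketbra_carrier: "ketbra d x \<in> carrier_mat d d" by (simp add: ketbra_def)
lemma idm_carrier: "idm d \<in> carrier_mat d d" by (simp add: idm_def)

section \<open>Block decomposition of classical-quantum states\<close>

lemma blk_projf: "0 < e \<Longrightarrow> blk e a * projf e = blk e a"
  by (rule fmat_eqI) (auto simp: entry_blk_mult projf.rep_eq blk.rep_eq)

lemma rtr_blk_conj:
  assumes "0 < e" "fbounded (entry A) e"
  shows "rtr (blk e a * A * (blk e a)\<^sup>\<dagger>) = rtr A"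
proof -
  have "rtr (blk e a * A * (blk e a)\<^sup>\<dagger>) = rtr ((blk e a)\<^sup>\<dagger> * blk e a * A)"
    using rtr_mult_commute[of "blk e a * A" "(blk e a)\<^sup>\<dagger>"] by (simp add: mult.assoc)
  then show ?thesis using assms by (simp add: blk_orthonormal projf_mult)
qed

text \<open>The blocks have orthogonal ranges, so the squared norm is a sum over blocks; after each
  \<open>U x\<close> is dropped, completeness of the blocks reassembles at most the norm of
  \<open>A\<close>.\<close>

lemma contr_block_diag:
  assumes e: "0 < e" and U: "\<And>x. contr (U x)"
  shows "contr (\<Sum>x<D. blk e x * U x * (blk e x)\<^sup>\<dagger>)"
  unfolding contr_def
proof
  fix A
  define v where "v = (\<lambda>x. U x * ((blk e x)\<^sup>\<dagger> * A))"
  have eq: "(\<Sum>x<D. blk e x * U x * (blk e x)\<^sup>\<dagger>) * A = (\<Sum>x<D. blk e x * v x)"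
    by (simp add: v_def sum_distrib_right mult.assoc)
  have "inner (blk e x * v x) (blk e y * v y) = (if x = y then inner (v x) (projf e * v x) else 0)" for x y
  proof -
    have "inner (blk e x * v x) (blk e y * v y) = inner (v x) (((blk e x)\<^sup>\<dagger> * blk e y) * v y)"
      by (simp add: inner_mult_left mult.assoc)
    then show ?thesis by (simp add: blk_orthonormal[OF e])
  qed
  then have "inner (\<Sum>x<D. blk e x * v x) (\<Sum>x<D. blk e x * v x) = (\<Sum>x<D. inner (v x) (projf e * v x))"
    by (simp add: inner_sum_left inner_sum_right)
  also have "\<dots> \<le> (\<Sum>x<D. inner ((blk e x)\<^sup>\<dagger> * A) ((blk e x)\<^sup>\<dagger> * A))"
  proof (rule sum_mono)
    fix x
    have "inner (v x) (projf e * v x) \<le> norm (v x) * norm (projf e * v x)" by (rule norm_cauchy_schwarz)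
    also have "\<dots> \<le> norm (v x) * norm (v x)"
      by (intro mult_left_mono contr_norm_left herm_proj_contr) (auto simp: projf_idem)
    also have "\<dots> \<le> norm ((blk e x)\<^sup>\<dagger> * A) * norm ((blk e x)\<^sup>\<dagger> * A)"
      unfolding v_def by (intro mult_mono contr_norm_left U) auto
    finally show "inner (v x) (projf e * v x) \<le> inner ((blk e x)\<^sup>\<dagger> * A) ((blk e x)\<^sup>\<dagger> * A)"
      by (simp add: power2_norm_eq_inner[symmetric] power2_eq_square)
  qed
  also have "\<dots> = inner A ((\<Sum>x<D. blk e x * projf e * (blk e x)\<^sup>\<dagger>) * A)"
    by (simp add: inner_mult_left[of "(blk _ _)\<^sup>\<dagger>"] inner_sum_right sum_distrib_right blk_projf[OF e] mult.assoc)
  also have "\<dots> = inner A (projf (D * e) * A)" by (simp add: blk_complete[OF e])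
  also have "\<dots> \<le> norm A * norm (projf (D * e) * A)" by (rule norm_cauchy_schwarz)
  also have "\<dots> \<le> norm A * norm A"
    by (intro mult_left_mono contr_norm_left herm_proj_contr) (auto simp: projf_idem)
  finally have "(norm ((\<Sum>x<D. blk e x * U x * (blk e x)\<^sup>\<dagger>) * A))\<^sup>2 \<le> (norm A)\<^sup>2"
    by (simp add: eq power2_norm_eq_inner[symmetric] power2_eq_square)
  then show "norm ((\<Sum>x<D. blk e x * U x * (blk e x)\<^sup>\<dagger>) * A) \<le> norm A"
    by (rule power2_le_imp_le) simp
qed

text \<open>A block diagonal test matrix sees only the diagonal blocks of \<open>X\<close>; this is
  how an arbitrary smoothed state is reduced to its blocks.\<close>

lemma rtr_block_diag:
  "rtr ((\<Sum>x<D. blk e x * U x * (blk e x)\<^sup>\<dagger>) * X) = (\<Sum>x<D. rtr (U x * ((blk e x)\<^sup>\<dagger> * X * blk e x)))"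
proof -
  have "rtr (blk e x * U x * (blk e x)\<^sup>\<dagger> * X) = rtr (U x * ((blk e x)\<^sup>\<dagger> * X * blk e x))" for x
    using rtr_mult_commute[of "blk e x" "U x * (blk e x)\<^sup>\<dagger> * X"] by (simp add: mult.assoc)
  then show ?thesis by (simp add: sum_distrib_right rtr_sum)
qed

text \<open>The sum of the diagonal blocks is the partial trace over the first register.\<close>

lemma rtr_sum_blk_compress:
  assumes e: "0 < e" and X: "fbounded (entry X) (D * e)"
  shows "rtr (\<Sum>x<D. (blk e x)\<^sup>\<dagger> * X * blk e x) = rtr X"
proof -
  have "rtr ((blk e x)\<^sup>\<dagger> * X * blk e x) = rtr (blk e x * projf e * (blk e x)\<^sup>\<dagger> * X)" for x
    using rtr_mult_commute[of "(blk e x)\<^sup>\<dagger> * X" "blk e x"] by (simp add: blk_projf[OF e] mult.assoc)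
  then have "rtr (\<Sum>x<D. (blk e x)\<^sup>\<dagger> * X * blk e x) = rtr ((\<Sum>x<D. blk e x * projf e * (blk e x)\<^sup>\<dagger>) * X)"
    by (simp add: rtr_sum sum_distrib_right)
  then show ?thesis by (simp add: blk_complete[OF e] projf_mult[OF X])
qed

lemma blk_compress_sum:
  assumes e: "0 < e" and A: "\<And>x. x < D \<Longrightarrow> fbounded (entry (A x)) e" and x: "x < D"
  shows "(blk e x)\<^sup>\<dagger> * (\<Sum>y<D. blk e y * A y * (blk e y)\<^sup>\<dagger>) * blk e x = A x"
proof -
  have "(blk e x)\<^sup>\<dagger> * (blk e y * A y * (blk e y)\<^sup>\<dagger>) * blk e x
    = ((blk e x)\<^sup>\<dagger> * blk e y) * A y * ((blk e y)\<^sup>\<dagger> * blk e x)" for y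
    by (simp add: mult.assoc)
  then have "(blk e x)\<^sup>\<dagger> * (\<Sum>y<D. blk e y * A y * (blk e y)\<^sup>\<dagger>) * blk e x
    = (\<Sum>y<D. if y = x then A y else 0)"
    unfolding sum_distrib_left sum_distrib_right using A
    by (intro sum.cong refl) (auto simp: blk_orthonormal[OF e] projf_mult mult_projf)
  then show ?thesis using x by simp
qed

lemma kron_smult_left:
  assumes "A \<in> carrier_mat a a" "B \<in> carrier_mat b b"
  shows "kron (c \<cdot>\<^sub>m A) B = c \<cdot>\<^sub>m kron A B"
  using assms by (intro eq_matI) (auto simp: kron_def less_mult_imp_div_less)

text \<open>In dimension 0 all traces are empty sums and cannot add up to 1.\<close>

lemma cq_dim_pos: "cq_data n dE \<rho>E \<Longrightarrow> 0 < dE"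
proof (rule ccontr)
  assume cq: "cq_data n dE \<rho>E" and "\<not> 0 < dE"
  then have "mtr (\<rho>E x) = 0" if "x < 2^n" for x
    using that by (auto simp: cq_data_def psd_def mtr_def)
  then show False using cq by (simp add: cq_data_def)
qed

lemma cq_rtr_sum: "cq_data n dE \<rho>E \<Longrightarrow> (\<Sum>x<2^n. rtr (conv (\<rho>E x))) = 1"
proof -
  assume cq: "cq_data n dE \<rho>E"
  have "(\<Sum>x<2^n. rtr (conv (\<rho>E x))) = (\<Sum>x<2^n. Re (mtr (\<rho>E x)))"
    using cq by (intro sum.cong refl rtr_conv[of _ dE]) (auto simp: cq_data_def psd_carrier)
  also have "\<dots> = Re (\<Sum>x<2^n. mtr (\<rho>E x))" by simp
  also have "\<dots> = 1" using cq by (simp only: cq_data_def one_complex.sel)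
  finally show ?thesis .
qed

lemma conv_rho_XE:
  assumes cq: "cq_data n dE \<rho>E"
  shows "conv (rho_XE n dE \<rho>E) = (\<Sum>x<2^n. blk dE x * conv (\<rho>E x) * (blk dE x)\<^sup>\<dagger>)"
proof -
  have c: "\<rho>E x \<in> carrier_mat dE dE" if "x < 2^n" for x
    using cq that by (auto simp: cq_data_def psd_carrier)
  have "conv (rho_XE n dE \<rho>E) = (\<Sum>x<2^n. conv (kron (ketbra (2^n) x) (\<rho>E x)))"
    unfolding rho_XE_def by (intro conv_msum kron_carrier ketbra_carrier) (use c in auto)
  also have "\<dots> = (\<Sum>x<2^n. blk dE x * conv (\<rho>E x) * (blk dE x)\<^sup>\<dagger>)"
    by (intro sum.cong refl conv_kron_ketbra cq_dim_pos[OF cq]) (use c in auto)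
  finally show ?thesis .
qed

lemma rho_XE_props:
  assumes cq: "cq_data n dE \<rho>E"
  shows "psd (2^n * dE) (rho_XE n dE \<rho>E)" "rtr (conv (rho_XE n dE \<rho>E)) = 1"
proof -
  have p: "psd dE (\<rho>E x)" if "x < 2^n" for x
    using cq that by (auto simp: cq_data_def)
  have "pos (conv (rho_XE n dE \<rho>E))"
    unfolding conv_rho_XE[OF cq] using psd_pos[OF p] by (intro pos_sum pos_conj') auto
  moreover have "rho_XE n dE \<rho>E \<in> carrier_mat (2^n * dE) (2^n * dE)"
    unfolding rho_XE_def by (rule msum_carrier)
  ultimately show "psd (2^n * dE) (rho_XE n dE \<rho>E)" by (simp add: psd_iff_pos)
  have "rtr (conv (rho_XE n dE \<rho>E)) = (\<Sum>x<2^n. rtr (conv (\<rho>E x)))"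
    unfolding conv_rho_XE[OF cq] rtr_sum
    by (intro sum.cong refl rtr_blk_conj cq_dim_pos[OF cq] fbounded_conv psd_carrier p) auto
  then show "rtr (conv (rho_XE n dE \<rho>E)) = 1" using cq_rtr_sum[OF cq] by simp
qed

text \<open>A small purified distance means a fidelity of squared size at least
  \<open>1 - e\<^sup>2\<close>. This fidelity is a trace against the polar contraction, as
  \<open>fidelity_trace_bound\<close> requires.\<close>

lemma pdist_trace_bound:
  assumes \<rho>: "psd d \<rho>" "rtr (conv \<rho>) = 1" and \<rho>': "substate d \<rho>'"
    and dist: "pdist d \<rho> \<rho>' \<le> e" and e: "0 \<le> e"
  shows "contr U \<Longrightarrow> rtr (U * (conv \<rho> - conv \<rho>')) \<le> 2 * e + e\<^sup>2"
    and "1 - e\<^sup>2 \<le> rtr (conv \<rho>')"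
proof -
  have psd': "psd d \<rho>'" and tr': "rtr (conv \<rho>') \<le> 1"
    using \<rho>' rtr_conv[OF psd_carrier] by (auto simp: substate_def)
  note s = msqrt_props[OF \<rho>(1)] and s' = msqrt_props[OF psd']
  define A where "A = conv (msqrt d \<rho>)"
  define B where "B = conv (msqrt d \<rho>')"
  have c: "msqrt d \<rho> \<in> carrier_mat d d" "msqrt d \<rho>' \<in> carrier_mat d d"
    using s s' psd_carrier by auto
  have A: "A\<^sup>\<dagger> = A" "A * A = conv \<rho>" and B: "B\<^sup>\<dagger> = B" "B * B = conv \<rho>'"
    unfolding A_def B_def using s s' c
    by (auto simp: conv_mult[of _ d, symmetric] intro: pos_adjf psd_pos)
  have nA: "(norm A)\<^sup>2 = 1" and nB: "(norm B)\<^sup>2 = rtr (conv \<rho>')"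
    using rtr_square[OF A(1)] rtr_square[OF B(1)] A B \<rho>(2) by auto
  have nA1: "norm A = 1" using nA by (simp add: power2_eq_1_iff) (smt (verit) norm_ge_zero)
  have nB1: "norm B \<le> 1" using nB tr' by (metis abs_norm_cancel abs_square_le_1)
  obtain C where C: "contr C" "tnorm d (msqrt d \<rho> * msqrt d \<rho>') = rtr (C * (A * B))"
    using tnorm_dual[of "msqrt d \<rho> * msqrt d \<rho>'" d] c by (auto simp: conv_mult[OF c] A_def B_def)
  \<comment> \<open>The second summand of \<open>gen_fid\<close> vanishes because \<rho> has trace
    1.\<close>
  have F: "gen_fid d \<rho> \<rho>' = rtr (C * (A * B))"
    using \<rho> by (simp add: gen_fid_def C(2) rtr_conv[OF psd_carrier])
  have "sqrt (1 - (gen_fid d \<rho> \<rho>')\<^sup>2) \<le> sqrt (e\<^sup>2)" using dist e by (simp add: pdist_def)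
  \<comment> \<open>\<open>sqrt\<close> is strictly increasing on the whole real line, so the
    arguments compare whatever the sign of the left one.\<close>
  then have F2: "1 - e\<^sup>2 \<le> (rtr (C * (A * B)))\<^sup>2" unfolding F real_sqrt_le_iff by simp
  show "rtr (U * (conv \<rho> - conv \<rho>')) \<le> 2 * e + e\<^sup>2" if "contr U"
    using fidelity_trace_bound[OF A(1) B(1) C(1) that _ nB1 e F2] nA1 A B by simp
  \<comment> \<open>The fidelity is at most \<open>norm A * norm B = norm B\<close>, so its square
    bounds the trace of \<rho>' from below.\<close>
  have "rtr (C * (A * B)) \<le> norm (C * A) * norm B"
    unfolding mult.assoc[symmetric] by (rule rtr_mult_le_norm)
  also have "\<dots> \<le> norm B"
    using contr_norm_left[OF C(1), of A] nA1 by (intro mult_left_le_one_le) auto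
  finally have "(rtr (C * (A * B)))\<^sup>2 \<le> (norm B)\<^sup>2"
    using tnorm_nonneg[of "msqrt d \<rho> * msqrt d \<rho>'" d] c C(2) by (intro power_mono) auto
  then show "1 - e\<^sup>2 \<le> rtr (conv \<rho>')" using F2 nB by simp
qed

text \<open>The infimum is bounded at one candidate, a uniform seed tensored with \<tau>. The
  difference is then block diagonal in \<open>(z, k)\<close>, so only the diagonal blocks of the
  contraction attaining the trace norm matter.\<close>

lemma d_u_dual:
  fixes \<rho>E :: "nat \<Rightarrow> complex mat"
  assumes cq: "cq_data n dE \<rho>E" and range: "\<And>k x. k < 2^S \<Longrightarrow> x < 2^n \<Longrightarrow> Fam k x < 2^l"
    and \<tau>: "psd dE \<tau>" "rtr (conv \<tau>) = 1"
  shows "\<exists>U. (\<forall>k z. contr (U k z)) \<and>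
    2 * d_u (2^l) (2^S * dE) (rho_ZFE n l S dE Fam \<rho>E) \<le>
      (1 / 2^S) * (\<Sum>k<2^S. \<Sum>z<2^l. rtr (U k z *
        ((\<Sum>x\<in>{x\<in>{..<2^n}. Fam k x = z}. conv (\<rho>E x)) - (1 / 2^l) *\<^sub>R conv \<tau>)))"
proof -
  note e = cq_dim_pos[OF cq]
  let ?F = "2^S * dE" let ?\<rho> = "rho_ZFE n l S dE Fam \<rho>E"
  have F: "0 < ?F" using e by simp
  have p: "psd dE (\<rho>E x)" if "x < 2^n" for x using cq that by (auto simp: cq_data_def)
  define r where "r = (\<lambda>k z. \<Sum>x\<in>{x\<in>{..<2^n}. Fam k x = z}. conv (\<rho>E x))"
  have fz: "conv (rho_E_fz n dE \<rho>E (Fam k) z) = r k z" for k z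
    unfolding rho_E_fz_def r_def by (subst conv_msum) (use p psd_carrier in auto)
  have rpos: "pos (r k z)" for k z unfolding r_def using psd_pos[OF p] by (intro pos_sum) auto
  have fzc: "rho_E_fz n dE \<rho>E f z \<in> carrier_mat dE dE" for f z
    unfolding rho_E_fz_def by (rule msum_carrier)
  have rb: "fbounded (entry (r k z)) dE" for k z
    using fbounded_conv[OF fzc, of "Fam k" z] by (simp add: fz)
  \<comment> \<open>Embeds the space of \<open>E\<close> as the block of hash value \<open>z\<close>
    and seed \<open>k\<close>.\<close>
  define T where "T = (\<lambda>z k. blk ?F z * blk dE k)"
  have Tc: "contr (T z k)" for z k
    unfolding contr_def T_def mult.assoc
    using contr_norm_left[OF contr_blk[OF F]] contr_norm_left[OF contr_blk[OF e]] order_trans by blast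
  have sc: "(1 / 2^S :: complex) = of_real (1 / 2^S)" "(1 / of_nat (2^l) :: complex) = of_real (1 / 2^l)"
    by simp_all
  have kc: "kron (ketbra (2^S) k) A \<in> carrier_mat ?F ?F" if "A \<in> carrier_mat dE dE" for k A
    by (intro kron_carrier ketbra_carrier that)
  have conv_zk: "conv (kron (ketbra (2^l) z) (kron (ketbra (2^S) k) A)) = T z k * conv A * (T z k)\<^sup>\<dagger>"
    if "A \<in> carrier_mat dE dE" "z < 2^l" "k < 2^S" for A z k
    using that by (simp add: conv_kron_ketbra[OF F kc] conv_kron_ketbra[OF e] T_def adjf_mult mult.assoc)
  have conv\<rho>: "conv ?\<rho> = (\<Sum>(z,k)\<in>{..<2^l} \<times> {..<2^S}. (1 / 2^S) *\<^sub>R (T z k * r k z * (T z k)\<^sup>\<dagger>))"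
  proof -
    have "conv ?\<rho> = (\<Sum>zk\<in>{..<2^l} \<times> {..<2^S}. conv (case zk of (z,k) \<Rightarrow>
      (1 / 2^S) \<cdot>\<^sub>m kron (ketbra (2^l) z) (kron (ketbra (2^S) k) (rho_E_fz n dE \<rho>E (Fam k) z))))"
      unfolding rho_ZFE_def
      by (rule conv_msum) (auto intro!: smult_carrier_mat kron_carrier ketbra_carrier fzc)
    also have "\<dots> = (\<Sum>(z,k)\<in>{..<2^l} \<times> {..<2^S}. (1 / 2^S) *\<^sub>R (T z k * r k z * (T z k)\<^sup>\<dagger>))"
      unfolding sc by (intro sum.cong refl) (auto simp only: split: prod.splits
          simp: conv_smult conv_zk[OF fzc] fz)
    finally show ?thesis .
  qed
  have rtrT: "rtr (T z k * A * (T z k)\<^sup>\<dagger>) = rtr A" if A: "fbounded (entry A) dE" and k: "k < 2^S" for z k A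
  proof -
    have "conv (kron (ketbra (2^S) k) (mat_of_fmat dE A)) = blk dE k * A * (blk dE k)\<^sup>\<dagger>"
      by (simp add: conv_kron_ketbra[OF e _ k] conv_mat_of_fmat[OF A])
    then have "fbounded (entry (blk dE k * A * (blk dE k)\<^sup>\<dagger>)) ?F"
      using fbounded_conv[OF kc[OF mat_of_fmat_carrier]] by metis
    then have "rtr (blk ?F z * (blk dE k * A * (blk dE k)\<^sup>\<dagger>) * (blk ?F z)\<^sup>\<dagger>) = rtr A"
      by (simp add: rtr_blk_conj[OF F] rtr_blk_conj[OF e A])
    then show ?thesis by (simp add: T_def adjf_mult mult.assoc)
  qed
  have rsum: "(\<Sum>z<2^l. rtr (r k z)) = 1" if "k < 2^S" for k
  proof -
    have "(\<Sum>z<2^l. rtr (r k z)) = (\<Sum>z<2^l. \<Sum>x\<in>{x\<in>{..<2^n}. Fam k x = z}. rtr (conv (\<rho>E x)))"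
      by (simp add: r_def rtr_sum)
    also have "\<dots> = (\<Sum>x<2^n. rtr (conv (\<rho>E x)))"
      by (rule sum.group) (use range that in auto)
    finally show ?thesis using cq_rtr_sum[OF cq] by simp
  qed
  have rho_c: "?\<rho> \<in> carrier_mat (2^l * ?F) (2^l * ?F)" unfolding rho_ZFE_def by (rule msum_carrier)
  have "pos (conv ?\<rho>)"
    unfolding conv\<rho> by (intro pos_sum) (auto intro!: pos_scaleR pos_conj' rpos)
  then have rho_psd: "psd (2^l * ?F) ?\<rho>" by (simp add: psd_iff_pos[OF rho_c])
  have "rtr (conv ?\<rho>) = (\<Sum>z<2^l. \<Sum>k<2^S. (1 / 2^S) * rtr (r k z))"
    unfolding conv\<rho> rtr_sum sum.cartesian_product
    by (intro sum.cong refl) (auto simp: rtr_scaleR rtrT[OF rb])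
  also have "\<dots> = (\<Sum>k<2^S. (1 / 2^S) * (\<Sum>z<2^l. rtr (r k z)))"
    by (subst sum.swap) (simp add: sum_distrib_left)
  also have "\<dots> = 1" by (simp add: rsum)
  finally have rho_tr: "mtr ?\<rho> = 1" using psd_mtr[OF rho_psd] by simp
  define \<sigma> where "\<sigma> = msum ?F (\<lambda>k. of_real (1 / 2^S) \<cdot>\<^sub>m kron (ketbra (2^S) k) \<tau>) {..<2^S}"
  note \<tau>c = psd_carrier[OF \<tau>(1)]
  have \<sigma>c: "\<sigma> \<in> carrier_mat ?F ?F" unfolding \<sigma>_def by (rule msum_carrier)
  have "conv \<sigma> = (\<Sum>k<2^S. conv (of_real (1 / 2^S) \<cdot>\<^sub>m kron (ketbra (2^S) k) \<tau>))"
    unfolding \<sigma>_def by (intro conv_msum smult_carrier_mat kc \<tau>c)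
  also have "\<dots> = (\<Sum>k<2^S. (1 / 2^S) *\<^sub>R (blk dE k * conv \<tau> * (blk dE k)\<^sup>\<dagger>))"
    by (intro sum.cong refl) (simp only: conv_smult conv_kron_ketbra[OF e \<tau>c] lessThan_iff)
  finally have conv\<sigma>: "conv \<sigma> = (\<Sum>k<2^S. (1 / 2^S) *\<^sub>R (blk dE k * conv \<tau> * (blk dE k)\<^sup>\<dagger>))" .
  have "pos (conv \<sigma>)" unfolding conv\<sigma> by (intro pos_sum pos_scaleR pos_conj' psd_pos[OF \<tau>(1)]) auto
  then have \<sigma>psd: "psd ?F \<sigma>" by (simp add: psd_iff_pos[OF \<sigma>c])
  have "rtr (conv \<sigma>) = 1"
    unfolding conv\<sigma> by (simp add: rtr_sum rtr_scaleR rtr_blk_conj[OF e fbounded_conv[OF \<tau>c]] \<tau>(2))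
  then have \<sigma>tr: "mtr \<sigma> = mtr ?\<rho>" using psd_mtr[OF \<sigma>psd] rho_tr by simp
  let ?W = "\<lambda>\<sigma>. kron ((1 / of_nat (2^l)) \<cdot>\<^sub>m idm (2^l)) \<sigma>"
  have Wc: "?W s \<in> carrier_mat (2^l * ?F) (2^l * ?F)" if "s \<in> carrier_mat ?F ?F" for s
    by (intro kron_carrier smult_carrier_mat idm_carrier that)
  have convW: "conv (?W \<sigma>) = (\<Sum>(z,k)\<in>{..<2^l} \<times> {..<2^S}. (1 / 2^S) *\<^sub>R (T z k * ((1 / 2^l) *\<^sub>R conv \<tau>) * (T z k)\<^sup>\<dagger>))"
  proof -
    have "conv (?W \<sigma>) = (1 / 2^l) *\<^sub>R (\<Sum>z<2^l. blk ?F z * conv \<sigma> * (blk ?F z)\<^sup>\<dagger>)"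
      unfolding sc by (simp only: kron_smult_left[OF idm_carrier \<sigma>c] conv_smult conv_kron_idm[OF F \<sigma>c])
    also have "\<dots> = (\<Sum>z<2^l. \<Sum>k<2^S. (1 / 2^S) *\<^sub>R (T z k * ((1 / 2^l) *\<^sub>R conv \<tau>) * (T z k)\<^sup>\<dagger>))"
      unfolding conv\<sigma> T_def
      by (simp add: sum_distrib_left sum_distrib_right scaleR_sum_right adjf_mult mult.assoc mult.commute)
    finally show ?thesis by (simp add: sum.cartesian_product)
  qed
  let ?X = "?\<rho> - ?W \<sigma>"
  have Xc: "?X \<in> carrier_mat (2^l * ?F) (2^l * ?F)" by (rule minus_carrier_mat[OF Wc[OF \<sigma>c]])
  obtain C where C: "contr C" "tnorm (2^l * ?F) ?X = rtr (C * conv ?X)"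
    using tnorm_dual[OF Xc] by blast
  \<comment> \<open>Compression of the single contraction \<open>C\<close> to each block.\<close>
  define U where "U = (\<lambda>k z. (T z k)\<^sup>\<dagger> * C * T z k)"
  have Uc: "contr (U k z)" for k z unfolding U_def by (rule contr_compress[OF C(1) Tc])
  have "d_u (2^l) ?F ?\<rho> \<le> tnorm (2^l * ?F) ?X / 2"
    unfolding d_u_def
  proof (rule cInf_lower)
    show "tnorm (2^l * ?F) ?X / 2 \<in> {tnorm (2^l * ?F) (?\<rho> - ?W \<sigma>) / 2 |\<sigma>. psd ?F \<sigma> \<and> mtr \<sigma> = mtr ?\<rho>}"
      using \<sigma>psd \<sigma>tr by blast
    show "bdd_below {tnorm (2^l * ?F) (?\<rho> - ?W \<sigma>) / 2 |\<sigma>. psd ?F \<sigma> \<and> mtr \<sigma> = mtr ?\<rho>}"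
    proof (rule bdd_belowI[of _ 0])
      fix x assume "x \<in> {tnorm (2^l * ?F) (?\<rho> - ?W \<sigma>) / 2 |\<sigma>. psd ?F \<sigma> \<and> mtr \<sigma> = mtr ?\<rho>}"
      then obtain s where "psd ?F s" and x: "x = tnorm (2^l * ?F) (?\<rho> - ?W s) / 2" by blast
      then show "0 \<le> x"
        using tnorm_nonneg[OF minus_carrier_mat[OF Wc[OF psd_carrier]]] unfolding x
        by (intro divide_nonneg_nonneg) (blast, simp)
    qed
  qed
  also have "tnorm (2^l * ?F) ?X = (\<Sum>(z,k)\<in>{..<2^l} \<times> {..<2^S}. (1 / 2^S) * rtr (U k z * (r k z - (1 / 2^l) *\<^sub>R conv \<tau>)))"
  proof -
    have "C * conv ?X = (\<Sum>(z,k)\<in>{..<2^l} \<times> {..<2^S}. (1 / 2^S) *\<^sub>R (C * T z k * (r k z - (1 / 2^l) *\<^sub>R conv \<tau>) * (T z k)\<^sup>\<dagger>))"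
      unfolding conv_minus[OF rho_c Wc[OF \<sigma>c]] conv\<rho> convW sum_subtractf[symmetric] sum_distrib_left
      by (intro sum.cong refl) (auto simp: algebra_simps)
    moreover have "rtr (C * T z k * M * (T z k)\<^sup>\<dagger>) = rtr (U k z * M)" for z k M
      using rtr_mult_commute[of "C * T z k * M" "(T z k)\<^sup>\<dagger>"] by (simp add: U_def mult.assoc)
    ultimately show ?thesis
      unfolding C(2) by (simp add: rtr_sum rtr_scaleR case_prod_beta)
  qed
  also have "\<dots> = (\<Sum>k<2^S. \<Sum>z<2^l. (1 / 2^S) * rtr (U k z * (r k z - (1 / 2^l) *\<^sub>R conv \<tau>)))"
    by (subst sum.swap) (simp add: sum.cartesian_product)
  also have "\<dots> = (1 / 2^S) * (\<Sum>k<2^S. \<Sum>z<2^l. rtr (U k z * (r k z - (1 / 2^l) *\<^sub>R conv \<tau>)))"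
    by (simp only: sum_distrib_left)
  finally have "2 * d_u (2^l) ?F ?\<rho> \<le> (1 / 2^S) * (\<Sum>k<2^S. \<Sum>z<2^l. rtr (U k z * (r k z - (1 / 2^l) *\<^sub>R conv \<tau>)))"
    by simp
  then show ?thesis unfolding r_def using Uc by (intro exI[of _ U]) auto
qed

section \<open>Leftover hashing with smoothing\<close>

text \<open>With the marginal on \<open>E\<close> as candidate, each seed contributes the traces of
  two normalised states, hence at most 2 before halving. This serves the parameters for which the
  claimed bound is at least 1.\<close>

lemma d_u_le_one:
  fixes \<rho>E :: "nat \<Rightarrow> complex mat"
  assumes cq: "cq_data n dE \<rho>E" and range: "\<And>k x. k < 2^S \<Longrightarrow> x < 2^n \<Longrightarrow> Fam k x < 2^l"
  shows "d_u (2^l) (2^S * dE) (rho_ZFE n l S dE Fam \<rho>E) \<le> 1"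
proof -
  have p: "psd dE (\<rho>E x)" if "x < 2^n" for x using cq that by (auto simp: cq_data_def)
  define R where "R = (\<Sum>x<2^n. conv (\<rho>E x))"
  define \<tau> where "\<tau> = msum dE \<rho>E {..<2^n}"
  have conv\<tau>: "conv \<tau> = R" unfolding \<tau>_def R_def by (rule conv_msum) (use p psd_carrier in auto)
  have R: "pos R" "rtr R = 1"
    unfolding R_def using psd_pos[OF p] cq_rtr_sum[OF cq] by (auto simp: rtr_sum intro!: pos_sum)
  have "\<tau> \<in> carrier_mat dE dE" unfolding \<tau>_def by (rule msum_carrier)
  then have \<tau>: "psd dE \<tau>" "rtr (conv \<tau>) = 1" using R by (auto simp: psd_iff_pos conv\<tau>)
  define r where "r = (\<lambda>k z. \<Sum>x\<in>{x\<in>{..<2^n}. Fam k x = z}. conv (\<rho>E x))"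
  have rpos: "pos (r k z)" for k z unfolding r_def using psd_pos[OF p] by (intro pos_sum) auto
  obtain U where U: "\<And>k z. contr (U k z)" and du: "2 * d_u (2^l) (2^S * dE) (rho_ZFE n l S dE Fam \<rho>E) \<le>
      (1 / 2^S) * (\<Sum>k<2^S. \<Sum>z<2^l. rtr (U k z * (r k z - (1 / 2^l) *\<^sub>R R)))"
    using d_u_dual[where Fam = Fam and S = S and l = l, OF cq range \<tau>] unfolding conv\<tau> r_def by blast
  have "(\<Sum>z<2^l. rtr (U k z * (r k z - (1 / 2^l) *\<^sub>R R))) \<le> 2" if k: "k < 2^S" for k
  proof -
    have "rtr (U k z * (r k z - (1 / 2^l) *\<^sub>R R)) \<le> rtr (r k z) + 1 / 2^l" for z
    proof -
      have "U k z * (r k z - (1 / 2^l) *\<^sub>R R) = U k z * r k z + (1 / 2^l) *\<^sub>R (- U k z * R)"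
        by (simp add: algebra_simps)
      moreover have "(1 / 2^l) * rtr (- U k z * R) \<le> (1 / 2^l) * rtr R"
        by (intro mult_left_mono rtr_contr_pos_le contr_uminus U R) auto
      moreover have "rtr (U k z * r k z) \<le> rtr (r k z)" by (rule rtr_contr_pos_le[OF U rpos])
      ultimately show ?thesis using R(2) by (simp add: rtr_minus rtr_uminus rtr_scaleR)
    qed
    then have "(\<Sum>z<2^l. rtr (U k z * (r k z - (1 / 2^l) *\<^sub>R R))) \<le> (\<Sum>z<2^l. rtr (r k z) + 1 / 2^l)"
      by (intro sum_mono)
    also have "\<dots> = (\<Sum>z<2^l. \<Sum>x\<in>{x\<in>{..<2^n}. Fam k x = z}. rtr (conv (\<rho>E x))) + 1"
      by (simp add: sum.distrib r_def rtr_sum)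
    also have "(\<Sum>z<2^l. \<Sum>x\<in>{x\<in>{..<2^n}. Fam k x = z}. rtr (conv (\<rho>E x))) = (\<Sum>x<2^n. rtr (conv (\<rho>E x)))"
      by (rule sum.group) (use range k in auto)
    also have "\<dots> = 1" by (rule cq_rtr_sum[OF cq])
    finally show ?thesis by simp
  qed
  then have "(\<Sum>k<2^S. \<Sum>z<2^l. rtr (U k z * (r k z - (1 / 2^l) *\<^sub>R R))) \<le> (\<Sum>k<(2^S::nat). 2)"
    by (intro sum_mono) auto
  then have "(1 / 2^S) * (\<Sum>k<2^S. \<Sum>z<2^l. rtr (U k z * (r k z - (1 / 2^l) *\<^sub>R R))) \<le> (1 / 2^S) * (2^S * 2)"
    by (intro mult_left_mono) auto
  then show ?thesis using du by simp
qed

text \<open>Compression to block \<open>x\<close> preserves positivity and turns the identity tensor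
  \<sigma> into \<sigma>.\<close>

lemma loewner_compress:
  assumes e: "0 < e" and \<sigma>: "psd e \<sigma>" and le: "loewner_le (D * e) \<rho> (of_real c \<cdot>\<^sub>m kron (idm D) \<sigma>)"
    and x: "x < D"
  shows "pos (c *\<^sub>R conv \<sigma> - (blk e x)\<^sup>\<dagger> * conv \<rho> * blk e x)"
proof -
  note \<sigma>c = psd_carrier[OF \<sigma>]
  have kc: "of_real c \<cdot>\<^sub>m kron (idm D) \<sigma> \<in> carrier_mat (D * e) (D * e)"
    by (intro smult_carrier_mat kron_carrier idm_carrier \<sigma>c)
  have "pos (conv (of_real c \<cdot>\<^sub>m kron (idm D) \<sigma> - \<rho>))"
    using le psd_pos by (auto simp: loewner_le_def)
  also have "conv (of_real c \<cdot>\<^sub>m kron (idm D) \<sigma> - \<rho>)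
    = c *\<^sub>R (\<Sum>a<D. blk e a * conv \<sigma> * (blk e a)\<^sup>\<dagger>) - conv \<rho>"
    using le conv_minus[OF kc, of \<rho>] by (simp add: loewner_le_def conv_smult conv_kron_idm[OF e \<sigma>c])
  finally have "pos ((blk e x)\<^sup>\<dagger> * (c *\<^sub>R (\<Sum>a<D. blk e a * conv \<sigma> * (blk e a)\<^sup>\<dagger>) - conv \<rho>) * blk e x)"
    by (rule pos_conj)
  also have "(blk e x)\<^sup>\<dagger> * (c *\<^sub>R (\<Sum>a<D. blk e a * conv \<sigma> * (blk e a)\<^sup>\<dagger>) - conv \<rho>) * blk e x
    = c *\<^sub>R ((blk e x)\<^sup>\<dagger> * (\<Sum>a<D. blk e a * conv \<sigma> * (blk e a)\<^sup>\<dagger>) * blk e x) - (blk e x)\<^sup>\<dagger> * conv \<rho> * blk e x"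
    by (simp add: right_diff_distrib left_diff_distrib)
  also have "(blk e x)\<^sup>\<dagger> * (\<Sum>a<D. blk e a * conv \<sigma> * (blk e a)\<^sup>\<dagger>) * blk e x = conv \<sigma>"
    by (rule blk_compress_sum[OF e fbounded_conv[OF \<sigma>c] x])
  finally show ?thesis .
qed

text \<open>Per seed there are three contributions to twice the distance: smoothing
  (\<open>2 * eps + eps\<^sup>2\<close>), hashing of the blocks \<open>P x\<close>, and
  renormalisation of their sum \<open>R\<close> (\<open>eps\<^sup>2\<close>).\<close>

lemma leftover_hash_smooth:
  fixes \<rho>E :: "nat \<Rightarrow> complex mat" and eps lam :: real
  assumes cq: "cq_data n dE \<rho>E" and range: "\<And>k x. k < 2^S \<Longrightarrow> x < 2^n \<Longrightarrow> Fam k x < 2^l"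
    and coll: "\<And>x x'. x < 2^n \<Longrightarrow> x' < 2^n \<Longrightarrow> x \<noteq> x' \<Longrightarrow>
      real (card {k \<in> {..<2^S}. Fam k x = Fam k x'}) \<le> \<delta> * 2^S"
    and \<delta>: "1 \<le> \<delta> * 2^l" "\<delta> * 2^l - 1 \<le> 4 * eps\<^sup>2" and eps: "0 < eps" "eps < 1/3"
    and \<rho>': "substate (2^n * dE) \<rho>'" "pdist (2^n * dE) (rho_XE n dE \<rho>E) \<rho>' \<le> eps"
    and \<sigma>: "psd dE \<sigma>" "mtr \<sigma> = 1"
    and le: "loewner_le (2^n * dE) \<rho>' (of_real (2 powr (- lam)) \<cdot>\<^sub>m kron (idm (2^n)) \<sigma>)"
  shows "d_u (2^l) (2^S * dE) (rho_ZFE n l S dE Fam \<rho>E)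
    \<le> 3 * eps + 1/2 * sqrt (2^l * 2 powr (- lam) * (2 / eps\<^sup>2 + 1))"
proof -
  note e = cq_dim_pos[OF cq]
  have psd': "psd (2^n * dE) \<rho>'" using \<rho>' by (simp add: substate_def)
  note pos' = psd_pos[OF psd'] and \<rho>'b = fbounded_conv[OF psd_carrier[OF psd']]
  define t where "t = rtr (conv \<rho>')"
  have t: "0 < t" "t \<le> 1" using \<rho>'(1) rtr_conv[OF psd_carrier[OF psd']] by (auto simp: substate_def t_def)
  note XE = rho_XE_props[OF cq]
  have smooth: "rtr (U * (conv (rho_XE n dE \<rho>E) - conv \<rho>')) \<le> 2 * eps + eps\<^sup>2" if "contr U" for U
    using pdist_trace_bound(1)[OF XE \<rho>' _ that] eps by simp
  have t1: "1 - eps\<^sup>2 \<le> t" using pdist_trace_bound(2)[OF XE \<rho>'] eps by (simp add: t_def)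
  define P where "P = (\<lambda>x. (blk dE x)\<^sup>\<dagger> * conv \<rho>' * blk dE x)"
  define R where "R = (\<Sum>x<2^n. P x)"
  have Ppos: "pos (P x)" for x unfolding P_def by (rule pos_conj[OF pos'])
  have Rpos: "pos R" unfolding R_def by (intro pos_sum Ppos)
  have Rtr: "rtr R = t" unfolding R_def P_def t_def by (rule rtr_sum_blk_compress[OF e]) (use \<rho>'b in simp)
  have Rb: "fbounded (entry R) dE"
  proof (rule fbounded_of_mult_projf)
    show "R\<^sup>\<dagger> = R" by (rule pos_adjf[OF Rpos])
    show "R * projf dE = R"
      unfolding R_def P_def sum_distrib_right by (simp add: mult.assoc blk_projf[OF e])
  qed
  \<comment> \<open>The candidate in \<open>d_u\<close> must have the trace of the hashed state,
    which is 1, whereas \<open>R\<close> has trace \<open>t\<close>.\<close>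
  define \<tau>0 where "\<tau>0 = mat_of_fmat dE ((1 / t) *\<^sub>R R)"
  have \<tau>0: "psd dE \<tau>0" "conv \<tau>0 = (1 / t) *\<^sub>R R"
    unfolding \<tau>0_def using t by (auto intro!: pos_psd pos_scaleR Rpos conv_mat_of_fmat fbounded_scaleR Rb)
  have "rtr (conv \<tau>0) = 1" using t by (simp add: \<tau>0 rtr_scaleR Rtr)
  define r where "r = (\<lambda>k z. \<Sum>x\<in>{x\<in>{..<2^n}. Fam k x = z}. conv (\<rho>E x))"
  define q where "q = (\<lambda>k z. \<Sum>x\<in>{x\<in>{..<2^n}. Fam k x = z}. P x)"
  obtain U where U: "\<And>k z. contr (U k z)" and du: "2 * d_u (2^l) (2^S * dE) (rho_ZFE n l S dE Fam \<rho>E) \<le>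
      (1 / 2^S) * (\<Sum>k<2^S. \<Sum>z<2^l. rtr (U k z * (r k z - (1 / 2^l) *\<^sub>R ((1 / t) *\<^sub>R R))))"
    using d_u_dual[where Fam = Fam and S = S and l = l, OF cq range \<tau>0(1) \<open>rtr (conv \<tau>0) = 1\<close>] unfolding \<tau>0(2) r_def by blast
  have term1: "(\<Sum>z<2^l. rtr (U k z * (r k z - q k z))) \<le> 2 * eps + eps\<^sup>2" if k: "k < 2^S" for k
  proof -
    \<comment> \<open>Block \<open>x\<close> is tested with the contraction of its own hash value.
      The sum over \<open>z\<close> thereby becomes one trace against the block diagonal contraction
      \<open>B\<close>, to which the smoothing bound applies.\<close>
    define V where "V = (\<lambda>x. U k (Fam k x))"
    define B where "B = (\<Sum>x<2^n. blk dE x * V x * (blk dE x)\<^sup>\<dagger>)"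
    have B: "contr B" unfolding B_def V_def by (rule contr_block_diag[OF e U])
    have "(\<Sum>z<2^l. rtr (U k z * (r k z - q k z)))
      = (\<Sum>z<2^l. \<Sum>x\<in>{x\<in>{..<2^n}. Fam k x = z}. rtr (V x * (conv (\<rho>E x) - P x)))"
    proof (intro sum.cong refl)
      fix z
      have "rtr (U k z * (r k z - q k z)) = (\<Sum>x\<in>{x\<in>{..<2^n}. Fam k x = z}. rtr (U k z * (conv (\<rho>E x) - P x)))"
        unfolding r_def q_def sum_subtractf[symmetric] sum_distrib_left rtr_sum ..
      then show "rtr (U k z * (r k z - q k z)) = (\<Sum>x\<in>{x\<in>{..<2^n}. Fam k x = z}. rtr (V x * (conv (\<rho>E x) - P x)))"
        by (simp add: V_def)
    qed
    also have "\<dots> = (\<Sum>x<2^n. rtr (V x * (conv (\<rho>E x) - P x)))"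
      by (rule sum.group) (use range k in auto)
    also have "\<dots> = (\<Sum>x<2^n. rtr (V x * ((blk dE x)\<^sup>\<dagger> * (conv (rho_XE n dE \<rho>E) - conv \<rho>') * blk dE x)))"
    proof (intro sum.cong refl)
      fix x :: nat assume "x \<in> {..<2^n}"
      then have "(blk dE x)\<^sup>\<dagger> * conv (rho_XE n dE \<rho>E) * blk dE x = conv (\<rho>E x)"
        unfolding conv_rho_XE[OF cq]
        by (intro blk_compress_sum[OF e] fbounded_conv psd_carrier) (use cq in \<open>auto simp: cq_data_def\<close>)
      then show "rtr (V x * (conv (\<rho>E x) - P x))
        = rtr (V x * ((blk dE x)\<^sup>\<dagger> * (conv (rho_XE n dE \<rho>E) - conv \<rho>') * blk dE x))"
        by (simp add: P_def right_diff_distrib left_diff_distrib)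
    qed
    also have "\<dots> = rtr (B * (conv (rho_XE n dE \<rho>E) - conv \<rho>'))"
      unfolding B_def by (rule rtr_block_diag[symmetric])
    also have "\<dots> \<le> 2 * eps + eps\<^sup>2" by (rule smooth[OF B])
    finally show ?thesis .
  qed
  have term3: "rtr (U k z * ((1 / 2^l) *\<^sub>R (R - (1 / t) *\<^sub>R R))) \<le> (1 / 2^l) * eps\<^sup>2" for k z
  proof -
    have "rtr (U k z * ((1 / 2^l) *\<^sub>R (R - (1 / t) *\<^sub>R R))) = ((1 / 2^l) * (1 / t - 1)) * rtr (- U k z * R)"
      by (simp add: rtr_scaleR rtr_minus rtr_uminus right_diff_distrib left_diff_distrib)
    also have "\<dots> \<le> ((1 / 2^l) * (1 / t - 1)) * rtr R"
      using t by (intro mult_left_mono rtr_contr_pos_le contr_uminus U Rpos) auto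
    also have "\<dots> = (1 / 2^l) * (1 - t)" using t by (simp add: Rtr field_simps)
    also have "\<dots> \<le> (1 / 2^l) * eps\<^sup>2" using t1 by (intro mult_left_mono) auto
    finally show ?thesis .
  qed
  \<comment> \<open>Chosen so that \<open>c * eps\<^sup>2 = 2 powr (- lam)\<close>: the
    \<sigma>-part of \<open>c *\<^sub>R \<tau>\<close> then dominates every block.\<close>
  define c where "c = 2 powr (- lam) / eps\<^sup>2"
  define \<tau> where "\<tau> = R + eps\<^sup>2 *\<^sub>R conv \<sigma>"
  have \<sigma>pos: "pos (conv \<sigma>)" by (rule psd_pos[OF \<sigma>(1)])
  have \<sigma>tr: "rtr (conv \<sigma>) = 1" using psd_mtr[OF \<sigma>(1)] \<sigma>(2) by simp
  have \<tau>pos: "pos \<tau>" unfolding \<tau>_def by (intro pos_add Rpos pos_scaleR \<sigma>pos) auto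
  have \<tau>tr: "rtr \<tau> \<le> 1 + eps\<^sup>2" using t by (simp add: \<tau>_def rtr_add rtr_scaleR \<sigma>tr Rtr)
  have c: "0 \<le> c" by (simp add: c_def)
  have term2: "(\<Sum>k<2^S. \<Sum>z<2^l. rtr (U k z * (q k z - (1 / 2^l) *\<^sub>R R)))
    \<le> 2^S * sqrt (rtr \<tau> * (2^l * c + (\<delta> * 2^l - 1)))"
  proof -
    have "(\<Sum>k\<in>{..<2^S}. \<Sum>z\<in>{..<2^l}. rtr (U k z * ((\<Sum>x\<in>{x\<in>{..<2^n}. Fam k x = z}. P x)
          - (1 / real (card {..<(2^l::nat)})) *\<^sub>R (\<Sum>x\<in>{..<2^n}. P x))))
      \<le> real (card {..<(2^S::nat)}) * sqrt (rtr \<tau> * (real (card {..<(2^l::nat)}) * c + (\<delta> * real (card {..<(2^l::nat)}) - 1)))"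
    proof (rule leftover_hash_core)
      fix x :: nat assume "x \<in> {..<2^n}"
      then have "pos (2 powr (- lam) *\<^sub>R conv \<sigma> - P x)"
        unfolding P_def by (intro loewner_compress[OF e \<sigma>(1) le]) auto
      then have "pos (c *\<^sub>R R + (2 powr (- lam) *\<^sub>R conv \<sigma> - P x))"
        by (intro pos_add pos_scaleR Rpos c)
      moreover have "c *\<^sub>R \<tau> - P x = c *\<^sub>R R + (2 powr (- lam) *\<^sub>R conv \<sigma> - P x)"
        using eps by (simp add: \<tau>_def c_def scaleR_add_right)
      ultimately show "pos (c *\<^sub>R \<tau> - P x)" by (simp only:)
    next
      show "{..<(2::nat)^l} \<noteq> {}"
        by (metis card.empty card_lessThan power_not_zero zero_neq_numeral)
      show "pos (\<tau> - sum P {..<2^n})" unfolding R_def[symmetric] \<tau>_def using \<sigma>pos by (simp add: pos_scaleR)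
      show "rtr (sum P {..<2^n}) \<le> 1" unfolding R_def[symmetric] Rtr using t by simp
    qed (use range coll \<delta> Ppos \<tau>pos c U in auto)
    then show ?thesis by (simp add: R_def q_def)
  qed
  have "(\<Sum>k<2^S. \<Sum>z<2^l. rtr (U k z * (r k z - (1 / 2^l) *\<^sub>R ((1 / t) *\<^sub>R R))))
    = (\<Sum>k<2^S. \<Sum>z<2^l. rtr (U k z * (r k z - q k z))) + (\<Sum>k<2^S. \<Sum>z<2^l. rtr (U k z * (q k z - (1 / 2^l) *\<^sub>R R)))
      + (\<Sum>k<2^S. \<Sum>z<2^l. rtr (U k z * ((1 / 2^l) *\<^sub>R (R - (1 / t) *\<^sub>R R))))"
    unfolding sum.distrib[symmetric] rtr_add[symmetric] distrib_left[symmetric]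
    by (simp add: algebra_simps)
  also have "\<dots> \<le> (\<Sum>k<(2^S::nat). 2 * eps + eps\<^sup>2) + 2^S * sqrt (rtr \<tau> * (2^l * c + (\<delta> * 2^l - 1)))
      + (\<Sum>k<(2^S::nat). \<Sum>z<(2^l::nat). (1 / 2^l) * eps\<^sup>2)"
    by (intro add_mono sum_mono term1 term2 term3) auto
  also have "\<dots> = 2^S * (2 * eps + 2 * eps\<^sup>2 + sqrt (rtr \<tau> * (2^l * c + (\<delta> * 2^l - 1))))"
    by (simp add: algebra_simps)
  finally have "2 * d_u (2^l) (2^S * dE) (rho_ZFE n l S dE Fam \<rho>E)
    \<le> (1 / 2^S) * (2^S * (2 * eps + 2 * eps\<^sup>2 + sqrt (rtr \<tau> * (2^l * c + (\<delta> * 2^l - 1)))))"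
    using du by (elim order_trans) (intro mult_left_mono, auto)
  then have main: "2 * d_u (2^l) (2^S * dE) (rho_ZFE n l S dE Fam \<rho>E)
    \<le> 2 * eps + 2 * eps\<^sup>2 + sqrt (rtr \<tau> * (2^l * c + (\<delta> * 2^l - 1)))" by simp
  define w where "w = 2^l * 2 powr (- lam)"
  have w: "0 \<le> w" by (simp add: w_def)
  have "rtr \<tau> * (2^l * c + (\<delta> * 2^l - 1)) \<le> (1 + eps\<^sup>2) * (w / eps\<^sup>2 + 4 * eps\<^sup>2)"
    using \<tau>tr pos_rtr_nonneg[OF \<tau>pos] \<delta> c w by (intro mult_mono) (auto simp: c_def w_def)
  also have "\<dots> = (1 + eps\<^sup>2) * (w / eps\<^sup>2) + (1 + eps\<^sup>2) * (2 * eps)\<^sup>2"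
    by (simp add: distrib_left power_mult_distrib)
  also have "(1 + eps\<^sup>2) * (w / eps\<^sup>2) = w * (1 / eps\<^sup>2 + 1)"
    using eps by (simp add: distrib_left distrib_right)
  \<comment> \<open>Enlarging \<open>1 + eps\<^sup>2\<close> to its square makes the second summand
    a perfect square, so its root can be taken exactly after splitting the root of the sum.\<close>
  also have "w * (1 / eps\<^sup>2 + 1) + (1 + eps\<^sup>2) * (2 * eps)\<^sup>2 \<le> w * (2 / eps\<^sup>2 + 1) + (2 * eps * (1 + eps\<^sup>2))\<^sup>2"
  proof (intro add_mono mult_left_mono w)
    have "(1 + eps\<^sup>2) * (2 * eps)\<^sup>2 \<le> (1 + eps\<^sup>2)\<^sup>2 * (2 * eps)\<^sup>2"
      by (intro mult_right_mono) (auto simp: power2_eq_square[of "1 + eps\<^sup>2"] algebra_simps)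
    then show "(1 + eps\<^sup>2) * (2 * eps)\<^sup>2 \<le> (2 * eps * (1 + eps\<^sup>2))\<^sup>2"
      by (simp add: power_mult_distrib mult.commute)
  qed (auto simp: divide_right_mono)
  finally have "sqrt (rtr \<tau> * (2^l * c + (\<delta> * 2^l - 1)))
    \<le> sqrt (w * (2 / eps\<^sup>2 + 1) + (2 * eps * (1 + eps\<^sup>2))\<^sup>2)" by simp
  also have "\<dots> \<le> sqrt (w * (2 / eps\<^sup>2 + 1)) + sqrt ((2 * eps * (1 + eps\<^sup>2))\<^sup>2)"
    by (rule sqrt_add_le_add_sqrt) (use w in auto)
  also have "sqrt ((2 * eps * (1 + eps\<^sup>2))\<^sup>2) = 2 * eps * (1 + eps\<^sup>2)"
    using eps by (intro real_sqrt_unique) (auto intro!: mult_nonneg_nonneg add_nonneg_nonneg)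
  finally have "2 * d_u (2^l) (2^S * dE) (rho_ZFE n l S dE Fam \<rho>E)
    \<le> 2 * eps + 2 * eps\<^sup>2 + (sqrt (w * (2 / eps\<^sup>2 + 1)) + 2 * eps * (1 + eps\<^sup>2))"
    using main by linarith
  \<comment> \<open>Both \<open>eps\<^sup>2\<close> and \<open>eps * eps\<^sup>2\<close> are at most
    \<open>eps / 3\<close> as \<open>eps < 1/3\<close>; halving \<open>6 * eps\<close> gives the
    final \<open>3 * eps\<close>.\<close>
  also have "\<dots> \<le> 6 * eps + sqrt (w * (2 / eps\<^sup>2 + 1))"
  proof -
    have sq: "eps\<^sup>2 \<le> eps * (1/3)" using eps by (simp add: power2_eq_square)
    then have "eps * eps\<^sup>2 \<le> eps * (1/3)" using eps by (intro mult_left_mono) auto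
    moreover have "2 * eps * (1 + eps\<^sup>2) = 2 * eps + 2 * (eps * eps\<^sup>2)" by (simp add: algebra_simps)
    ultimately show ?thesis using sq eps by linarith
  qed
  finally show ?thesis by (simp add: w_def)
qed

text \<open>Every one of the \<open>D\<close> blocks has trace at most \<open>c\<close>. This limits
  the min-entropy by the input length when the output is longer than the input.\<close>

lemma loewner_rtr_le:
  assumes e: "0 < e" and \<sigma>: "psd e \<sigma>" "mtr \<sigma> = 1" and \<rho>: "psd (D * e) \<rho>"
    and le: "loewner_le (D * e) \<rho> (of_real c \<cdot>\<^sub>m kron (idm D) \<sigma>)"
  shows "rtr (conv \<rho>) \<le> real D * c"
proof -
  have "rtr (conv \<rho>) = (\<Sum>x<D. rtr ((blk e x)\<^sup>\<dagger> * conv \<rho> * blk e x))"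
    using rtr_sum_blk_compress[OF e fbounded_conv[OF psd_carrier[OF \<rho>]]] by (simp add: rtr_sum)
  also have "\<dots> \<le> (\<Sum>x<D. c)"
  proof (rule sum_mono)
    fix x assume "x \<in> {..<D}"
    then have "0 \<le> rtr (c *\<^sub>R conv \<sigma> - (blk e x)\<^sup>\<dagger> * conv \<rho> * blk e x)"
      by (intro pos_rtr_nonneg loewner_compress[OF e \<sigma>(1) le]) auto
    moreover have "rtr (conv \<sigma>) = 1" using psd_mtr[OF \<sigma>(1)] \<sigma>(2) by simp
    ultimately show "rtr ((blk e x)\<^sup>\<dagger> * conv \<rho> * blk e x) \<le> c" by (simp add: rtr_minus rtr_scaleR)
  qed
  finally show ?thesis by simp
qed

text \<open>Each eigenvalue is at most their sum, the trace; hence \<open>A\<close> lies below its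
  support projection \<open>Q\<close>, which lies below the corner identity.\<close>

lemma pos_le_projf:
  assumes "pos A" "fbounded (entry A) d" "rtr A \<le> 1"
  shows "pos (projf d - A)"
proof -
  obtain k E c where sf: "spectral_family k E" and c: "\<And>i. i < k \<Longrightarrow> 0 < c i"
    and A: "A = (\<Sum>i<k. c i *\<^sub>R E i)"
    using pos_spectral[OF assms(1)] by blast
  define Q where "Q = (\<Sum>i<k. 1 *\<^sub>R E i)"
  have Q: "Q\<^sup>\<dagger> = Q" "Q * Q = Q"
    unfolding Q_def by (rule spectral_family_adjf[OF sf]) (simp only: spectral_family_mult[OF sf] mult_1)
  have "Q = (\<Sum>i<k. inverse (c i) *\<^sub>R E i) * A"
    unfolding Q_def A spectral_family_mult[OF sf] using c
    by (intro sum.cong) (auto simp: less_imp_neq[THEN not_sym])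
  then have QP: "Q * projf d = Q" using mult_projf[OF assms(2)] by (metis mult.assoc)
  have PQ: "projf d * Q = Q" using arg_cong[OF QP, of adjf] by (simp add: adjf_mult Q)
  have "rtr A = (\<Sum>i<k. c i)"
    unfolding A rtr_sum rtr_scaleR using sf by (intro sum.cong) (auto simp: spectral_family_def)
  then have c1: "c i \<le> 1" if "i < k" for i
    using member_le_sum[of i "{..<k}" c] that c assms(3) by (force simp: less_imp_le)
  have "(projf d - Q) * (projf d - Q) = projf d - Q"
    by (simp add: algebra_simps Q PQ QP projf_idem)
  then have "pos (projf d - Q)" using pos_square[of "projf d - Q"] by (simp add: adjf_minus Q)
  then have "pos ((projf d - Q) + (\<Sum>i<k. (1 - c i) *\<^sub>R E i))"
    using c1 by (intro pos_add pos_spectral_sum[OF sf]) auto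
  also have "(projf d - Q) + (\<Sum>i<k. (1 - c i) *\<^sub>R E i) = projf d - A"
    by (simp add: Q_def A scaleR_diff_left sum_subtractf)
  finally show ?thesis .
qed

section \<open>A family with small collision probability\<close>

text \<open>All fields of characteristic 2 live inside one algebraic closure, so no irreducible
  polynomials have to be constructed.\<close>

type_synonym f2bar = "bit alg_closure"

lemma f2bar_two: "(2 :: f2bar) = 0"
proof -
  have "(2 :: bit) = 0" by simp
  then show ?thesis by (metis to_ac_0 to_ac_numeral)
qed

lemma f2bar_add_self [simp]: "(x :: f2bar) + x = 0"
  by (metis f2bar_two mult_2 mult_zero_left)

lemma f2bar_minus: "(x :: f2bar) - y = x + y"
  by (metis add_diff_cancel_right' diff_add_eq f2bar_add_self add.assoc add_0_right diff_0_right diff_add_cancel)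

lemma f2bar_frobenius: "(x + y :: f2bar) ^ (2^m) = x ^ (2^m) + y ^ (2^m)"
proof (induction m)
  case (Suc m)
  have "(x + y) ^ (2 ^ Suc m) = ((x + y) ^ (2^m))\<^sup>2" by (simp add: power_mult[symmetric] mult.commute)
  also have "\<dots> = (x ^ (2^m))\<^sup>2 + (y ^ (2^m))\<^sup>2 + 2 * (x ^ (2^m)) * (y ^ (2^m))"
    unfolding Suc by (simp add: power2_sum)
  also have "\<dots> = x ^ (2 ^ Suc m) + y ^ (2 ^ Suc m)"
    by (simp add: f2bar_two power_mult[symmetric] mult.commute)
  finally show ?case .
qed simp

text \<open>The fixed points of the \<open>m\<close>-fold Frobenius map: for \<open>m > 0\<close>
  the field with \<open>2^m\<close> elements.\<close>

definition GF2 :: "nat \<Rightarrow> f2bar set" where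
  "GF2 m = {x. x ^ (2^m) = x}"

lemma GF2_zero: "0 \<in> GF2 m" and GF2_add: "x \<in> GF2 m \<Longrightarrow> y \<in> GF2 m \<Longrightarrow> x + y \<in> GF2 m"
  and GF2_mult: "x \<in> GF2 m \<Longrightarrow> y \<in> GF2 m \<Longrightarrow> x * y \<in> GF2 m"
  and GF2_power: "x \<in> GF2 m \<Longrightarrow> x ^ k \<in> GF2 m"
  by (auto simp: GF2_def f2bar_frobenius power_mult_distrib) (metis power_commutes power_mult mult.commute)

lemma GF2_sum: "(\<And>i. i \<in> I \<Longrightarrow> f i \<in> GF2 m) \<Longrightarrow> (\<Sum>i\<in>I. f i) \<in> GF2 m"
  by (induction I rule: infinite_finite_induct) (auto simp: GF2_zero GF2_add)

text \<open>The elements are the roots of \<open>p = X^(2^m) - X\<close>, which splits in the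
  closure. Its derivative is the constant -1, so no root is repeated.\<close>

lemma card_GF2:
  assumes m: "0 < m"
  shows "finite (GF2 m)" "card (GF2 m) = 2^m"
proof -
  define p :: "f2bar poly" where "p = Polynomial.monom 1 (2^m) - Polynomial.monom 1 1"
  have m2: "(1::nat) < 2^m" by (rule one_less_power) (use m in auto)
  have deg: "Polynomial.degree p = 2^m"
    unfolding p_def diff_conv_add_uminus using m2
    by (subst Polynomial.degree_add_eq_left) (auto simp: degree_monom_eq)
  then have p0: "p \<noteq> 0" by auto
  have roots: "GF2 m = {x. poly p x = 0}" by (auto simp: GF2_def p_def poly_monom)
  have "(of_nat (2^m) :: f2bar) = 0" using m f2bar_two by simp
  then have pd: "pderiv p = [:-1:]"
    by (simp add: p_def pderiv_diff pderiv_monom monom_0 del: of_nat_power)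
  obtain A where A: "size A = Polynomial.degree p" "p = smult (Polynomial.lead_coeff p) (\<Prod>x\<in>#A. [:-x, 1:])"
    using alg_closed_imp_factorization[OF p0] by blast
  have lc: "Polynomial.lead_coeff p \<noteq> 0" using p0 by simp
  have "count A x \<le> 1" for x
  proof (rule ccontr)
    assume "\<not> count A x \<le> 1"
    then have "{#x, x#} \<subseteq># A" by (intro mset_subset_eqI) auto
    then obtain B where B: "A = {#x, x#} + B" by (auto simp: subset_mset.le_iff_add)
    define s where "s = smult (Polynomial.lead_coeff p) (\<Prod>y\<in>#B. [:-y, 1:])"
    have eq: "p = [:-x, 1:] * ([:-x, 1:] * s)"
      by (subst A(2)) (simp add: B s_def)
    have "pderiv p = [:-x, 1:] * pderiv ([:-x, 1:] * s) + [:-x, 1:] * s * pderiv [:-x, 1:]"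
      by (subst eq) (rule pderiv_mult)
    then have "poly (pderiv p) x = 0" by (simp only: poly_add poly_mult) simp
    then show False by (simp add: pd)
  qed
  then have "A = mset_set (set_mset A)"
    by (intro multiset_eqI) (metis count_mset_set(1,3) finite_set_mset not_in_iff
        count_greater_zero_iff le_antisym One_nat_def Suc_leI)
  then have "card (set_mset A) = size A" by (metis size_mset_set)
  moreover have "{x. poly p x = 0} = set_mset A"
    by (subst A(2)) (use lc in \<open>auto simp: poly_prod_mset prod_mset_zero_iff\<close>)
  ultimately show "finite (GF2 m)" "card (GF2 m) = 2^m" using A(1) deg roots by auto
qed

text \<open>Adjoining a coset \<open>w + H\<close> with \<open>w\<close> outside \<open>H\<close>
  doubles the size; the union is closed under addition since \<open>w + w = 0\<close>.\<close>

lemma GF2_subgroup: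
  assumes m: "0 < m"
  shows "j \<le> m \<Longrightarrow> \<exists>H. H \<subseteq> GF2 m \<and> card H = 2^j \<and> 0 \<in> H \<and> (\<forall>x\<in>H. \<forall>y\<in>H. x + y \<in> H)"
proof (induction j)
  case 0
  then show ?case by (intro exI[of _ "{0}"]) (auto simp: GF2_zero)
next
  case (Suc j)
  then obtain H where H: "H \<subseteq> GF2 m" "card H = 2^j" "0 \<in> H" "\<And>x y. x \<in> H \<Longrightarrow> y \<in> H \<Longrightarrow> x + y \<in> H"
    by auto
  have fin: "finite H" using H(1) card_GF2(1)[OF m] finite_subset by blast
  have "card H < card (GF2 m)" using H(2) card_GF2(2)[OF m] Suc.prems by simp
  then obtain w where w: "w \<in> GF2 m" "w \<notin> H" using H(1) by (metis less_irrefl subsetI subset_antisym)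
  define H' where "H' = H \<union> (\<lambda>h. w + h) ` H"
  have "H \<inter> (\<lambda>h. w + h) ` H = {}"
  proof (rule ccontr)
    assume "H \<inter> (\<lambda>h. w + h) ` H \<noteq> {}"
    then obtain h where h: "h \<in> H" "w + h \<in> H" by auto
    then have "(w + h) + h \<in> H" using H(4) by blast
    then show False using w by (simp add: add.assoc)
  qed
  then have "card H' = 2 ^ Suc j"
    unfolding H'_def using fin H(2) by (simp add: card_Un_disjoint card_image inj_on_def)
  moreover have "x + y \<in> H'" if xy: "x \<in> H'" "y \<in> H'" for x y
  proof -
    have *: "w + h \<in> H'" if "h \<in> H" for h using that by (simp add: H'_def)
    have "w + a + (w + b) = a + b" for a b
      by (metis add.assoc add.left_commute f2bar_add_self add_0_left)
    then show ?thesis using xy H(4) * unfolding H'_def by (auto simp: add.assoc add.left_commute)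
  qed
  ultimately show ?case
    using H w by (intro exI[of _ H']) (auto simp: H'_def GF2_add)
qed

text \<open>Truncation to \<open>l\<close> bits is modelled as the quotient by an additive subgroup
  of order \<open>2^(m - l)\<close>: \<phi> numbers its \<open>2^l\<close> cosets. In characteristic
  2, \<open>u + v\<close> is the difference.\<close>

lemma GF2_truncation:
  assumes m: "0 < m" and l: "l \<le> m"
  shows "\<exists>H \<phi>. H \<subseteq> GF2 m \<and> card H = 2^(m - l) \<and> (\<forall>u\<in>GF2 m. \<phi> u < (2::nat)^l) \<and>
    (\<forall>u\<in>GF2 m. \<forall>v\<in>GF2 m. \<phi> u = \<phi> v \<longrightarrow> u + v \<in> H)"
proof -
  obtain H where H: "H \<subseteq> GF2 m" "card H = 2^(m - l)" "0 \<in> H"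
    "\<And>x y. x \<in> H \<Longrightarrow> y \<in> H \<Longrightarrow> x + y \<in> H"
    using GF2_subgroup[OF m, of "m - l"] by auto
  note K = card_GF2[OF m]
  define cl where "cl = (\<lambda>u. (\<lambda>h. u + h) ` H)"
  have self: "u \<in> cl u" for u using H(3) by (auto simp: cl_def intro!: image_eqI[of _ _ 0])
  have cl_eq: "cl u = cl v" if w: "w \<in> cl u" "w \<in> cl v" for u v w
  proof -
    obtain a b where ab: "a \<in> H" "b \<in> H" "w = u + a" "w = v + b"
      using w unfolding cl_def by blast
    have "cl u' \<subseteq> cl v'" if "a' \<in> H" "b' \<in> H" "u' + a' = v' + b'" for u' v' a' b'
    proof
      fix y assume "y \<in> cl u'"
      then obtain h where h: "h \<in> H" "y = u' + h" by (auto simp: cl_def)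
      have "u' = u' + a' + a'" by (simp add: add.assoc)
      also have "\<dots> = v' + b' + a'" using that(3) by simp
      finally have "y = v' + (b' + a' + h)" using h by (simp add: add.assoc)
      then show "y \<in> cl v'" using H(4) that h by (auto simp: cl_def)
    qed
    then show ?thesis using ab by (metis subset_antisym)
  qed
  let ?Q = "cl ` GF2 m"
  have un: "\<Union>?Q = GF2 m"
    using self H(1) by (auto simp: cl_def intro: GF2_add)
  have "2^(m - l) * card ?Q = card (\<Union>?Q)"
  proof (rule card_partition)
    show "card c = 2^(m - l)" if "c \<in> ?Q" for c
      using that H(2) by (auto simp: cl_def card_image inj_on_def)
    show "c1 \<inter> c2 = {}" if "c1 \<in> ?Q" "c2 \<in> ?Q" "c1 \<noteq> c2" for c1 c2
      using that cl_eq by blast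
  qed (use K un in auto)
  then have "2^(m - l) * card ?Q = 2^(m - l) * 2^l"
    unfolding un K(2) using l by (simp add: power_add[symmetric])
  then have "card ?Q = card {..<(2::nat)^l}" by simp
  then obtain g where g: "bij_betw g ?Q {..<(2::nat)^l}"
    using finite_same_card_bij[of ?Q "{..<(2::nat)^l}"] K(1) by auto
  have "u + v \<in> H" if "u \<in> GF2 m" "v \<in> GF2 m" "g (cl u) = g (cl v)" for u v
  proof -
    have "cl u = cl v" using that g by (auto simp: bij_betw_def inj_on_def)
    then obtain h where "h \<in> H" "u = v + h" using self[of u] by (auto simp: cl_def)
    then show ?thesis by (simp add: add.assoc add.commute f2bar_two)
  qed
  moreover have "g (cl u) < 2^l" if "u \<in> GF2 m" for u
    using g that by (auto simp: bij_betw_def)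
  ultimately show ?thesis using H by (intro exI[of _ H] exI[of _ "\<lambda>u. g (cl u)"]) auto
qed

text \<open>Polynomial evaluation at \<open>a\<close> followed by multiplication with \<open>b\<close> and truncation. Two inputs
  collide either because \<open>a\<close> is a root of the difference of their polynomials, or because \<open>b\<close> moves
  the nonzero difference of the values into the kernel of the truncation.\<close>

lemma hash_family_exists:
  assumes m: "0 < m" and l: "l \<le> m" and n: "n \<le> m * r" and r: "0 < r"
  shows "\<exists>Fam :: nat \<Rightarrow> nat \<Rightarrow> nat. (\<forall>k<2^(2*m). \<forall>x<2^n. Fam k x < 2^l) \<and>
    (\<forall>x<2^n. \<forall>x'<2^n. x \<noteq> x' \<longrightarrow>
      card {k \<in> {..<2^(2*m)}. Fam k x = Fam k x'} \<le> (r - 1) * 2^m + 2^m * 2^(m - l))"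
proof -
  note K = card_GF2[OF m]
  obtain H \<phi> where H: "H \<subseteq> GF2 m" "card H = 2^(m - l)"
    and \<phi>: "\<And>u. u \<in> GF2 m \<Longrightarrow> \<phi> u < (2::nat)^l"
    and ker: "\<And>u v. u \<in> GF2 m \<Longrightarrow> v \<in> GF2 m \<Longrightarrow> \<phi> u = \<phi> v \<Longrightarrow> u + v \<in> H"
    using GF2_truncation[OF m l] by metis
  have finH: "finite H" using H(1) K(1) finite_subset by blast
  let ?C = "PiE {..<r} (\<lambda>_. GF2 m)"
  \<comment> \<open>As \<open>n \<le> m * r\<close>, the inputs inject into the
    \<open>r\<close>-tuples of field elements, which serve as polynomial coefficients.\<close>
  have "card {..<(2::nat)^n} \<le> card ?C"
    using n by (simp add: card_PiE K power_mult[symmetric] power_increasing)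
  then obtain enc where enc: "enc ` {..<2^n} \<subseteq> ?C" "inj_on enc {..<(2::nat)^n}"
    using card_le_inj[of "{..<(2::nat)^n}" ?C] K(1) by (auto intro: finite_PiE)
  define pol where "pol = (\<lambda>x. \<Sum>i<r. Polynomial.monom (enc x i) i)"
  have coeff_pol: "Polynomial.coeff (pol x) i = (if i < r then enc x i else 0)" for x i
    by (simp add: pol_def Polynomial.coeff_sum)
  have encK: "enc x i \<in> GF2 m" if "x < 2^n" "i < r" for x i
    using enc(1) that by (auto simp: PiE_iff)
  have polK: "poly (pol x) a \<in> GF2 m" if "x < 2^n" "a \<in> GF2 m" for x a
    unfolding pol_def poly_sum poly_monom using that encK by (intro GF2_sum GF2_mult GF2_power) auto
  have roots: "card {a \<in> GF2 m. poly (pol x) a = poly (pol x') a} \<le> r - 1"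
    if x: "x < 2^n" "x' < 2^n" "x \<noteq> x'" for x x'
  proof -
    have ne: "pol x - pol x' \<noteq> 0"
    proof
      assume "pol x - pol x' = 0"
      then have "Polynomial.coeff (pol x) i = Polynomial.coeff (pol x') i" for i by simp
      then have "enc x i = enc x' i" if "i < r" for i using that by (metis coeff_pol)
      then have "enc x = enc x'" using enc(1) x
        by (intro PiE_ext[of "enc x" "{..<r}" "\<lambda>_. GF2 m" "enc x'"]) auto
      then show False using enc(2) x by (auto simp: inj_on_def)
    qed
    have "card {a \<in> GF2 m. poly (pol x) a = poly (pol x') a} \<le> card {a. poly (pol x - pol x') a = 0}"
      using poly_roots_finite[OF ne] by (intro card_mono) auto
    also have "\<dots> \<le> Polynomial.degree (pol x - pol x')" by (rule card_poly_roots_bound[OF ne])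
    also have "\<dots> \<le> r - 1" using r by (intro Polynomial.degree_le) (auto simp: coeff_pol)
    finally show ?thesis .
  qed
  have "card {..<(2::nat)^(2*m)} = card (GF2 m \<times> GF2 m)"
    by (simp add: card_cartesian_product K power_add[symmetric] mult_2)
  then obtain g where g: "bij_betw g {..<(2::nat)^(2*m)} (GF2 m \<times> GF2 m)"
    using finite_same_card_bij[of "{..<(2::nat)^(2*m)}" "GF2 m \<times> GF2 m"] K(1) by auto
  define h where "h = (\<lambda>(a,b) x. \<phi> (b * poly (pol x) a))"
  have "card {k \<in> {..<2^(2*m)}. h (g k) x = h (g k) x'} \<le> (r - 1) * 2^m + 2^m * 2^(m - l)"
    if x: "x < 2^n" "x' < 2^n" "x \<noteq> x'" for x x'
  proof -
    define Z where "Z = {a \<in> GF2 m. poly (pol x) a = poly (pol x') a}"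
    define w where "w = (\<lambda>a. poly (pol x) a + poly (pol x') a)"
    define T where "T = (Z \<times> GF2 m) \<union> Sigma (GF2 m - Z) (\<lambda>a. {b \<in> GF2 m. b * w a \<in> H})"
    have finT: "finite T" unfolding T_def Z_def using K(1) by auto
    have "g ` {k \<in> {..<2^(2*m)}. h (g k) x = h (g k) x'} \<subseteq> T"
    proof
      fix ab assume "ab \<in> g ` {k \<in> {..<2^(2*m)}. h (g k) x = h (g k) x'}"
      then have "ab \<in> GF2 m \<times> GF2 m" "h ab x = h ab x'" using g by (auto simp: bij_betw_def)
      then obtain a b where ab: "ab = (a,b)" "a \<in> GF2 m" "b \<in> GF2 m"
        "\<phi> (b * poly (pol x) a) = \<phi> (b * poly (pol x') a)" by (auto simp: h_def)
      then have "b * poly (pol x) a + b * poly (pol x') a \<in> H"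
        by (intro ker GF2_mult polK x) auto
      then show "ab \<in> T" using ab by (auto simp: T_def w_def distrib_left)
    qed
    moreover have "inj_on g {k \<in> {..<2^(2*m)}. h (g k) x = h (g k) x'}"
      using g by (auto simp: bij_betw_def inj_on_def)
    ultimately have "card {k \<in> {..<2^(2*m)}. h (g k) x = h (g k) x'} \<le> card T"
      using card_inj_on_le finT by blast
    also have "\<dots> \<le> card (Z \<times> GF2 m) + card (Sigma (GF2 m - Z) (\<lambda>a. {b \<in> GF2 m. b * w a \<in> H}))"
      unfolding T_def by (rule card_Un_le)
    also have "card (Sigma (GF2 m - Z) (\<lambda>a. {b \<in> GF2 m. b * w a \<in> H})) \<le> 2^m * 2^(m - l)"
    proof -
      have "card {b \<in> GF2 m. b * w a \<in> H} \<le> 2^(m - l)" if "a \<in> GF2 m - Z" for a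
      proof -
        have "w a = poly (pol x) a - poly (pol x') a" by (simp only: w_def f2bar_minus)
        then have "w a \<noteq> 0" using that by (auto simp: Z_def)
        then have "card {b \<in> GF2 m. b * w a \<in> H} \<le> card H"
          by (intro card_inj_on_le[of "\<lambda>b. b * w a"] finH) (auto simp: inj_on_def)
        then show ?thesis using H by simp
      qed
      then have "(\<Sum>a\<in>GF2 m - Z. card {b \<in> GF2 m. b * w a \<in> H}) \<le> (\<Sum>a\<in>GF2 m - Z. 2^(m - l))"
        by (rule sum_mono)
      also have "\<dots> \<le> 2^m * 2^(m - l)"
        using card_mono[of "GF2 m" "GF2 m - Z"] K by simp
      finally show ?thesis using K(1) by (simp add: card_SigmaI)
    qed
    also have "card (Z \<times> GF2 m) \<le> (r - 1) * 2^m"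
      using roots[OF x] K by (simp add: card_cartesian_product Z_def)
    finally show ?thesis by simp
  qed
  moreover have "h (g k) x < 2^l" if "k < 2^(2*m)" "x < 2^n" for k x
  proof -
    have "g k \<in> GF2 m \<times> GF2 m" using g that by (auto simp: bij_betw_def)
    then show ?thesis using that polK by (auto simp: h_def intro!: \<phi> GF2_mult)
  qed
  ultimately show ?thesis by (intro exI[of _ "\<lambda>k. h (g k)"]) auto
qed

section \<open>Smooth min-entropy and the theorem\<close>

text \<open>The supremum in \<open>Hmin\<close> is informative only over a nonempty set. With
  \<sigma> maximally mixed and \<open>lam = - log 2 dB\<close>, the right side becomes the identity,
  which dominates any substate.\<close>

lemma Hmin_set_nonempty:
  assumes \<rho>: "substate (dA * dB) \<rho>" and dB: "0 < dB"
  shows "\<exists>lam \<sigma>. psd dB \<sigma> \<and> mtr \<sigma> = 1 \<and>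
    loewner_le (dA * dB) \<rho> (of_real (2 powr (- lam)) \<cdot>\<^sub>m kron (idm dA) \<sigma>)"
proof -
  have psd: "psd (dA * dB) \<rho>" and tr: "rtr (conv \<rho>) \<le> 1"
    using \<rho> rtr_conv[OF psd_carrier] by (auto simp: substate_def)
  define \<sigma> where "\<sigma> = mat_of_fmat dB ((1 / real dB) *\<^sub>R projf dB)"
  have b: "fbounded (entry ((1 / real dB) *\<^sub>R projf dB)) dB" by (rule fbounded_scaleR[OF fbounded_projf])
  have conv\<sigma>: "conv \<sigma> = (1 / real dB) *\<^sub>R projf dB" unfolding \<sigma>_def by (rule conv_mat_of_fmat[OF b])
  have \<sigma>c: "\<sigma> \<in> carrier_mat dB dB" by (simp add: \<sigma>_def)
  have "pos (projf dB)" using pos_square[of "projf dB"] by (simp add: projf_idem)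
  then have \<sigma>: "psd dB \<sigma>" unfolding psd_iff_pos[OF \<sigma>c] conv\<sigma> by (intro pos_scaleR) auto
  have \<sigma>tr: "mtr \<sigma> = 1" using psd_mtr[OF \<sigma>] dB by (simp add: conv\<sigma> rtr_scaleR rtr_projf)
  define lam where "lam = - log 2 (real dB)"
  have lam: "2 powr (- lam) = real dB" using dB by (simp add: lam_def)
  let ?W = "of_real (2 powr (- lam)) \<cdot>\<^sub>m kron (idm dA) \<sigma>"
  have Wc: "?W \<in> carrier_mat (dA * dB) (dA * dB)"
    by (intro smult_carrier_mat kron_carrier idm_carrier \<sigma>c)
  have "conv ?W = projf (dA * dB)"
    unfolding conv_smult conv_kron_idm[OF dB \<sigma>c] lam conv\<sigma> using dB blk_complete[OF dB, of dA]
    by (simp add: scaleR_sum_right[symmetric] mult_scaleR_right mult_scaleR_left)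
  then have "pos (conv (?W - \<rho>))"
    unfolding conv_minus[OF Wc psd_carrier[OF psd]]
    using pos_le_projf[OF psd_pos[OF psd] fbounded_conv[OF psd_carrier[OF psd]] tr] by simp
  then have "loewner_le (dA * dB) \<rho> ?W"
    unfolding loewner_le_def using Wc psd_carrier[OF psd] psd_iff_pos[OF minus_carrier_mat[OF psd_carrier[OF psd]]]
    by blast
  then show ?thesis using \<sigma> \<sigma>tr by blast
qed

text \<open>The state lies in its own ball, so the supremum in \<open>Hmin_smooth\<close> is over a
  nonempty set; the product of its two roots is the state itself, of trace norm 1.\<close>

lemma rho_XE_in_ball:
  assumes cq: "cq_data n dE \<rho>E" and eps: "0 \<le> eps"
  shows "substate (2^n * dE) (rho_XE n dE \<rho>E)"
    "pdist (2^n * dE) (rho_XE n dE \<rho>E) (rho_XE n dE \<rho>E) \<le> eps"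
proof -
  let ?d = "2^n * dE" and ?\<rho> = "rho_XE n dE \<rho>E"
  note XE = rho_XE_props[OF cq]
  note c = psd_carrier[OF XE(1)]
  have tr: "Re (mtr ?\<rho>) = 1" using rtr_conv[OF c] XE(2) by simp
  then show "substate ?d ?\<rho>" using XE by (simp add: substate_def)
  have "conv (mabs ?d ?\<rho>) = conv ?\<rho>"
    by (rule pos_sqrt_unique[OF psd_pos[OF mabs_props(1)[OF c]] psd_pos[OF XE(1)]])
      (simp add: mabs_props(2)[OF c] pos_adjf[OF psd_pos[OF XE(1)]])
  then have "tnorm ?d ?\<rho> = 1"
    unfolding tnorm_def using rtr_conv[OF psd_carrier[OF mabs_props(1)[OF c]]] XE(2) by simp
  then have "gen_fid ?d ?\<rho> ?\<rho> = 1"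
    unfolding gen_fid_def msqrt_props(2)[OF XE(1)] by (simp add: tr)
  then show "pdist ?d ?\<rho> ?\<rho> \<le> eps" using eps by (simp add: pdist_def)
qed

text \<open>The maxima are formalised as suprema, so witnesses are extracted only for values
  strictly below; \<open>d_u_bound_limit\<close> recovers the endpoint.\<close>

lemma Hmin_smooth_witness:
  assumes cq: "cq_data n dE \<rho>E" and eps: "0 \<le> eps"
    and lam: "lam < Hmin_smooth (2^n) dE eps (rho_XE n dE \<rho>E)"
  obtains \<rho>' \<sigma> lam' where "lam < lam'" "substate (2^n * dE) \<rho>'"
    "pdist (2^n * dE) (rho_XE n dE \<rho>E) \<rho>' \<le> eps" "psd dE \<sigma>" "mtr \<sigma> = 1"
    "loewner_le (2^n * dE) \<rho>' (of_real (2 powr (- lam')) \<cdot>\<^sub>m kron (idm (2^n)) \<sigma>)"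
proof -
  let ?A = "{Hmin (2^n) dE \<rho>' |\<rho>'. substate (2^n * dE) \<rho>' \<and> pdist (2^n * dE) (rho_XE n dE \<rho>E) \<rho>' \<le> eps}"
  have "?A \<noteq> {}" using rho_XE_in_ball[OF cq eps] by blast
  then obtain \<rho>' where \<rho>': "substate (2^n * dE) \<rho>'" "pdist (2^n * dE) (rho_XE n dE \<rho>E) \<rho>' \<le> eps"
    and lt: "lam < Hmin (2^n) dE \<rho>'"
    using lam less_cSupE[of lam ?A] unfolding Hmin_smooth_def by blast
  let ?B = "{lam. \<exists>\<sigma>. psd dE \<sigma> \<and> mtr \<sigma> = 1 \<and>
       loewner_le (2^n * dE) \<rho>' ((2 powr (- lam)) \<cdot>\<^sub>m kron (idm (2^n)) \<sigma>)}"
  have "?B \<noteq> {}" using Hmin_set_nonempty[OF \<rho>'(1) cq_dim_pos[OF cq]] by blast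
  then obtain lam' where "lam' \<in> ?B" "lam < lam'"
    using lt less_cSupE[of lam ?B] unfolding Hmin_def by blast
  then show thesis using that \<rho>' by blast
qed

text \<open>The right side is continuous in \<open>lam\<close>, so the bound survives the limit from
  the left.\<close>

lemma d_u_bound_limit:
  fixes Hs D a q :: real
  assumes "\<And>lam. lam < Hs \<Longrightarrow> D \<le> a + 1/2 * sqrt (2^l * 2 powr (- lam) * q)"
  shows "D \<le> a + 1/2 * sqrt (2^l * 2 powr (- Hs) * q)"
proof (rule tendsto_lowerbound)
  show "((\<lambda>lam. a + 1/2 * sqrt (2^l * 2 powr (- lam) * q)) \<longlongrightarrow> a + 1/2 * sqrt (2^l * 2 powr (- Hs) * q)) (at_left Hs)"
    by (intro tendsto_intros) auto
  show "\<forall>\<^sub>F lam in at_left Hs. D \<le> a + 1/2 * sqrt (2^l * 2 powr (- lam) * q)"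
    by (rule eventually_at_leftI[of "Hs - 1"]) (use assms in auto)
qed simp

text \<open>For \<open>eps < 1/3\<close> the term \<open>log 2 (1 / eps\<^sup>2)\<close> is at least
  1 and makes up for the subtracted 1, so that \<open>l \<le> m\<close>. The second bound controls
  the collisions caused by polynomial roots.\<close>

lemma hash_parameters:
  fixes n l :: nat and eps :: real
  defines "m \<equiv> nat \<lfloor>real l + log 2 (real n / real l) + log 2 (1 / eps\<^sup>2) - 1\<rfloor>"
  assumes l: "0 < l" and nl: "l \<le> n" and eps: "0 < eps" "eps < 1/3"
  shows "l \<le> m" "2^l * real ((n - 1) div m) \<le> 4 * eps\<^sup>2 * 2^m"
proof -
  define L where "L = real l + log 2 (real n / real l) + log 2 (1 / eps\<^sup>2) - 1"
  have "eps\<^sup>2 \<le> (1/3)\<^sup>2" using eps by (intro power_mono) auto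
  then have "eps\<^sup>2 * 2 \<le> 1" by (simp add: power2_eq_square)
  then have "2 \<le> 1 / eps\<^sup>2" using eps by (simp add: field_simps)
  then have "log 2 2 \<le> log 2 (1 / eps\<^sup>2)" by (subst log_le_cancel_iff) auto
  moreover have "0 \<le> log 2 (real n / real l)" using l nl by (subst zero_le_log_cancel_iff) auto
  ultimately have lL: "real l \<le> L" unfolding L_def by simp
  then have "int l \<le> \<lfloor>L\<rfloor>" by (simp add: le_floor_iff)
  then show lm: "l \<le> m" unfolding m_def L_def by simp
  \<comment> \<open>The floor loses at most 1 and \<open>L\<close> already contains a
    \<open>- 1\<close>; together these two binary digits make the factor 4.\<close>
  have "L - 1 \<le> real m"
    unfolding m_def L_def[symmetric] using lL by simp
  then have "2 powr (L - 1) \<le> 2 powr real m" by simp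
  also have "2 powr real m = 2^m" by (simp add: powr_realpow)
  also have "2 powr (L - 1) = 2^l * (real n / real l) * (1 / eps\<^sup>2) / 4"
    unfolding L_def using l nl eps by (simp add: powr_add powr_diff powr_realpow)
  finally have "4 * eps\<^sup>2 * (2^l * (real n / real l) * (1 / eps\<^sup>2) / 4) \<le> 4 * eps\<^sup>2 * 2^m"
    by (intro mult_left_mono) auto
  then have ge: "2^l * (real n / real l) \<le> 4 * eps\<^sup>2 * 2^m" using eps by simp
  have "l * ((n - 1) div m) \<le> m * ((n - 1) div m)" using lm by simp
  also have "\<dots> \<le> n" by (metis diff_le_self le_trans times_div_less_eq_dividend)
  finally have "real l * real ((n - 1) div m) \<le> real n" by (metis of_nat_le_iff of_nat_mult)
  then have "real ((n - 1) div m) \<le> real n / real l" using l by (simp add: field_simps)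
  then have "2^l * real ((n - 1) div m) \<le> 2^l * (real n / real l)" by (intro mult_left_mono) auto
  then show "2^l * real ((n - 1) div m) \<le> 4 * eps\<^sup>2 * 2^m" using ge by linarith
qed

theorem theorem4:
  fixes n l :: nat and eps :: real
  assumes "0 < n" and "0 < l" and "0 < eps"
    and "0 \<le> 2 * \<lfloor>real l + log 2 (real n / real l) + log 2 (1 / eps\<^sup>2) - 1\<rfloor>"
  shows "\<exists>Fam :: nat \<Rightarrow> nat \<Rightarrow> nat.
     (let S = nat (2 * \<lfloor>real l + log 2 (real n / real l) + log 2 (1 / eps\<^sup>2) - 1\<rfloor>) in
       (\<forall>k<2^S. \<forall>x<2^n. Fam k x < 2^l) \<and>
       (\<forall>dE \<rho>E. cq_data n dE \<rho>E \<longrightarrow>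
          d_u (2^l) (2^S * dE) (rho_ZFE n l S dE Fam \<rho>E)
            \<le> 3 * eps + 1/2 * sqrt (2 powr (real l - Hmin_smooth (2^n) dE eps (rho_XE n dE \<rho>E)
                                          + log 2 (2 / eps\<^sup>2 + 1)))))"
proof -
  define m where "m = nat \<lfloor>real l + log 2 (real n / real l) + log 2 (1 / eps\<^sup>2) - 1\<rfloor>"
  have S: "nat (2 * \<lfloor>real l + log 2 (real n / real l) + log 2 (1 / eps\<^sup>2) - 1\<rfloor>) = 2 * m"
    unfolding m_def by (simp add: nat_mult_distrib)
  define q where "q = 2 / eps\<^sup>2 + 1"
  have q: "0 < q" unfolding q_def by (intro add_nonneg_pos) auto
  have pw: "2 powr (real l - h + log 2 q) = 2^l * 2 powr (- h) * q" for h
    using q by (simp add: powr_add powr_diff powr_minus powr_realpow field_simps)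
  \<comment> \<open>The bound is kept for all \<open>lam\<close> strictly below the smooth
    min-entropy. The family is fixed before any state, so the limit can be taken afterwards for each
    state separately.\<close>
  define good where "good = (\<lambda>Fam :: nat \<Rightarrow> nat \<Rightarrow> nat. (\<forall>k<2^(2*m). \<forall>x<2^n. Fam k x < 2^l) \<and>
    (\<forall>dE \<rho>E. cq_data n dE \<rho>E \<longrightarrow> (\<forall>lam < Hmin_smooth (2^n) dE eps (rho_XE n dE \<rho>E).
       d_u (2^l) (2^(2*m) * dE) (rho_ZFE n l (2*m) dE Fam \<rho>E) \<le> 3 * eps + 1/2 * sqrt (2^l * 2 powr (- lam) * q))))"
  have "\<exists>Fam. good Fam"
  proof -
    consider "1/3 \<le> eps" | "eps < 1/3" "n < l" | "eps < 1/3" "l \<le> n" by linarith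
    then show ?thesis
    proof cases
      case 1
      have "d_u (2^l) (2^(2*m) * dE) (rho_ZFE n l (2*m) dE (\<lambda>_ _. 0) \<rho>E) \<le> 3 * eps + 1/2 * sqrt (2^l * 2 powr (- lam) * q)"
        if "cq_data n dE \<rho>E" for dE \<rho>E lam
      proof -
        have "d_u (2^l) (2^(2*m) * dE) (rho_ZFE n l (2*m) dE (\<lambda>_ _. 0) \<rho>E) \<le> 1"
          by (rule d_u_le_one[OF that]) auto
        moreover have "0 \<le> sqrt (2^l * 2 powr (- lam) * q)" using q by simp
        ultimately show ?thesis using 1 by linarith
      qed
      then show ?thesis unfolding good_def by (intro exI[of _ "\<lambda>_ _. 0"]) auto
    next
      \<comment> \<open>A witness has trace at least \<open>1 - eps\<^sup>2\<close>, hence at least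
        8/9, and at most \<open>2^n * 2 powr (- lam')\<close>. With \<open>n < l\<close> and
        \<open>q \<ge> 19\<close> the radicand exceeds 4, so half the root is at least 1.\<close>
      case 2
      have sq: "eps\<^sup>2 \<le> 1/9" using power_mono[of eps "1/3" 2] assms(3) 2(1) by (simp add: power2_eq_square)
      have q19: "19 \<le> q"
      proof -
        have "18 * eps\<^sup>2 \<le> 2" using sq by simp
        then have "18 \<le> 2 / eps\<^sup>2" using assms(3) by (simp add: field_simps)
        then show ?thesis by (simp add: q_def)
      qed
      have "d_u (2^l) (2^(2*m) * dE) (rho_ZFE n l (2*m) dE (\<lambda>_ _. 0) \<rho>E) \<le> 3 * eps + 1/2 * sqrt (2^l * 2 powr (- lam) * q)"
        if cq: "cq_data n dE \<rho>E" and lam: "lam < Hmin_smooth (2^n) dE eps (rho_XE n dE \<rho>E)" for dE \<rho>E lam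
      proof -
        have "d_u (2^l) (2^(2*m) * dE) (rho_ZFE n l (2*m) dE (\<lambda>_ _. 0) \<rho>E) \<le> 1"
          by (rule d_u_le_one[OF cq]) auto
        moreover have "2 \<le> sqrt (2^l * 2 powr (- lam) * q)"
        proof -
          obtain \<rho>' \<sigma> lam' where w: "lam < lam'" "substate (2^n * dE) \<rho>'"
            "pdist (2^n * dE) (rho_XE n dE \<rho>E) \<rho>' \<le> eps" "psd dE \<sigma>" "mtr \<sigma> = 1"
            "loewner_le (2^n * dE) \<rho>' (of_real (2 powr (- lam')) \<cdot>\<^sub>m kron (idm (2^n)) \<sigma>)"
            by (rule Hmin_smooth_witness[OF cq less_imp_le[OF assms(3)] lam])
          have "1 - eps\<^sup>2 \<le> rtr (conv \<rho>')"
            by (rule pdist_trace_bound(2)[OF rho_XE_props[OF cq] w(2,3)]) (use assms in auto)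
          also have "\<dots> \<le> real (2^n) * 2 powr (- lam')"
            using w(2) by (intro loewner_rtr_le[OF cq_dim_pos[OF cq] w(4,5) _ w(6)]) (auto simp: substate_def)
          also have "\<dots> \<le> 2^l * 2 powr (- lam)"
            using w(1) 2 by (intro mult_mono) (auto intro: power_increasing)
          finally have "8/9 \<le> 2^l * 2 powr (- lam)" using sq by simp
          then have "8/9 * 19 \<le> 2^l * 2 powr (- lam) * q" using q19 by (intro mult_mono) auto
          then show ?thesis by (intro real_le_rsqrt) simp
        qed
        ultimately show ?thesis using assms(3) by linarith
      qed
      then show ?thesis unfolding good_def by (intro exI[of _ "\<lambda>_ _. 0"]) auto
    next
      case 3
      note par = hash_parameters[OF assms(2) 3(2) assms(3) 3(1), folded m_def]
      have m: "0 < m" using par(1) assms(2) by simp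
      \<comment> \<open>The number of coefficients, \<open>n / m\<close> rounded up; the degree
        bound \<open>r - 1\<close> is the quotient in \<open>hash_parameters\<close>.\<close>
      define r where "r = Suc ((n - 1) div m)"
      have "n \<le> m * r"
      proof -
        have "n - 1 < m * r" unfolding r_def using m by (metis dividend_less_times_div mult_Suc_right)
        then show ?thesis by simp
      qed
      then obtain Fam :: "nat \<Rightarrow> nat \<Rightarrow> nat" where range: "\<And>k x. k < 2^(2*m) \<Longrightarrow> x < 2^n \<Longrightarrow> Fam k x < 2^l"
        and coll: "\<And>x x'. x < 2^n \<Longrightarrow> x' < 2^n \<Longrightarrow> x \<noteq> x' \<Longrightarrow>
          card {k \<in> {..<2^(2*m)}. Fam k x = Fam k x'} \<le> (r - 1) * 2^m + 2^m * 2^(m - l)"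
        using hash_family_exists[OF m par(1), of n r] unfolding r_def by blast
      \<comment> \<open>The collision count divided by the number \<open>2^(2*m)\<close> of seeds:
        truncation accounts for \<open>1 / 2^l\<close>, polynomial roots for the rest.\<close>
      define \<delta> :: real where "\<delta> = 1 / 2^l + real (r - 1) / 2^m"
      have "\<delta> * 2^(2*m) = 2^m * (2^m / 2^l) + real (r - 1) * 2^m"
        by (simp add: \<delta>_def mult_2 power_add distrib_right)
      also have "(2::real)^m / 2^l = 2^(m - l)" using par(1) by (simp add: power_diff)
      finally have "real ((r - 1) * 2^m + 2^m * 2^(m - l)) = \<delta> * 2^(2*m)" by simp
      then have coll': "real (card {k \<in> {..<2^(2*m)}. Fam k x = Fam k x'}) \<le> \<delta> * 2^(2*m)"
        if "x < 2^n" "x' < 2^n" "x \<noteq> x'" for x x'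
        using coll[OF that] by (metis of_nat_le_iff)
      have \<delta>': "\<delta> * 2^l - 1 = 2^l * real (r - 1) / 2^m" by (simp add: \<delta>_def distrib_right)
      have \<delta>1: "1 \<le> \<delta> * 2^l"
      proof -
        have "0 \<le> 2^l * real (r - 1) / 2^m" by simp
        then show ?thesis using \<delta>' by linarith
      qed
      have \<delta>2: "\<delta> * 2^l - 1 \<le> 4 * eps\<^sup>2"
        unfolding \<delta>' using par(2) by (simp add: r_def divide_le_eq)
      have "d_u (2^l) (2^(2*m) * dE) (rho_ZFE n l (2*m) dE Fam \<rho>E) \<le> 3 * eps + 1/2 * sqrt (2^l * 2 powr (- lam) * q)"
        if cq: "cq_data n dE \<rho>E" and lam: "lam < Hmin_smooth (2^n) dE eps (rho_XE n dE \<rho>E)" for dE \<rho>E lam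
      proof -
        obtain \<rho>' \<sigma> lam' where w: "lam < lam'" "substate (2^n * dE) \<rho>'"
          "pdist (2^n * dE) (rho_XE n dE \<rho>E) \<rho>' \<le> eps" "psd dE \<sigma>" "mtr \<sigma> = 1"
          "loewner_le (2^n * dE) \<rho>' (of_real (2 powr (- lam')) \<cdot>\<^sub>m kron (idm (2^n)) \<sigma>)"
          by (rule Hmin_smooth_witness[OF cq less_imp_le[OF assms(3)] lam])
        have "d_u (2^l) (2^(2*m) * dE) (rho_ZFE n l (2*m) dE Fam \<rho>E)
          \<le> 3 * eps + 1/2 * sqrt (2^l * 2 powr (- lam') * (2 / eps\<^sup>2 + 1))"
          by (rule leftover_hash_smooth[OF cq range coll' \<delta>1 \<delta>2 assms(3) 3(1) w(2-6)])
        also have "\<dots> \<le> 3 * eps + 1/2 * sqrt (2^l * 2 powr (- lam) * q)"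
          using w(1) q unfolding q_def[symmetric]
          by (intro add_left_mono mult_left_mono real_sqrt_le_mono mult_right_mono) auto
        finally show ?thesis .
      qed
      then show ?thesis unfolding good_def using range by (intro exI[of _ Fam]) auto
    qed
  qed
  then obtain Fam where range: "\<forall>k<2^(2*m). \<forall>x<2^n. Fam k x < 2^l"
    and bound: "\<And>dE \<rho>E lam. cq_data n dE \<rho>E \<Longrightarrow> lam < Hmin_smooth (2^n) dE eps (rho_XE n dE \<rho>E) \<Longrightarrow>
      d_u (2^l) (2^(2*m) * dE) (rho_ZFE n l (2*m) dE Fam \<rho>E) \<le> 3 * eps + 1/2 * sqrt (2^l * 2 powr (- lam) * q)"
    unfolding good_def by blast
  show ?thesis
    unfolding S Let_def q_def[symmetric] pw
    using range d_u_bound_limit[OF bound] by blast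
qed

end
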